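(* Let $M^n$ be a compact Riemannian manifold (without boundary) with non-negative Ricci curvature, and let $\mathcal{F}$ be a singular Riemannian foliation of $M$ with closed leaves and basic mean curvature. Then the first non-zero basic eigenvalue $\lambda_1^B$ of the Laplacian satisfies $$\lambda_1^B\geq \frac{\pi^2}{d_{M/\mathcal{F}}^2},$$ where $d_{M/\mathcal{F}}$ is the diameter of the leaf space $M/\mathcal{F}$.
   Context: A singular Riemannian foliation $\mathcal{F}$ of a Riemannian manifold $(M,g)$ is a decomposition of $M$ into connected injectively immersed submanifolds (leaves), possibly of different dimensions, such that (i) every geodesic orthogonal to one leaf is orthogonal to all leaves it intersects, and (ii) for every leaf $L$ and every $p\in L$, $T_pL=\{X_p: X\in\mathcal{X}_{\mathcal{F}}\}$, where $\mathcal{X}_{\mathcal{F}}$ is the module of smooth vector fields on $M$ that are everywhere tangent to the leaves. $L_p$ denotes the leaf through $p$. When all leaves are closed, the leaf space $M/\mathcal{F}$ carries the metric $\rho([L_p],[L_q])=d(L_p,L_q)=d(p,L_q)$, where $d$ is the Riemannian distance on $M$; its diameter is $d_{M/\mathcal{F}}=\sup_{L,L'\in\mathcal{F}} d(L,L')$. Let $\sigma:M\to M/\mathcal{F}$ be the natural projection. There is an open, dense, saturated, full-measure subset $N\subset M$ (the principal part) such that $N/\mathcal{F}$ is a smooth Riemannian manifold and $\sigma|_N:N\to N/\mathcal{F}$ is a Riemannian submersion. For $p\in N$ let $H(p)$ be the mean curvature vector of the leaf $L_p\subset M$. $\mathcal{F}$ has basic mean curvature if the vector field $H$ on $N$ is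 $\sigma$-related to a smooth vector field on $N/\mathcal{F}$. A function on $M$ is basic if it is constant on every leaf of $\mathcal{F}$. The Laplacian is $\Delta=\mathrm{div}\,\nabla$. A basic eigenvalue is a number $\lambda$ for which there is a non-zero smooth basic function $f$ on $M$ with $\Delta f=-\lambda f$; $\lambda_1^B$ is the smallest non-zero basic eigenvalue. *)

theory Defs
  imports "HOL-Analysis.Analysis"
begin

section \<open>Calculus on open subsets of coordinate space\<close>

text \<open>
  Coordinate space of dimension \<open>n\<close> is \<^term>\<open>Euclidean_space n\<close>, the space of real sequences
  vanishing from index \<open>n\<close> on. This makes the dimension a term, so that leaves of different
  dimensions and the leaf space can all be handled by one notion of manifold.
\<close>

definition pd :: "nat \<Rightarrow> ((nat \<Rightarrow> real) \<Rightarrow> real) \<Rightarrow> (nat \<Rightarrow> real) \<Rightarrow> real" where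
  "pd i f x = deriv (\<lambda>t. f (x(i := t))) (x i)"

text \<open>All iterated partial derivatives exist and are continuous on the open set \<open>W\<close>.\<close>

definition smooth_coord :: "nat \<Rightarrow> (nat \<Rightarrow> real) set \<Rightarrow> ((nat \<Rightarrow> real) \<Rightarrow> real) \<Rightarrow> bool" where
  "smooth_coord n W f \<longleftrightarrow>
     (\<forall>is \<in> lists {..<n}.
        continuous_map (subtopology (Euclidean_space n) W) euclideanreal (foldr pd is f) \<and>
        (\<forall>i<n. \<forall>x\<in>W. (\<lambda>t. foldr pd is f (x(i := t))) differentiable (at (x i))))"

definition smooth_real :: "real set \<Rightarrow> (real \<Rightarrow> real) \<Rightarrow> bool" where
  "smooth_real J f \<longleftrightarrow> (\<forall>k. \<forall>t\<in>J. ((deriv ^^ k) f) differentiable (at t))"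

definition inverse_coeffs :: "nat \<Rightarrow> (nat \<Rightarrow> nat \<Rightarrow> real) \<Rightarrow> nat \<Rightarrow> nat \<Rightarrow> real" where
  "inverse_coeffs n A =
     (THE B. (\<forall>i j. n \<le> i \<or> n \<le> j \<longrightarrow> B i j = 0) \<and>
             (\<forall>i<n. \<forall>j<n. (\<Sum>k<n. A i k * B k j) = of_bool (i = j)))"


section \<open>Smooth manifolds\<close>

type_synonym 'a chart = "'a set \<times> ('a \<Rightarrow> nat \<Rightarrow> real)"

record 'a mfd =
  mtop :: "'a topology"
  mdim :: nat
  matlas :: "'a chart set"

abbreviation mcarrier :: "'a mfd \<Rightarrow> 'a set" where
  "mcarrier M \<equiv> topspace (mtop M)"

abbreviation chart_inv :: "'a chart \<Rightarrow> (nat \<Rightarrow> real) \<Rightarrow> 'a" where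
  "chart_inv c \<equiv> inv_into (fst c) (snd c)"

text \<open>The atlas need not be maximal.\<close>

definition smooth_manifold :: "'a mfd \<Rightarrow> bool" where
  "smooth_manifold M \<longleftrightarrow>
     Hausdorff_space (mtop M) \<and> second_countable (mtop M) \<and>
     (\<Union>c\<in>matlas M. fst c) = mcarrier M \<and>
     (\<forall>(U, \<phi>)\<in>matlas M.
        openin (mtop M) U \<and> openin (Euclidean_space (mdim M)) (\<phi> ` U) \<and>
        homeomorphic_map (subtopology (mtop M) U)
                         (subtopology (Euclidean_space (mdim M)) (\<phi> ` U)) \<phi>) \<and>
     (\<forall>(U, \<phi>)\<in>matlas M. \<forall>(V, \<psi>)\<in>matlas M. \<forall>i<mdim M.
        smooth_coord (mdim M) (\<phi> ` (U \<inter> V)) (\<lambda>x. \<psi> (inv_into U \<phi> x) i))"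

definition open_submanifold :: "'a mfd \<Rightarrow> 'a set \<Rightarrow> 'a mfd" where
  "open_submanifold M N =
     \<lparr>mtop = subtopology (mtop M) N, mdim = mdim M, matlas = (\<lambda>(U, \<phi>). (U \<inter> N, \<phi>)) ` matlas M\<rparr>"

definition smooth_on :: "'a mfd \<Rightarrow> 'a set \<Rightarrow> ('a \<Rightarrow> real) \<Rightarrow> bool" where
  "smooth_on M W f \<longleftrightarrow>
     (\<forall>(U, \<phi>)\<in>matlas M. smooth_coord (mdim M) (\<phi> ` (U \<inter> W)) (\<lambda>x. f (inv_into U \<phi> x)))"

abbreviation smooth_function :: "'a mfd \<Rightarrow> ('a \<Rightarrow> real) \<Rightarrow> bool" where
  "smooth_function M f \<equiv> smooth_on M (mcarrier M) f"

definition smooth_near :: "'a mfd \<Rightarrow> 'a \<Rightarrow> ('a \<Rightarrow> real) \<Rightarrow> bool" where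
  "smooth_near M p f \<longleftrightarrow> (\<exists>W. openin (mtop M) W \<and> p \<in> W \<and> smooth_on M W f)"

definition smooth_map :: "'a mfd \<Rightarrow> 'b mfd \<Rightarrow> ('a \<Rightarrow> 'b) \<Rightarrow> bool" where
  "smooth_map M N F \<longleftrightarrow>
     continuous_map (mtop M) (mtop N) F \<and>
     (\<forall>(U, \<phi>)\<in>matlas M. \<forall>(V, \<psi>)\<in>matlas N. \<forall>i<mdim N.
        smooth_coord (mdim M) (\<phi> ` {p \<in> U. F p \<in> V}) (\<lambda>x. \<psi> (F (inv_into U \<phi> x)) i))"


section \<open>Tangent vectors and vector fields\<close>

text \<open>
  Tangent vectors at \<open>p\<close> are derivations on functions that are smooth near \<open>p\<close>, made total by the
  value 0 on all other functions. They depend only on germs: if \<open>f\<close> vanishes on a neighbourhood of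
  \<open>p\<close> with indicator function \<open>e\<close>, the Leibniz rule for \<open>e = e \<cdot> e\<close> and \<open>0 = e \<cdot> f\<close> gives \<open>v f = 0\<close>.
  In particular a manifold and an open submanifold have the same tangent vectors.
\<close>

type_synonym 'a tvec = "('a \<Rightarrow> real) \<Rightarrow> real"

definition tangent_space :: "'a mfd \<Rightarrow> 'a \<Rightarrow> 'a tvec set" where
  "tangent_space M p =
     {v. (\<forall>f. \<not> smooth_near M p f \<longrightarrow> v f = 0) \<and>
         (\<forall>f h. smooth_near M p f \<longrightarrow> smooth_near M p h \<longrightarrow>
            v (\<lambda>q. f q + h q) = v f + v h \<and>
            v (\<lambda>q. f q * h q) = f p * v h + h p * v f) \<and>
         (\<forall>f a. smooth_near M p f \<longrightarrow> v (\<lambda>q. a * f q) = a * v f)}"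

definition lincomb :: "nat \<Rightarrow> (nat \<Rightarrow> real) \<Rightarrow> (nat \<Rightarrow> 'a tvec) \<Rightarrow> 'a tvec" where
  "lincomb n a v = (\<lambda>f. \<Sum>i<n. a i * v i f)"

definition coord_vec :: "'a mfd \<Rightarrow> 'a chart \<Rightarrow> nat \<Rightarrow> 'a \<Rightarrow> 'a tvec" where
  "coord_vec M c i p =
     (\<lambda>f. if smooth_near M p f then pd i (\<lambda>x. f (chart_inv c x)) (snd c p) else 0)"

text \<open>The \<open>i\<close>-th component of a tangent vector is its value on the \<open>i\<close>-th coordinate function.\<close>

definition vcomp :: "'a chart \<Rightarrow> nat \<Rightarrow> 'a tvec \<Rightarrow> real" where
  "vcomp c i v = v (\<lambda>q. snd c q i)"

definition pushforward :: "'b mfd \<Rightarrow> ('a \<Rightarrow> 'b) \<Rightarrow> 'a \<Rightarrow> 'a tvec \<Rightarrow> 'b tvec" where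
  "pushforward N F p v = (\<lambda>h. if smooth_near N (F p) h then v (\<lambda>q. h (F q)) else 0)"

definition smooth_vector_field :: "'a mfd \<Rightarrow> ('a \<Rightarrow> 'a tvec) \<Rightarrow> bool" where
  "smooth_vector_field M X \<longleftrightarrow>
     (\<forall>p\<in>mcarrier M. X p \<in> tangent_space M p) \<and>
     (\<forall>f. smooth_function M f \<longrightarrow> smooth_function M (\<lambda>p. X p f))"

definition velocity :: "'a mfd \<Rightarrow> (real \<Rightarrow> 'a) \<Rightarrow> real \<Rightarrow> 'a tvec" where
  "velocity M \<gamma> t = (\<lambda>f. if smooth_near M (\<gamma> t) f then deriv (\<lambda>s. f (\<gamma> s)) t else 0)"

text \<open>Smooth curves are defined on open sets \<open>J\<close> of parameters.\<close>

definition smooth_curve :: "'a mfd \<Rightarrow> real set \<Rightarrow> (real \<Rightarrow> 'a) \<Rightarrow> bool" where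
  "smooth_curve M J \<gamma> \<longleftrightarrow>
     continuous_map (top_of_set J) (mtop M) \<gamma> \<and>
     (\<forall>(U, \<phi>)\<in>matlas M. \<forall>i<mdim M. smooth_real {t \<in> J. \<gamma> t \<in> U} (\<lambda>t. \<phi> (\<gamma> t) i))"


section \<open>Riemannian manifolds\<close>

type_synonym 'a rmetric = "'a \<Rightarrow> 'a tvec \<Rightarrow> 'a tvec \<Rightarrow> real"

definition riemannian_metric :: "'a mfd \<Rightarrow> 'a rmetric \<Rightarrow> bool" where
  "riemannian_metric M g \<longleftrightarrow>
     (\<forall>p\<in>mcarrier M. \<forall>u\<in>tangent_space M p. \<forall>v\<in>tangent_space M p.
        g p u v = g p v u \<and>
        (u \<noteq> (\<lambda>f. 0) \<longrightarrow> g p u u > 0) \<and>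
        (\<forall>w\<in>tangent_space M p. \<forall>a b.
           g p (\<lambda>f. a * u f + b * v f) w = a * g p u w + b * g p v w)) \<and>
     (\<forall>X Y. smooth_vector_field M X \<longrightarrow> smooth_vector_field M Y \<longrightarrow>
        smooth_function M (\<lambda>p. g p (X p) (Y p)))"

definition riemannian_manifold :: "'a mfd \<Rightarrow> 'a rmetric \<Rightarrow> bool" where
  "riemannian_manifold M g \<longleftrightarrow> smooth_manifold M \<and> riemannian_metric M g"

subsection \<open>Distance\<close>

definition piecewise_smooth_path :: "'a mfd \<Rightarrow> (real \<Rightarrow> 'a) \<Rightarrow> bool" where
  "piecewise_smooth_path M \<gamma> \<longleftrightarrow>
     continuous_map (top_of_set {0..1}) (mtop M) \<gamma> \<and>
     (\<exists>m s. s 0 = 0 \<and> s m = 1 \<and>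
        (\<forall>i<m. s i < s (Suc i) \<and>
           (\<exists>e>0. \<exists>c. smooth_curve M {s i - e<..<s (Suc i) + e} c \<and>
                      (\<forall>t\<in>{s i..s (Suc i)}. \<gamma> t = c t))))"

definition path_length :: "'a mfd \<Rightarrow> 'a rmetric \<Rightarrow> (real \<Rightarrow> 'a) \<Rightarrow> real" where
  "path_length M g \<gamma> =
     integral {0..1} (\<lambda>t. sqrt (g (\<gamma> t) (velocity M \<gamma> t) (velocity M \<gamma> t)))"

definition rdist :: "'a mfd \<Rightarrow> 'a rmetric \<Rightarrow> 'a \<Rightarrow> 'a \<Rightarrow> real" where
  "rdist M g p q =
     Inf {path_length M g \<gamma> | \<gamma>. piecewise_smooth_path M \<gamma> \<and> \<gamma> 0 = p \<and> \<gamma> 1 = q}"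

subsection \<open>Levi-Civita connection, Ricci curvature and Laplacian\<close>

definition metric_coeff ::
  "'a mfd \<Rightarrow> 'a rmetric \<Rightarrow> 'a chart \<Rightarrow> nat \<Rightarrow> nat \<Rightarrow> (nat \<Rightarrow> real) \<Rightarrow> real" where
  "metric_coeff M g c i j x =
     (let p = chart_inv c x in g p (coord_vec M c i p) (coord_vec M c j p))"

text \<open>\<open>christoffel M g c k i j\<close> is the Christoffel symbol with upper index \<open>k\<close> and lower
  indices \<open>i, j\<close>, as a function of the coordinates.\<close>

definition christoffel ::
  "'a mfd \<Rightarrow> 'a rmetric \<Rightarrow> 'a chart \<Rightarrow> nat \<Rightarrow> nat \<Rightarrow> nat \<Rightarrow> (nat \<Rightarrow> real) \<Rightarrow> real" where
  "christoffel M g c k i j x =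
     (\<Sum>l<mdim M. inverse_coeffs (mdim M) (\<lambda>a b. metric_coeff M g c a b x) k l *
        (pd i (metric_coeff M g c j l) x + pd j (metric_coeff M g c i l) x
         - pd l (metric_coeff M g c i j) x)) / 2"

text \<open>The Ricci tensor and the divergence below are given by coordinate formulas whose values do
  not depend on the chart; an arbitrary chart around the point is selected.\<close>

definition chart_at :: "'a mfd \<Rightarrow> 'a \<Rightarrow> 'a chart" where
  "chart_at M p = (SOME c. c \<in> matlas M \<and> p \<in> fst c)"

definition ricci_coeff ::
  "'a mfd \<Rightarrow> 'a rmetric \<Rightarrow> 'a chart \<Rightarrow> nat \<Rightarrow> nat \<Rightarrow> (nat \<Rightarrow> real) \<Rightarrow> real" where
  "ricci_coeff M g c j k x =
     (let n = mdim M; \<Gamma> = christoffel M g c in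
      \<Sum>i<n. pd i (\<Gamma> i j k) x - pd k (\<Gamma> i j i) x
             + (\<Sum>l<n. \<Gamma> i i l x * \<Gamma> l j k x - \<Gamma> i k l x * \<Gamma> l j i x))"

definition ricci :: "'a mfd \<Rightarrow> 'a rmetric \<Rightarrow> 'a \<Rightarrow> 'a tvec \<Rightarrow> 'a tvec \<Rightarrow> real" where
  "ricci M g p v w =
     (let c = chart_at M p in
      \<Sum>j<mdim M. \<Sum>k<mdim M. ricci_coeff M g c j k (snd c p) * vcomp c j v * vcomp c k w)"

definition nonneg_ricci :: "'a mfd \<Rightarrow> 'a rmetric \<Rightarrow> bool" where
  "nonneg_ricci M g \<longleftrightarrow> (\<forall>p\<in>mcarrier M. \<forall>v\<in>tangent_space M p. ricci M g p v v \<ge> 0)"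

definition gradient :: "'a mfd \<Rightarrow> 'a rmetric \<Rightarrow> ('a \<Rightarrow> real) \<Rightarrow> 'a \<Rightarrow> 'a tvec" where
  "gradient M g f p =
     (THE v. v \<in> tangent_space M p \<and> (\<forall>w\<in>tangent_space M p. g p v w = w f))"

text \<open>The divergence is the trace of \<open>v \<mapsto> \<nabla>\<^sub>v X\<close>.\<close>

definition divergence :: "'a mfd \<Rightarrow> 'a rmetric \<Rightarrow> ('a \<Rightarrow> 'a tvec) \<Rightarrow> 'a \<Rightarrow> real" where
  "divergence M g X p =
     (let c = chart_at M p in
      \<Sum>i<mdim M. coord_vec M c i p (\<lambda>q. vcomp c i (X q))
        + (\<Sum>j<mdim M. christoffel M g c i i j (snd c p) * vcomp c j (X p)))"

definition laplacian :: "'a mfd \<Rightarrow> 'a rmetric \<Rightarrow> ('a \<Rightarrow> real) \<Rightarrow> 'a \<Rightarrow> real" where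
  "laplacian M g f p = divergence M g (gradient M g f) p"

definition geodesic :: "'a mfd \<Rightarrow> 'a rmetric \<Rightarrow> real set \<Rightarrow> (real \<Rightarrow> 'a) \<Rightarrow> bool" where
  "geodesic M g J \<gamma> \<longleftrightarrow>
     open J \<and> is_interval J \<and> smooth_curve M J \<gamma> \<and>
     (\<forall>c\<in>matlas M. \<forall>t\<in>J. \<gamma> t \<in> fst c \<longrightarrow>
        (\<forall>k<mdim M.
           deriv (deriv (\<lambda>s. snd c (\<gamma> s) k)) t
           + (\<Sum>i<mdim M. \<Sum>j<mdim M. christoffel M g c k i j (snd c (\<gamma> t))
                * deriv (\<lambda>s. snd c (\<gamma> s) i) t * deriv (\<lambda>s. snd c (\<gamma> s) j) t) = 0))"


section \<open>Immersed submanifolds\<close>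

text \<open>
  An immersed submanifold carries its own topology and atlas; only its underlying set is a subset
  of \<open>M\<close>. The immersion is the inclusion, so it is automatically injective.
\<close>

definition immersed_submanifold :: "'a mfd \<Rightarrow> 'a mfd \<Rightarrow> bool" where
  "immersed_submanifold M L \<longleftrightarrow>
     smooth_manifold L \<and> mcarrier L \<subseteq> mcarrier M \<and> smooth_map L M (\<lambda>q. q) \<and>
     (\<forall>p\<in>mcarrier L. inj_on (pushforward M (\<lambda>q. q) p) (tangent_space L p))"

text \<open>\<open>T\<^sub>pL\<close> as a subspace of \<open>T\<^sub>pM\<close>.\<close>

definition tangent_sub :: "'a mfd \<Rightarrow> 'a mfd \<Rightarrow> 'a \<Rightarrow> 'a tvec set" where
  "tangent_sub M L p = pushforward M (\<lambda>q. q) p ` tangent_space L p"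

text \<open>
  For charts \<open>c\<close> of \<open>M\<close> and \<open>d\<close> of \<open>L\<close> around \<open>p\<close>, the following is the ambient covariant
  derivative at \<open>p\<close>, in the direction of the \<open>a\<close>-th coordinate field of \<open>L\<close>, of the \<open>b\<close>-th one.
  Its normal part is the value of the second fundamental form on these two coordinate vectors.
\<close>

definition sub_cov_deriv ::
  "'a mfd \<Rightarrow> 'a rmetric \<Rightarrow> 'a chart \<Rightarrow> 'a chart \<Rightarrow> 'a \<Rightarrow> nat \<Rightarrow> nat \<Rightarrow> 'a tvec" where
  "sub_cov_deriv M g c d p a b =
     (let n = mdim M; u = snd d p; F = (\<lambda>l y. snd c (chart_inv d y) l) in
      lincomb n
        (\<lambda>l. pd a (pd b (F l)) u
             + (\<Sum>i<n. \<Sum>j<n. christoffel M g c l i j (snd c p) * pd a (F i) u * pd b (F j) u))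
        (\<lambda>l. coord_vec M c l p))"

definition sub_metric_coeff ::
  "'a mfd \<Rightarrow> 'a rmetric \<Rightarrow> 'a mfd \<Rightarrow> 'a chart \<Rightarrow> 'a \<Rightarrow> nat \<Rightarrow> nat \<Rightarrow> real" where
  "sub_metric_coeff M g L d p a b =
     g p (pushforward M (\<lambda>q. q) p (coord_vec L d a p))
         (pushforward M (\<lambda>q. q) p (coord_vec L d b p))"

text \<open>
  The mean curvature vector is the trace of the second fundamental form (not divided by the
  dimension), that is, the normal part of the trace of the covariant derivatives above with respect
  to the induced metric.
\<close>

definition mean_curvature :: "'a mfd \<Rightarrow> 'a rmetric \<Rightarrow> 'a mfd \<Rightarrow> 'a \<Rightarrow> 'a tvec" where
  "mean_curvature M g L p =
     (THE H. H \<in> tangent_space M p \<and> (\<forall>v\<in>tangent_sub M L p. g p H v = 0) \<and>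
        (\<forall>c\<in>matlas M. \<forall>d\<in>matlas L. p \<in> fst c \<longrightarrow> p \<in> fst d \<longrightarrow>
           (\<lambda>f. (\<Sum>a<mdim L. \<Sum>b<mdim L.
                   inverse_coeffs (mdim L) (sub_metric_coeff M g L d p) a b
                     * sub_cov_deriv M g c d p a b f) - H f)
           \<in> tangent_sub M L p))"


section \<open>Singular Riemannian foliations\<close>

text \<open>A foliation is given as the set of its leaves, each with its manifold structure.\<close>

definition tangent_fields :: "'a mfd \<Rightarrow> 'a mfd set \<Rightarrow> ('a \<Rightarrow> 'a tvec) set" where
  "tangent_fields M \<F> =
     {X. smooth_vector_field M X \<and> (\<forall>L\<in>\<F>. \<forall>p\<in>mcarrier L. X p \<in> tangent_sub M L p)}"

definition orthogonal_at ::
  "'a mfd \<Rightarrow> 'a rmetric \<Rightarrow> (real \<Rightarrow> 'a) \<Rightarrow> real \<Rightarrow> 'a mfd \<Rightarrow> bool" where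
  "orthogonal_at M g \<gamma> t L \<longleftrightarrow> (\<forall>v\<in>tangent_sub M L (\<gamma> t). g (\<gamma> t) (velocity M \<gamma> t) v = 0)"

definition singular_riemannian_foliation ::
  "'a mfd \<Rightarrow> 'a rmetric \<Rightarrow> 'a mfd set \<Rightarrow> bool" where
  "singular_riemannian_foliation M g \<F> \<longleftrightarrow>
     (\<forall>L\<in>\<F>. immersed_submanifold M L \<and> connected_space (mtop L) \<and> mcarrier L \<noteq> {}) \<and>
     (\<Union>L\<in>\<F>. mcarrier L) = mcarrier M \<and>
     (\<forall>L\<in>\<F>. \<forall>L'\<in>\<F>. L \<noteq> L' \<longrightarrow> mcarrier L \<inter> mcarrier L' = {}) \<and>
     (\<forall>J \<gamma>. geodesic M g J \<gamma> \<longrightarrow>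
        (\<forall>t\<in>J. \<forall>L\<in>\<F>. \<gamma> t \<in> mcarrier L \<and> orthogonal_at M g \<gamma> t L \<longrightarrow>
           (\<forall>t'\<in>J. \<forall>L'\<in>\<F>. \<gamma> t' \<in> mcarrier L' \<longrightarrow> orthogonal_at M g \<gamma> t' L'))) \<and>
     (\<forall>L\<in>\<F>. \<forall>p\<in>mcarrier L. tangent_sub M L p = {X p | X. X \<in> tangent_fields M \<F>})"

definition closed_leaves :: "'a mfd \<Rightarrow> 'a mfd set \<Rightarrow> bool" where
  "closed_leaves M \<F> \<longleftrightarrow> (\<forall>L\<in>\<F>. closedin (mtop M) (mcarrier L))"

text \<open>The points of the leaf space are the underlying sets of the leaves.\<close>

definition leaf_proj :: "'a mfd set \<Rightarrow> 'a \<Rightarrow> 'a set" where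
  "leaf_proj \<F> p = (THE S. S \<in> mcarrier ` \<F> \<and> p \<in> S)"

definition leaf_dist :: "'a mfd \<Rightarrow> 'a rmetric \<Rightarrow> 'a mfd \<Rightarrow> 'a mfd \<Rightarrow> real" where
  "leaf_dist M g L L' = Inf {rdist M g p q | p q. p \<in> mcarrier L \<and> q \<in> mcarrier L'}"

definition leaf_space_diameter :: "'a mfd \<Rightarrow> 'a rmetric \<Rightarrow> 'a mfd set \<Rightarrow> real" where
  "leaf_space_diameter M g \<F> = Sup {leaf_dist M g L L' | L L'. L \<in> \<F> \<and> L' \<in> \<F>}"

subsection \<open>Principal part and basic mean curvature\<close>

definition riemannian_submersion ::
  "'a mfd \<Rightarrow> 'a rmetric \<Rightarrow> 'b mfd \<Rightarrow> 'b rmetric \<Rightarrow> ('a \<Rightarrow> 'b) \<Rightarrow> bool" where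
  "riemannian_submersion M g Q h \<sigma> \<longleftrightarrow>
     smooth_map M Q \<sigma> \<and>
     (\<forall>p\<in>mcarrier M.
        let T = tangent_space M p; D = pushforward Q \<sigma> p;
            horizontal = {v \<in> T. \<forall>w\<in>T. D w = (\<lambda>f. 0) \<longrightarrow> g p v w = 0}
        in D ` T = tangent_space Q (\<sigma> p) \<and>
           (\<forall>v\<in>horizontal. \<forall>w\<in>horizontal. h (\<sigma> p) (D v) (D w) = g p v w))"

definition null_subset :: "'a mfd \<Rightarrow> 'a set \<Rightarrow> bool" where
  "null_subset M A \<longleftrightarrow>
     (\<forall>(U, \<phi>)\<in>matlas M.
        (\<lambda>p. restrict (\<phi> p) {..<mdim M}) ` (U \<inter> A)
          \<in> null_sets (completion (Pi\<^sub>M {..<mdim M} (\<lambda>_. lborel))))"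

text \<open>
  \<open>N\<close> is an open, dense, saturated set of full measure, and \<open>(Q, h)\<close> is a Riemannian manifold
  structure on the quotient of \<open>N\<close> by the leaves for which the projection is a Riemannian submersion.
\<close>

definition principal_part ::
  "'a mfd \<Rightarrow> 'a rmetric \<Rightarrow> 'a mfd set \<Rightarrow> 'a set \<Rightarrow> 'a set mfd \<Rightarrow> 'a set rmetric \<Rightarrow> bool" where
  "principal_part M g \<F> N Q h \<longleftrightarrow>
     openin (mtop M) N \<and> mtop M closure_of N = mcarrier M \<and>
     (\<forall>L\<in>\<F>. mcarrier L \<inter> N \<noteq> {} \<longrightarrow> mcarrier L \<subseteq> N) \<and>
     null_subset M (mcarrier M - N) \<and>
     riemannian_manifold Q h \<and>
     quotient_map (subtopology (mtop M) N) (mtop Q) (leaf_proj \<F>) \<and>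
     riemannian_submersion (open_submanifold M N) g Q h (leaf_proj \<F>)"

text \<open>
  A set \<open>N\<close> with the above properties is not unique, but any two of them meet in a third one and
  the mean curvature fields are continuous, so the choice does not affect whether they are basic.
\<close>

definition basic_mean_curvature :: "'a mfd \<Rightarrow> 'a rmetric \<Rightarrow> 'a mfd set \<Rightarrow> bool" where
  "basic_mean_curvature M g \<F> \<longleftrightarrow>
     (\<exists>N Q h Y. principal_part M g \<F> N Q h \<and> smooth_vector_field Q Y \<and>
        (\<forall>L\<in>\<F>. \<forall>p\<in>mcarrier L \<inter> N.
           pushforward Q (leaf_proj \<F>) p (mean_curvature M g L p) = Y (leaf_proj \<F> p)))"

subsection \<open>Basic eigenvalues\<close>

definition basic_function :: "'a mfd set \<Rightarrow> ('a \<Rightarrow> real) \<Rightarrow> bool" where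
  "basic_function \<F> f \<longleftrightarrow> (\<forall>L\<in>\<F>. \<forall>p\<in>mcarrier L. \<forall>q\<in>mcarrier L. f p = f q)"

definition basic_eigenvalue :: "'a mfd \<Rightarrow> 'a rmetric \<Rightarrow> 'a mfd set \<Rightarrow> real \<Rightarrow> bool" where
  "basic_eigenvalue M g \<F> lam \<longleftrightarrow>
     (\<exists>f. smooth_function M f \<and> basic_function \<F> f \<and> (\<exists>p\<in>mcarrier M. f p \<noteq> 0) \<and>
          (\<forall>p\<in>mcarrier M. laplacian M g f p = - lam * f p))"

definition first_nonzero_basic_eigenvalue ::
  "'a mfd \<Rightarrow> 'a rmetric \<Rightarrow> 'a mfd set \<Rightarrow> real \<Rightarrow> bool" where
  "first_nonzero_basic_eigenvalue M g \<F> lam \<longleftrightarrow>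
     basic_eigenvalue M g \<F> lam \<and> lam \<noteq> 0 \<and>
     (\<forall>\<mu>. basic_eigenvalue M g \<F> \<mu> \<and> \<mu> \<noteq> 0 \<longrightarrow> lam \<le> \<mu>)"

end

theory Submission
  imports Defs
begin

text \<open>
  Let \<open>u\<close> be a basic eigenfunction for \<open>lam\<close>, with range \<open>[- k, K]\<close>, where \<open>K \<ge> k\<close> after a change
  of sign. Put \<open>\<beta> = ln (K / k) / \<pi>\<close>, \<open>\<mu>\<^sup>2 = lam / (1 + \<beta>\<^sup>2)\<close> and write \<open>u = A w(\<theta>)\<close> for
  \<open>w(s) = exp (\<beta> s) (\<beta> sin s - cos s)\<close> and \<open>A\<close> slightly larger than \<open>k\<close>, so that \<open>\<theta>\<close> is a smooth
  function with values in \<open>(0, \<pi>)\<close>. Then \<open>P = |\<nabla>\<theta>|\<^sup>2\<close> satisfies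
  \<open>\<Delta>\<theta> = (\<beta> - cot \<theta>) (P - \<mu>\<^sup>2) - 2 \<beta> P\<close>. At a maximum of \<open>P\<close>, where \<open>\<nabla>P = 0\<close>, the Bochner formula
  and \<open>Ric \<ge> 0\<close> give \<open>0 \<ge> \<Delta>P / 2 \<ge> \<langle>\<nabla>\<theta>, \<nabla>\<Delta>\<theta>\<rangle> = P (P - \<mu>\<^sup>2) / sin\<^sup>2 \<theta>\<close>, hence \<open>|\<nabla>\<theta>| \<le> \<mu>\<close>.
  Integrating along a path from a minimum to a maximum of \<open>u\<close> and letting \<open>A\<close> tend to \<open>k\<close>, its length is
  at least \<open>\<pi> / \<mu> \<ge> \<pi> / sqrt lam\<close>. As \<open>u\<close> is constant on leaves, this bounds from below the distance
  of two leaves, and thereby the diameter of the leaf space.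
\<close>

section \<open>Functions of class \<open>C\<^sup>k\<close> on coordinate space\<close>

text \<open>A half period of -cos has range [-1, 1], while the range of an eigenfunction may be
  lopsided; fitted to such a range, the profile without drift would lose part of the length \<pi>.
  The drift \<beta> stretches a half period until its extreme values have the ratio K : k (for k >
  0). The price is the factor 1 + \<beta>^2 in \<open>\<mu>\<close>, and it works in the right
  direction: a smaller \<open>\<mu>\<close> makes paths longer. The drift being constant, -2 \<beta>
  P has zero gradient at a maximum of P, and the derivative that remains is that of -cot, which is 1
  / sin^2 > 0. A stays above k because the inverse profile is not differentiable at the ends of its
  range.

  Two obstacles come from the definitions. The Laplacian is evaluated in a chart selected separately
  at every point, whereas the Bochner identity differentiates it; so its independence of the chart
  has to be shown. Distance and diameter are \<open>Inf\<close> and \<open>Sup\<close> of real sets,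
  which say nothing unless these sets are nonempty and bounded; so a uniform bound on distances is
  derived from compactness and connectedness.\<close>

abbreviation coord_space :: "nat \<Rightarrow> (nat \<Rightarrow> real) set" where
  "coord_space n \<equiv> topspace (Euclidean_space n)"

text \<open>A cube for the sup norm, so that changing coordinates one at a time towards those of
  another of its points does not leave it. Coordinates from \<open>n\<close> on are 0 by membership
  in \<open>coord_space n\<close>.\<close>

definition coord_ball :: "nat \<Rightarrow> (nat \<Rightarrow> real) \<Rightarrow> real \<Rightarrow> (nat \<Rightarrow> real) set" where
  "coord_ball n x e = {y \<in> coord_space n. \<forall>i<n. \<bar>y i - x i\<bar> < e}"

text \<open>The hypothesis asks for all smaller radii as well, so that in the induction the minimum
  of two radii serves both.\<close>

lemma common_radius:
  fixes n :: nat
  assumes "\<And>i. i < n \<Longrightarrow> \<exists>e>0. \<forall>d. 0 < d \<and> d \<le> e \<longrightarrow> P i d"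
  shows "\<exists>e>0::real. \<forall>i<n. P i e"
proof -
  have "\<exists>e>0::real. \<forall>i<n. \<forall>d. 0 < d \<and> d \<le> e \<longrightarrow> P i d"
    using assms
  proof (induction n)
    case 0
    then show ?case by (auto intro: exI[of _ 1])
  next
    case (Suc n)
    obtain e1 where "e1 > 0" "\<forall>i<n. \<forall>d. 0 < d \<and> d \<le> e1 \<longrightarrow> P i d"
      using Suc.IH[OF Suc.prems[OF less_SucI]] by blast
    moreover obtain e2 where "e2 > 0" "\<forall>d. 0 < d \<and> d \<le> e2 \<longrightarrow> P n d"
      using Suc.prems by blast
    ultimately show ?case
      by (intro exI[of _ "min e1 e2"]) (auto simp: less_Suc_eq)
  qed
  then show ?thesis by fastforce
qed

lemma openin_coord_ball: "openin (Euclidean_space n) (coord_ball n x e)"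
proof -
  have eq: "coord_ball n x e = {y. \<forall>i\<in>{..<n}. y i \<in> ball (x i) e} \<inter> {y. \<forall>i\<ge>n. y i = 0}"
    by (auto simp: coord_ball_def topspace_Euclidean_space dist_real_def abs_minus_commute)
  have "open {y::nat\<Rightarrow>real. \<forall>i\<in>{..<n}. y i \<in> ball (x i) e}"
    by (rule product_topology_basis'[where x="\<lambda>i. i"]) auto
  then show ?thesis
    unfolding eq Euclidean_space_def open_fun_def by (auto simp: openin_subtopology)
qed

text \<open>All points of the space agree from index \<open>n\<close> on, so of the factors of a
  basic open box only the first \<open>n\<close> constrain them, and these admit a common
  radius.\<close>

lemma openin_Euclidean_space_iff:
  "openin (Euclidean_space n) W \<longleftrightarrow>
     W \<subseteq> coord_space n \<and> (\<forall>x\<in>W. \<exists>e>0. coord_ball n x e \<subseteq> W)"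
proof (intro iffI conjI ballI)
  assume W: "openin (Euclidean_space n) W"
  then show "W \<subseteq> coord_space n" by (rule openin_subset)
  fix x assume x: "x \<in> W"
  obtain T where T: "openin (powertop_real UNIV) T" "W = T \<inter> {x. \<forall>i\<ge>n. x i = 0}"
    using W by (auto simp: Euclidean_space_def openin_subtopology)
  obtain X where X: "x \<in> (\<Pi>\<^sub>E i\<in>UNIV. X i)" "\<And>i. openin euclideanreal (X i)"
      "(\<Pi>\<^sub>E i\<in>UNIV. X i) \<subseteq> T"
    using product_topology_open_contains_basis[OF T(1), of x] x T(2) by auto
  have "\<exists>e>0. \<forall>i<n. \<forall>z. \<bar>z - x i\<bar> < e \<longrightarrow> z \<in> X i"
  proof (rule common_radius)
    fix i
    have "open (X i)" "x i \<in> X i" using X by auto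
    then obtain e where "e > 0" "\<forall>z. dist z (x i) < e \<longrightarrow> z \<in> X i"
      by (auto simp: open_dist)
    then show "\<exists>e>0. \<forall>d. 0 < d \<and> d \<le> e \<longrightarrow> (\<forall>z. \<bar>z - x i\<bar> < d \<longrightarrow> z \<in> X i)"
      by (intro exI[of _ e]) (auto simp: dist_real_def)
  qed
  then obtain e where e: "e > 0" "\<And>i z. i < n \<Longrightarrow> \<bar>z - x i\<bar> < e \<Longrightarrow> z \<in> X i" by blast
  have xW: "\<forall>i\<ge>n. x i = 0" using x T(2) by auto
  have "coord_ball n x e \<subseteq> W"
  proof
    fix y assume y: "y \<in> coord_ball n x e"
    have "y i \<in> X i" for i
    proof (cases "i < n")
      case True then show ?thesis using e y by (auto simp: coord_ball_def)
    next
      case False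
      then have "y i = x i" using y xW by (auto simp: coord_ball_def topspace_Euclidean_space)
      then show ?thesis using X(1) by auto
    qed
    then have "y \<in> T" using X(3) by auto
    then show "y \<in> W" using y T(2) by (auto simp: coord_ball_def topspace_Euclidean_space)
  qed
  then show "\<exists>e>0. coord_ball n x e \<subseteq> W" using e by blast
next
  assume "W \<subseteq> coord_space n \<and> (\<forall>x\<in>W. \<exists>e>0. coord_ball n x e \<subseteq> W)"
  then have *: "W \<subseteq> coord_space n" "\<And>x. x \<in> W \<Longrightarrow> \<exists>e>0. coord_ball n x e \<subseteq> W" by auto
  show "openin (Euclidean_space n) W"
  proof (subst openin_subopen, intro ballI)
    fix x assume x: "x \<in> W"
    obtain e where e: "e > 0" "coord_ball n x e \<subseteq> W" using * x by blast
    have "x \<in> coord_ball n x e" using x *(1) e by (auto simp: coord_ball_def)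
    then show "\<exists>T. openin (Euclidean_space n) T \<and> x \<in> T \<and> T \<subseteq> W"
      using openin_coord_ball e by blast
  qed
qed

lemma coord_ballE:
  assumes "openin (Euclidean_space n) W" "x \<in> W"
  obtains e where "e > 0" "coord_ball n x e \<subseteq> W"
  using assms by (auto simp: openin_Euclidean_space_iff)

lemma centre_in_coord_ball: "x \<in> coord_space n \<Longrightarrow> e > 0 \<Longrightarrow> x \<in> coord_ball n x e"
  by (auto simp: coord_ball_def)

lemma fun_upd_in_coord_space: "x \<in> coord_space n \<Longrightarrow> i < n \<Longrightarrow> x(i := t) \<in> coord_space n"
  by (auto simp: topspace_Euclidean_space)

lemma open_in_coord_space: "openin (Euclidean_space n) W \<Longrightarrow> x \<in> W \<Longrightarrow> x \<in> coord_space n"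
  using openin_subset by blast

lemma Euclidean_space_eq_top_of_set: "Euclidean_space n = top_of_set {x. \<forall>i\<ge>n. x i = 0}"
  by (simp add: Euclidean_space_def euclidean_product_topology topspace_Euclidean_space)

text \<open>The product topology is also the type class topology of functions; this gives access to
  the calculus of \<open>continuous_on\<close>.\<close>

lemma continuous_map_coord_iff:
  assumes "W \<subseteq> coord_space n"
  shows "continuous_map (subtopology (Euclidean_space n) W) euclideanreal f \<longleftrightarrow> continuous_on W f"
proof -
  have "subtopology (Euclidean_space n) W = top_of_set W"
    unfolding Euclidean_space_eq_top_of_set subtopology_subtopology
    using assms by (simp add: topspace_Euclidean_space Int_absorb1)
  then show ?thesis by (simp only: continuous_map_iff_continuous)
qed

lemma openin_preimage_coord:
  assumes "openin (Euclidean_space n) W" "continuous_on W f" "open S"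
  shows "openin (Euclidean_space n) {x \<in> W. f x \<in> (S::real set)}"
proof -
  have "continuous_map (subtopology (Euclidean_space n) W) euclideanreal f"
    using assms continuous_map_coord_iff openin_subset by blast
  then have "openin (subtopology (Euclidean_space n) W)
     {x \<in> topspace (subtopology (Euclidean_space n) W). f x \<in> S}"
    by (rule openin_continuous_map_preimage) (use assms(3) in \<open>simp only: open_openin\<close>)
  moreover have "topspace (subtopology (Euclidean_space n) W) = W"
    by (rule topspace_subtopology_subset[OF openin_subset[OF assms(1)]])
  ultimately have "openin (subtopology (Euclidean_space n) W) {x \<in> W. f x \<in> S}" by (simp only:)
  then show ?thesis
    unfolding openin_open_subtopology[OF assms(1)] by blast
qed

lemma continuous_on_coordE:
  assumes "openin (Euclidean_space n) W" "continuous_on W f" "x \<in> W" "(e::real) > 0"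
  obtains d where "d > 0" "coord_ball n x d \<subseteq> W" "\<And>y. y \<in> coord_ball n x d \<Longrightarrow> \<bar>f y - f x\<bar> < e"
proof -
  have "openin (Euclidean_space n) {y \<in> W. f y \<in> ball (f x) e}"
    by (rule openin_preimage_coord) (use assms in auto)
  moreover have "x \<in> {y \<in> W. f y \<in> ball (f x) e}" using assms by auto
  ultimately obtain d where "d > 0" "coord_ball n x d \<subseteq> {y \<in> W. f y \<in> ball (f x) e}"
    by (rule coord_ballE)
  then show thesis by (intro that[of d]) (auto simp: dist_real_def abs_minus_commute subset_iff)
qed

section \<open>Partial derivatives on open sets and the classes C^k\<close>

lemma eventually_fun_upd_in:
  assumes "openin (Euclidean_space n) W" "x \<in> W" "i < n"
  shows "\<forall>\<^sub>F t in nhds (x i). x(i := t) \<in> W"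
proof -
  obtain e where e: "e > 0" "coord_ball n x e \<subseteq> W" using assms coord_ballE by metis
  have "x(i := t) \<in> W" if "dist t (x i) < e" for t
    using that e assms fun_upd_in_coord_space[OF open_in_coord_space[OF assms(1,2)] assms(3)]
    by (auto simp: coord_ball_def dist_real_def subset_iff)
  then show ?thesis using e(1) by (auto simp: eventually_nhds_metric)
qed

lemma pd_eqI: "((\<lambda>t. f (x(i := t))) has_real_derivative D) (at (x i)) \<Longrightarrow> pd i f x = D"
  by (simp add: pd_def DERIV_imp_deriv)

lemma has_pd: "(\<lambda>t. f (x(i := t))) differentiable at (x i) \<Longrightarrow>
   ((\<lambda>t. f (x(i := t))) has_real_derivative pd i f x) (at (x i))"
  by (simp add: pd_def DERIV_deriv_iff_real_differentiable)

lemma pd_cong: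
  assumes "openin (Euclidean_space n) W" "x \<in> W" "i < n" "\<And>y. y \<in> W \<Longrightarrow> f y = g y"
  shows "pd i f x = pd i g x"
  unfolding pd_def
  by (rule deriv_cong_ev)
    (use assms eventually_fun_upd_in[OF assms(1-3)] in \<open>auto elim!: eventually_mono\<close>)

text \<open>Unlike \<open>smooth_coord\<close>, the recursion counts the order of differentiability.
  Smoothness then means all \<open>k\<close>, and closure properties follow by induction on
  \<open>k\<close> with the functions generalised, since derivatives of products and composites are
  built from functions of the same kind with one order less.\<close>

fun Ck_coord :: "nat \<Rightarrow> (nat \<Rightarrow> real) set \<Rightarrow> nat \<Rightarrow> ((nat \<Rightarrow> real) \<Rightarrow> real) \<Rightarrow> bool" where
  "Ck_coord n W 0 f \<longleftrightarrow> continuous_on W f"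
| "Ck_coord n W (Suc k) f \<longleftrightarrow> continuous_on W f \<and>
     (\<forall>i<n. (\<forall>x\<in>W. (\<lambda>t. f (x(i := t))) differentiable (at (x i))) \<and> Ck_coord n W k (pd i f))"

lemma Ck_continuous: "Ck_coord n W k f \<Longrightarrow> continuous_on W f"
  by (cases k) auto

lemma Ck_has_pd:
  "Ck_coord n W (Suc k) f \<Longrightarrow> i < n \<Longrightarrow> x \<in> W \<Longrightarrow>
   ((\<lambda>t. f (x(i := t))) has_real_derivative pd i f x) (at (x i))"
  by (simp add: has_pd)

lemma Ck_pd: "Ck_coord n W (Suc k) f \<Longrightarrow> i < n \<Longrightarrow> Ck_coord n W k (pd i f)"
  by simp

lemma Ck_Suc_imp: "Ck_coord n W (Suc k) f \<Longrightarrow> Ck_coord n W k f"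
  by (induction k arbitrary: f) auto

lemma Ck_antimono: "Ck_coord n W l f \<Longrightarrow> k \<le> l \<Longrightarrow> Ck_coord n W k f"
  by (induction l) (auto simp: le_Suc_eq dest: Ck_Suc_imp simp del: Ck_coord.simps(2))

text \<open>\<open>foldr\<close> applies the last index of the list first, so the inner derivative
  is accounted for by appending \<open>i\<close>.\<close>

lemma smooth_coord_pd:
  assumes "smooth_coord n W f" "i < n"
  shows "smooth_coord n W (pd i f)"
  unfolding smooth_coord_def
proof
  fix "is" assume "is \<in> lists {..<n}"
  then have 1: "is @ [i] \<in> lists {..<n}" using assms(2) by auto
  have 2: "foldr pd (is @ [i]) f = foldr pd is (pd i f)" by simp
  show "continuous_map (subtopology (Euclidean_space n) W) euclideanreal (foldr pd is (pd i f)) \<and>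
    (\<forall>j<n. \<forall>x\<in>W. (\<lambda>t. foldr pd is (pd i f) (x(j := t))) differentiable at (x j))"
    using bspec[OF assms(1)[unfolded smooth_coord_def] 1] unfolding 2 .
qed

lemma smooth_coord_iff_Ck:
  assumes W: "W \<subseteq> coord_space n"
  shows "smooth_coord n W f \<longleftrightarrow> (\<forall>k. Ck_coord n W k f)"
proof
  have "smooth_coord n W f \<Longrightarrow> Ck_coord n W k f" for k
  proof (induction k arbitrary: f)
    case 0
    then have "continuous_map (subtopology (Euclidean_space n) W) euclideanreal (foldr pd [] f)"
      unfolding smooth_coord_def by blast
    then show ?case using continuous_map_coord_iff[OF W] by simp
  next
    case (Suc k)
    have 1: "continuous_map (subtopology (Euclidean_space n) W) euclideanreal (foldr pd [] f)"
      "\<forall>i<n. \<forall>x\<in>W. (\<lambda>t. foldr pd [] f (x(i := t))) differentiable (at (x i))"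
      using Suc.prems unfolding smooth_coord_def by blast+
    show ?case
      using 1 continuous_map_coord_iff[OF W] Suc.IH[OF smooth_coord_pd[OF Suc.prems]] by auto
  qed
  then show "smooth_coord n W f \<Longrightarrow> \<forall>k. Ck_coord n W k f" by blast
next
  \<comment> \<open>Order 1 bundles the continuity and the differentiability that
    \<open>smooth_coord\<close> asks of each iterated derivative. The list is taken apart from its
    end because that index is applied first.\<close>
  have "is \<in> lists {..<n} \<Longrightarrow> \<forall>k. Ck_coord n W k f \<Longrightarrow> Ck_coord n W 1 (foldr pd is f)" for "is"
  proof (induction "is" arbitrary: f rule: rev_induct)
    case Nil then show ?case by (simp del: Ck_coord.simps)
  next
    case (snoc i "is")
    then have "Ck_coord n W k (pd i f)" for k
      using Ck_pd[of n W k f i] by (auto simp del: Ck_coord.simps)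
    then show ?case using snoc by simp
  qed
  then show "\<forall>k. Ck_coord n W k f \<Longrightarrow> smooth_coord n W f"
    unfolding smooth_coord_def using continuous_map_coord_iff[OF W] by force
qed

lemma Ck_cong:
  assumes "openin (Euclidean_space n) W" "\<And>y. y \<in> W \<Longrightarrow> f y = g y" "Ck_coord n W k f"
  shows "Ck_coord n W k g"
  using assms(2,3)
proof (induction k arbitrary: f g)
  case 0 then show ?case by (auto cong: continuous_on_cong)
next
  case (Suc k)
  have "continuous_on W g" using Suc.prems by (auto cong: continuous_on_cong)
  moreover have "(\<lambda>t. g (x(i := t))) differentiable at (x i)" if "i < n" "x \<in> W" for i x
  proof -
    have "((\<lambda>t. f (x(i := t))) has_real_derivative pd i f x) (at (x i))"
      using Ck_has_pd Suc.prems that by blast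
    moreover have "\<forall>\<^sub>F t in nhds (x i). f (x(i := t)) = g (x(i := t))"
      using eventually_fun_upd_in[OF assms(1) that(2,1)] Suc.prems(1) by (auto elim!: eventually_mono)
    ultimately have "((\<lambda>t. g (x(i := t))) has_real_derivative pd i f x) (at (x i))"
      by (simp add: DERIV_cong_ev)
    then show ?thesis by (auto simp: real_differentiable_def)
  qed
  moreover have "Ck_coord n W k (pd i g)" if "i < n" for i
    using Suc.IH[of "pd i f" "pd i g"] pd_cong[OF assms(1) _ that, of _ f g] Suc.prems that by auto
  ultimately show ?case by simp
qed

text \<open>Any family that agrees with the partial derivatives on \<open>W\<close> will do; off
  \<open>W\<close> the term \<open>pd i f\<close> may be an arbitrary value of
  \<open>deriv\<close>.\<close>

lemma Ck_SucI:
  assumes "openin (Euclidean_space n) W" "continuous_on W f"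
    "\<And>i x. i < n \<Longrightarrow> x \<in> W \<Longrightarrow> ((\<lambda>t. f (x(i := t))) has_real_derivative f' i x) (at (x i))"
    "\<And>i. i < n \<Longrightarrow> Ck_coord n W k (f' i)"
  shows "Ck_coord n W (Suc k) f"
proof -
  have "Ck_coord n W k (pd i f)" if "i < n" for i
    by (rule Ck_cong[OF assms(1) _ assms(4)[OF that]]) (use pd_eqI assms(3) that in metis)
  then show ?thesis using assms by (auto simp: real_differentiable_def)
qed

section \<open>Closure properties of the classes C^k\<close>

lemma Ck_const: "openin (Euclidean_space n) W \<Longrightarrow> Ck_coord n W k (\<lambda>x. c)"
proof (induction k arbitrary: c)
  case (Suc k) then show ?case by (intro Ck_SucI[where f'="\<lambda>i x. 0"]) auto
qed auto

lemma continuous_on_coord: "continuous_on W (\<lambda>x. x i)"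
  by (rule continuous_on_subset[OF continuous_on_product_coordinates subset_UNIV])

lemma Ck_component: "openin (Euclidean_space n) W \<Longrightarrow> Ck_coord n W k (\<lambda>x. x j)"
proof (cases k)
  case (Suc m)
  assume W: "openin (Euclidean_space n) W"
  show ?thesis unfolding Suc
    by (intro Ck_SucI[where f'="\<lambda>i x. if i = j then 1 else 0"] continuous_on_coord W)
      (auto intro: Ck_const[OF W])
qed (auto intro: continuous_on_coord)

lemma Ck_add:
  assumes W: "openin (Euclidean_space n) W"
  shows "Ck_coord n W k f \<Longrightarrow> Ck_coord n W k g \<Longrightarrow> Ck_coord n W k (\<lambda>x. f x + g x)"
proof (induction k arbitrary: f g)
  case (Suc k)
  show ?case
  proof (rule Ck_SucI[OF W])
    show "continuous_on W (\<lambda>x. f x + g x)"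
      using Suc.prems Ck_continuous by (intro continuous_on_add) blast+
    show "((\<lambda>t. f (x(i := t)) + g (x(i := t))) has_real_derivative pd i f x + pd i g x) (at (x i))"
      if "i < n" "x \<in> W" for i x
      by (rule DERIV_add[OF Ck_has_pd[OF Suc.prems(1) that] Ck_has_pd[OF Suc.prems(2) that]])
    show "Ck_coord n W k (\<lambda>x. pd i f x + pd i g x)" if "i < n" for i
      by (intro Suc.IH Ck_pd[OF Suc.prems(1) that] Ck_pd[OF Suc.prems(2) that])
  qed
qed (auto intro: continuous_intros)

lemma Ck_mult:
  assumes W: "openin (Euclidean_space n) W"
  shows "Ck_coord n W k f \<Longrightarrow> Ck_coord n W k g \<Longrightarrow> Ck_coord n W k (\<lambda>x. f x * g x)"
proof (induction k arbitrary: f g)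
  case (Suc k)
  have D: "((\<lambda>t. f (x(i := t)) * g (x(i := t))) has_real_derivative
        pd i f x * g x + pd i g x * f x) (at (x i))" if "i < n" "x \<in> W" for i x
    using DERIV_mult[OF Ck_has_pd[OF Suc.prems(1) that] Ck_has_pd[OF Suc.prems(2) that]]
    by (simp only: fun_upd_triv)
  have C: "continuous_on W (\<lambda>x. f x * g x)"
    using Suc.prems Ck_continuous by (intro continuous_on_mult) blast+
  show ?case
    by (rule Ck_SucI[OF W C D]; (assumption | intro Ck_add[OF W] Suc.IH Ck_pd[OF Suc.prems(1)]
        Ck_pd[OF Suc.prems(2)] Ck_Suc_imp[OF Suc.prems(1)] Ck_Suc_imp[OF Suc.prems(2)]; assumption))
qed (auto intro: continuous_intros)

lemma Ck_sum:
  assumes W: "openin (Euclidean_space n) W" and "\<And>j. j \<in> J \<Longrightarrow> Ck_coord n W k (f j)"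
  shows "Ck_coord n W k (\<lambda>x. \<Sum>j\<in>J. f j x)"
  using assms(2)
  by (induction J rule: infinite_finite_induct) (auto intro: Ck_const Ck_add W)

lemma Ck_prod:
  assumes W: "openin (Euclidean_space n) W" and "\<And>j. j \<in> J \<Longrightarrow> Ck_coord n W k (f j)"
  shows "Ck_coord n W k (\<lambda>x. \<Prod>j\<in>J. f j x)"
  using assms(2)
  by (induction J rule: infinite_finite_induct) (auto intro: Ck_const Ck_mult W)

text \<open>The outer function comes with the whole sequence \<open>S\<close> of its successive
  derivatives; generalising over \<open>m\<close> lets the induction pass from \<open>S m\<close> to
  \<open>S (Suc m)\<close>.\<close>

lemma Ck_real_compose:
  assumes W: "openin (Euclidean_space n) W"
    and S: "\<And>m s. s \<in> J \<Longrightarrow> (S m has_real_derivative S (Suc m) s) (at s)"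
    and f: "\<And>x. x \<in> W \<Longrightarrow> f x \<in> J"
  shows "Ck_coord n W k f \<Longrightarrow> Ck_coord n W k (\<lambda>x. S m (f x))"
proof (induction k arbitrary: m)
  case 0
  have "continuous_on J (S m)"
    using S by (meson DERIV_isCont continuous_at_imp_continuous_on)
  then show ?case using 0 f by (auto intro: continuous_on_compose2)
next
  case (Suc k)
  have "continuous_on J (S m)"
    using S by (meson DERIV_isCont continuous_at_imp_continuous_on)
  then have C: "continuous_on W (\<lambda>x. S m (f x))"
    using Ck_continuous[OF Suc.prems] f by (auto intro: continuous_on_compose2)
  have D: "((\<lambda>t. S m (f (x(i := t)))) has_real_derivative S (Suc m) (f x) * pd i f x) (at (x i))"
    if "i < n" "x \<in> W" for i x
  proof -
    have "(S m has_real_derivative S (Suc m) (f x)) (at (f (x(i := x i))))"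
      using S f that by simp
    from DERIV_chain2[OF this Ck_has_pd[OF Suc.prems that]] show ?thesis
      by (simp only: fun_upd_triv)
  qed
  show ?case
    by (rule Ck_SucI[OF W C D]; (assumption |
      intro Ck_mult[OF W] Suc.IH Ck_pd[OF Suc.prems] Ck_Suc_imp[OF Suc.prems]; assumption))
qed

text \<open>Up to sign, the derivative is the product of \<open>pd i f\<close> with two copies of
  the inverse itself, which are of order \<open>k\<close> by induction.\<close>

lemma Ck_inverse:
  assumes W: "openin (Euclidean_space n) W" and nz: "\<And>x. x \<in> W \<Longrightarrow> f x \<noteq> 0"
  shows "Ck_coord n W k f \<Longrightarrow> Ck_coord n W k (\<lambda>x. inverse (f x))"
proof (induction k)
  case (Suc k)
  have D: "((\<lambda>t. inverse (f (x(i := t)))) has_real_derivative (- 1) * (pd i f x * (inverse (f x) * inverse (f x)))) (at (x i))"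
    if "i < n" "x \<in> W" for i x
    using DERIV_inverse_fun[OF Ck_has_pd[OF Suc.prems that]] nz[OF that(2)]
    by (simp only: fun_upd_triv power_Suc power_0 inverse_mult_distrib mult_1_right inverse_1
        mult_minus1 not_False_eq_True simp_thms)
  have C: "continuous_on W (\<lambda>x. inverse (f x))"
    using Suc.prems Ck_continuous nz by (intro continuous_on_inverse) blast+
  show ?case
    by (rule Ck_SucI[OF W C D]; (assumption | intro Ck_mult[OF W] Ck_const[OF W] Suc.IH
        Ck_pd[OF Suc.prems] Ck_Suc_imp[OF Suc.prems]; assumption))
qed (use nz in \<open>auto intro: continuous_intros\<close>)

lemma continuous_on_eq_locally:
  assumes "openin (Euclidean_space n) W"
    "\<And>x. x \<in> W \<Longrightarrow> \<exists>V. openin (Euclidean_space n) V \<and> x \<in> V \<and> V \<subseteq> W \<and> continuous_on V f"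
  shows "continuous_on W (f :: _ \<Rightarrow> real)"
  unfolding continuous_on_def
proof
  fix x assume x: "x \<in> W"
  obtain V where V: "openin (Euclidean_space n) V" "x \<in> V" "V \<subseteq> W" "continuous_on V f"
    using assms(2)[OF x] by blast
  obtain T where T: "open T" "V = coord_space n \<inter> T"
    using V(1) unfolding Euclidean_space_eq_top_of_set openin_open
    by (auto simp: topspace_Euclidean_space)
  have "at x within W = at x within V"
    by (rule at_within_nhd[of _ T]) (use V T openin_subset[OF assms(1)] in auto)
  then show "(f \<longlongrightarrow> f x) (at x within W)"
    using V by (auto simp: continuous_on_def)
qed

lemma Ck_local:
  assumes "openin (Euclidean_space n) W"
    "\<And>x. x \<in> W \<Longrightarrow> \<exists>V. openin (Euclidean_space n) V \<and> x \<in> V \<and> V \<subseteq> W \<and> Ck_coord n V k f"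
  shows "Ck_coord n W k f"
  using assms(2)
proof (induction k arbitrary: f)
  case 0
  then show ?case using continuous_on_eq_locally[OF assms(1)] by auto
next
  case (Suc k)
  have "continuous_on W f"
    by (rule continuous_on_eq_locally[OF assms(1)]) (meson Suc.prems Ck_continuous)
  moreover have "(\<lambda>t. f (x(i := t))) differentiable at (x i)" if "x \<in> W" "i < n" for x i
    using Suc.prems[OF that(1)] that by auto
  moreover have "Ck_coord n W k (pd i f)" if "i < n" for i
    by (rule Suc.IH) (use Suc.prems that in fastforce)
  ultimately show ?case by simp
qed

lemma Ck_subset: "Ck_coord n W k f \<Longrightarrow> V \<subseteq> W \<Longrightarrow> Ck_coord n V k f"
  by (induction k arbitrary: f) (auto intro: continuous_on_subset)

subsection \<open>The chain rule\<close>

lemma mean_value_real: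
  assumes "\<And>t. \<bar>t - a\<bar> \<le> \<bar>b - a\<bar> \<Longrightarrow> (f has_real_derivative f' t) (at t)"
  shows "\<exists>s. \<bar>s - a\<bar> \<le> \<bar>b - a\<bar> \<and> f b - f a = f' s * (b - a)"
proof -
  consider "a < b" | "b < a" | "a = b" by linarith
  then show ?thesis
  proof cases
    case 1
    then obtain z where "a < z" "z < b" "f b - f a = (b - a) * f' z"
      using MVT2[of a b f f'] assms by auto
    then show ?thesis by (intro exI[of _ z]) auto
  next
    case 2
    then obtain z where "b < z" "z < a" "f a - f b = (a - b) * f' z"
      using MVT2[of b a f f'] assms by auto
    then show ?thesis by (intro exI[of _ z]) (auto simp: algebra_simps)
  qed auto
qed

text \<open>The point \<open>x\<close> is moved to \<open>y\<close> along edges parallel to the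
  axes, with one mean value theorem per edge; only partial derivatives enter. Each intermediate
  point is in every coordinate at most as far from \<open>x\<close> as \<open>y\<close> is.\<close>

lemma mean_value_coord:
  assumes sub: "coord_ball n x e \<subseteq> W" and x: "x \<in> coord_space n" and y: "y \<in> coord_ball n x e"
    and D: "\<And>i z. i < n \<Longrightarrow> z \<in> W \<Longrightarrow> ((\<lambda>t. f (z(i := t))) has_real_derivative pd i f z) (at (z i))"
  shows "\<exists>\<xi>. (\<forall>i<n. \<xi> i \<in> coord_space n \<and> (\<forall>j<n. \<bar>\<xi> i j - x j\<bar> \<le> \<bar>y j - x j\<bar>)) \<and>
             f y - f x = (\<Sum>i<n. pd i f (\<xi> i) * (y i - x i))"
proof -
  define z where "z m = (\<lambda>j. if j < m then y j else x j)" for m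
  have zn: "z n = y" using x y by (auto simp: z_def coord_ball_def topspace_Euclidean_space)
  have step: "\<exists>\<xi>. \<xi> \<in> coord_space n \<and> (\<forall>j<n. \<bar>\<xi> j - x j\<bar> \<le> \<bar>y j - x j\<bar>) \<and>
        f (z (Suc i)) - f (z i) = pd i f \<xi> * (y i - x i)" if i: "i < n" for i
  proof -
    have zS: "z (Suc i) = (z i)(i := y i)" by (auto simp: z_def less_Suc_eq)
    have z0: "z i = (z i)(i := x i)" by (auto simp: z_def)
    have zc: "z i \<in> coord_space n"
      using x y i by (auto simp: z_def coord_ball_def topspace_Euclidean_space)
    have inb: "(z i)(i := t) \<in> W" if "\<bar>t - x i\<bar> \<le> \<bar>y i - x i\<bar>" for t
    proof -
      have "\<bar>((z i)(i := t)) j - x j\<bar> < e" if "j < n" for j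
      proof -
        have e: "\<bar>y j - x j\<bar> < e" "\<bar>y i - x i\<bar> < e" using y that i by (auto simp: coord_ball_def)
        then have "e > 0" by linarith
        then show ?thesis using e \<open>\<bar>t - x i\<bar> \<le> \<bar>y i - x i\<bar>\<close> by (auto simp: z_def)
      qed
      then have "(z i)(i := t) \<in> coord_ball n x e"
        using fun_upd_in_coord_space[OF zc i] by (auto simp: coord_ball_def)
      then show ?thesis using sub by blast
    qed
    have "\<exists>s. \<bar>s - x i\<bar> \<le> \<bar>y i - x i\<bar> \<and>
        f ((z i)(i := y i)) - f ((z i)(i := x i)) = pd i f ((z i)(i := s)) * (y i - x i)"
    proof (rule mean_value_real)
      fix t assume t: "\<bar>t - x i\<bar> \<le> \<bar>y i - x i\<bar>"
      show "((\<lambda>t. f ((z i)(i := t))) has_real_derivative pd i f ((z i)(i := t))) (at t)"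
        using D[OF i inb[OF t]] by simp
    qed
    then obtain s where s: "\<bar>s - x i\<bar> \<le> \<bar>y i - x i\<bar>"
      "f ((z i)(i := y i)) - f ((z i)(i := x i)) = pd i f ((z i)(i := s)) * (y i - x i)" by blast
    show ?thesis
      by (intro exI[of _ "(z i)(i := s)"])
        (use s zS z0 fun_upd_in_coord_space[OF zc i] in \<open>auto simp: z_def\<close>)
  qed
  then obtain \<xi> where \<xi>: "\<And>i. i < n \<Longrightarrow> \<xi> i \<in> coord_space n \<and> (\<forall>j<n. \<bar>\<xi> i j - x j\<bar> \<le> \<bar>y j - x j\<bar>) \<and>
        f (z (Suc i)) - f (z i) = pd i f (\<xi> i) * (y i - x i)" by metis
  have "f y - f x = f (z n) - f (z 0)" by (simp add: zn) (simp add: z_def)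
  also have "\<dots> = (\<Sum>i<n. f (z (Suc i)) - f (z i))"
    by (rule sum_lessThan_telescope[of "\<lambda>i. f (z i)", symmetric])
  also have "\<dots> = (\<Sum>i<n. pd i f (\<xi> i) * (y i - x i))" using \<xi> by auto
  finally show ?thesis using \<xi> by blast
qed

lemma tendsto_coordinatewise:
  fixes f :: "'a \<Rightarrow> nat \<Rightarrow> real"
  assumes "\<And>i. ((\<lambda>t. f t i) \<longlongrightarrow> l i) F"
  shows "(f \<longlongrightarrow> l) F"
proof -
  have "limitin (product_topology (\<lambda>i. euclideanreal) UNIV) f l F"
    using assms by (subst limitin_componentwise) auto
  then show ?thesis by (simp add: euclidean_product_topology)
qed

text \<open>Divided by \<open>t - t0\<close>, the mean value formula expresses the difference
  quotient by partial derivatives at intermediate points, which converge to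
  \<open>\<gamma> t0\<close>; continuity of the partial derivatives gives the limit.\<close>

lemma chain_rule_coord:
  assumes W: "openin (Euclidean_space n) W"
    and f: "Ck_coord n W (Suc 0) f"
    and t0: "\<gamma> t0 \<in> W" and ev: "\<forall>\<^sub>F t in at t0. \<gamma> t \<in> coord_space n"
    and \<gamma>: "\<And>i. i < n \<Longrightarrow> ((\<lambda>t. \<gamma> t i) has_real_derivative \<gamma>' i) (at t0)"
  shows "((\<lambda>t. f (\<gamma> t)) has_real_derivative (\<Sum>i<n. pd i f (\<gamma> t0) * \<gamma>' i)) (at t0)"
proof -
  obtain e where e: "e > 0" "coord_ball n (\<gamma> t0) e \<subseteq> W" using W t0 coord_ballE by metis
  have x0: "\<gamma> t0 \<in> coord_space n" using open_in_coord_space W t0 by blast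
  have lim: "((\<lambda>t. \<gamma> t i) \<longlongrightarrow> \<gamma> t0 i) (at t0)" if "i < n" for i
    using \<gamma>[OF that] DERIV_isCont isCont_def by blast
  have near: "\<forall>\<^sub>F t in at t0. \<forall>i\<in>{..<n}. \<bar>\<gamma> t i - \<gamma> t0 i\<bar> < e"
    using tendstoD[OF lim e(1)] by (auto simp: eventually_ball_finite_distrib dist_real_def)
  have ball: "\<forall>\<^sub>F t in at t0. \<gamma> t \<in> coord_ball n (\<gamma> t0) e"
    using near ev by eventually_elim (auto simp: coord_ball_def)
  define Q where "Q t \<xi> \<longleftrightarrow> (\<forall>i<n. \<xi> i \<in> coord_space n \<and> (\<forall>j<n. \<bar>\<xi> i j - \<gamma> t0 j\<bar> \<le> \<bar>\<gamma> t j - \<gamma> t0 j\<bar>)) \<and>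
             f (\<gamma> t) - f (\<gamma> t0) = (\<Sum>i<n. pd i f (\<xi> i) * (\<gamma> t i - \<gamma> t0 i))" for t and \<xi> :: "nat \<Rightarrow> nat \<Rightarrow> real"
  define \<xi> where "\<xi> t = (SOME \<xi>. Q t \<xi>)" for t
  have ball\<xi>: "\<forall>\<^sub>F t in at t0. \<gamma> t \<in> coord_ball n (\<gamma> t0) e \<and> Q t (\<xi> t)"
    using ball
  proof eventually_elim
    case (elim t)
    have "\<exists>\<xi>. Q t \<xi>" unfolding Q_def
      by (rule mean_value_coord[OF e(2) x0 elim]) (use Ck_has_pd[OF f] in blast)
    then show ?case using elim someI_ex[of "Q t"] by (auto simp: \<xi>_def)
  qed
  have \<xi>lim: "((\<lambda>t. pd i f (\<xi> t i)) \<longlongrightarrow> pd i f (\<gamma> t0)) (at t0)" if i: "i < n" for i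
  proof (rule continuous_on_tendsto_compose[of W "pd i f" "\<lambda>t. \<xi> t i"])
    show "continuous_on W (pd i f)" using f i by auto
    show "\<gamma> t0 \<in> W" by fact
    show "\<forall>\<^sub>F t in at t0. \<xi> t i \<in> W" using ball\<xi>
    proof eventually_elim
      case (elim t)
      then have "\<xi> t i \<in> coord_ball n (\<gamma> t0) e"
        using i unfolding Q_def coord_ball_def by (blast intro: le_less_trans)
      then show ?case using e by blast
    qed
    show "((\<lambda>t. \<xi> t i) \<longlongrightarrow> \<gamma> t0) (at t0)"
    proof (rule tendsto_coordinatewise)
      fix j
      show "((\<lambda>t. \<xi> t i j) \<longlongrightarrow> \<gamma> t0 j) (at t0)"
      proof (cases "j < n")
        case True
        have 1: "((\<lambda>t. \<bar>\<gamma> t j - \<gamma> t0 j\<bar>) \<longlongrightarrow> 0) (at t0)"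
          using tendsto_rabs[OF LIM_zero[OF lim[OF True]]] by simp
        have "\<forall>\<^sub>F t in at t0. norm (\<xi> t i j - \<gamma> t0 j) \<le> \<bar>\<gamma> t j - \<gamma> t0 j\<bar>"
          using ball\<xi> by eventually_elim (use i True in \<open>auto simp: Q_def\<close>)
        from Lim_null_comparison[OF this 1] show ?thesis using LIM_zero_iff by blast
      next
        case False
        have "\<forall>\<^sub>F t in at t0. \<gamma> t0 j = \<xi> t i j"
          using ball\<xi> by eventually_elim
            (use i False x0 in \<open>auto simp: Q_def topspace_Euclidean_space\<close>)
        then show ?thesis by (rule Lim_transform_eventually[OF tendsto_const])
      qed
    qed
  qed
  have "((\<lambda>t. \<Sum>i<n. pd i f (\<xi> t i) * ((\<gamma> t i - \<gamma> t0 i) / (t - t0))) \<longlongrightarrow>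
         (\<Sum>i<n. pd i f (\<gamma> t0) * \<gamma>' i)) (at t0)"
    using \<gamma> by (intro tendsto_sum tendsto_mult \<xi>lim) (auto simp: has_field_derivative_iff)
  moreover have "\<forall>\<^sub>F t in at t0. (\<Sum>i<n. pd i f (\<xi> t i) * ((\<gamma> t i - \<gamma> t0 i) / (t - t0))) =
      (f (\<gamma> t) - f (\<gamma> t0)) / (t - t0)"
    using ball\<xi> by eventually_elim (auto simp: Q_def sum_divide_distrib)
  ultimately show ?thesis
    unfolding has_field_derivative_iff by (rule Lim_transform_eventually)
qed

lemma continuous_on_into_coord_space:
  assumes "\<And>j. j < m \<Longrightarrow> continuous_on W (\<lambda>x. F x j)" "\<And>x. x \<in> W \<Longrightarrow> F x \<in> coord_space m"
  shows "continuous_on W F"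
proof (rule continuous_on_coordinatewise_then_product)
  fix j
  show "continuous_on W (\<lambda>x. F x j)"
  proof (cases "j < m")
    case False
    then have "\<And>x. x \<in> W \<Longrightarrow> F x j = 0" using assms(2) by (auto simp: topspace_Euclidean_space)
    then show ?thesis by (auto cong: continuous_on_cong)
  qed (use assms in auto)
qed

lemma Ck_compose:
  assumes W: "openin (Euclidean_space n) W" and W': "openin (Euclidean_space m) W'"
    and F: "\<And>x. x \<in> W \<Longrightarrow> F x \<in> W'"
  shows "(\<And>j. j < m \<Longrightarrow> Ck_coord n W k (\<lambda>x. F x j)) \<Longrightarrow> Ck_coord m W' k f \<Longrightarrow>
    Ck_coord n W k (\<lambda>x. f (F x))"
proof (induction k arbitrary: f)
  have Fc: "F x \<in> coord_space m" if "x \<in> W" for x using F[OF that] open_in_coord_space W' by blast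
  case 0
  have "continuous_on W F"
    by (rule continuous_on_into_coord_space[OF _ Fc]) (use 0 in auto)
  then show ?case using 0(2) F by (auto intro: continuous_on_compose2[of W' f])
next
  have Fc: "F x \<in> coord_space m" if "x \<in> W" for x using F[OF that] open_in_coord_space W' by blast
  case (Suc k)
  have "continuous_on W F"
    by (rule continuous_on_into_coord_space[OF _ Fc]) (use Suc.prems Ck_continuous in auto)
  then have C: "continuous_on W (\<lambda>x. f (F x))"
    using Ck_continuous[OF Suc.prems(2)] F by (auto intro: continuous_on_compose2[of W' f])
  have D: "((\<lambda>t. f (F (x(i := t)))) has_real_derivative
      (\<Sum>j<m. pd j f (F x) * pd i (\<lambda>x. F x j) x)) (at (x i))" if "i < n" "x \<in> W" for i x
  proof -
    have "((\<lambda>t. f (F (x(i := t)))) has_real_derivative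
      (\<Sum>j<m. pd j f (F (x(i := x i))) * pd i (\<lambda>x. F x j) x)) (at (x i))"
    proof (rule chain_rule_coord[OF W'])
      show "Ck_coord m W' (Suc 0) f" using Ck_antimono[OF Suc.prems(2)] by (simp del: Ck_coord.simps)
      show "F (x(i := x i)) \<in> W'" using F that by simp
      have "\<forall>\<^sub>F t in nhds (x i). x(i := t) \<in> W" by (rule eventually_fun_upd_in[OF W that(2,1)])
      then have "\<forall>\<^sub>F t in at (x i). x(i := t) \<in> W" by (simp add: eventually_at_filter eventually_mono)
      then show "\<forall>\<^sub>F t in at (x i). F (x(i := t)) \<in> coord_space m"
        by (rule eventually_mono) (use Fc in blast)
    qed (use Ck_has_pd[OF Suc.prems(1)] that in blast)
    then show ?thesis by simp
  qed
  show ?case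
  proof (rule Ck_SucI[OF W C D])
    fix i assume i: "i < n"
    show "Ck_coord n W k (\<lambda>x. \<Sum>j<m. pd j f (F x) * pd i (\<lambda>x. F x j) x)"
    proof (rule Ck_sum[OF W])
      fix j assume "j \<in> {..<m}"
      then have j: "j < m" by simp
      show "Ck_coord n W k (\<lambda>x. pd j f (F x) * pd i (\<lambda>x. F x j) x)"
        by (rule Ck_mult[OF W Suc.IH[OF Ck_Suc_imp[OF Suc.prems(1)] Ck_pd[OF Suc.prems(2) j]]
            Ck_pd[OF Suc.prems(1)[OF j] i]])
    qed
  qed
qed

subsection \<open>Second derivatives\<close>

text \<open>The mean value theorem is applied in direction \<open>i\<close> to the increment
  \<open>\<phi>\<close> taken in direction \<open>j\<close>, and once more in direction
  \<open>j\<close>. Up to rearrangement the left-hand side is symmetric in \<open>i\<close> and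
  \<open>j\<close>, which is why mixed derivatives commute.\<close>

lemma second_difference:
  assumes W: "openin (Euclidean_space n) W" and f: "Ck_coord n W (Suc (Suc 0)) f"
    and x: "x \<in> W" and ij: "i < n" "j < n" "i \<noteq> j" and h: "h > 0"
    and sub: "coord_ball n x d \<subseteq> W" "h < d"
  shows "\<exists>y\<in>coord_ball n x d.
    f (x(i := x i + h, j := x j + h)) - f (x(i := x i + h)) - f (x(j := x j + h)) + f x =
      h * h * pd j (pd i f) y"
proof -
  have xc: "x \<in> coord_space n" using W x open_in_coord_space by blast
  have inb: "x(i := s, j := r) \<in> coord_ball n x d" if "\<bar>s - x i\<bar> \<le> h" "\<bar>r - x j\<bar> \<le> h" for s r
  proof -
    have "\<bar>(x(i := s, j := r)) l - x l\<bar> < d" for l using that h sub(2) by simp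
    then show ?thesis
      unfolding coord_ball_def
      using fun_upd_in_coord_space[OF fun_upd_in_coord_space[OF xc ij(1)] ij(2)] by blast
  qed
  have inW: "x(i := s, j := r) \<in> W" if "\<bar>s - x i\<bar> \<le> h" "\<bar>r - x j\<bar> \<le> h" for s r
    using inb that sub by blast
  define \<phi> where "\<phi> s = f (x(i := s, j := x j + h)) - f (x(i := s, j := x j))" for s
  have Di: "((\<lambda>s. f (x(i := s, j := r))) has_real_derivative pd i f (x(i := s, j := r))) (at s)"
    if "\<bar>s - x i\<bar> \<le> h" "\<bar>r - x j\<bar> \<le> h" for s r
  proof -
    have "((\<lambda>t. f ((x(i := s, j := r))(i := t))) has_real_derivative pd i f (x(i := s, j := r)))
        (at ((x(i := s, j := r)) i))"
      by (rule Ck_has_pd[OF f ij(1) inW[OF that]])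
    moreover have "(x(i := s, j := r))(i := t) = x(i := t, j := r)" for t using ij by auto
    ultimately show ?thesis using ij by simp
  qed
  have "\<exists>s. \<bar>s - x i\<bar> \<le> \<bar>x i + h - x i\<bar> \<and> \<phi> (x i + h) - \<phi> (x i) =
      (pd i f (x(i := s, j := x j + h)) - pd i f (x(i := s, j := x j))) * (x i + h - x i)"
  proof (rule mean_value_real)
    fix t assume "\<bar>t - x i\<bar> \<le> \<bar>x i + h - x i\<bar>"
    then show "(\<phi> has_real_derivative
        pd i f (x(i := t, j := x j + h)) - pd i f (x(i := t, j := x j))) (at t)"
      unfolding \<phi>_def using h by (intro DERIV_diff Di) auto
  qed
  then obtain s where s: "\<bar>s - x i\<bar> \<le> h" "\<phi> (x i + h) - \<phi> (x i) =
      (pd i f (x(i := s, j := x j + h)) - pd i f (x(i := s, j := x j))) * h"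
    using h by auto
  have "\<exists>r. \<bar>r - x j\<bar> \<le> \<bar>x j + h - x j\<bar> \<and>
     pd i f (x(i := s, j := x j + h)) - pd i f (x(i := s, j := x j)) =
       pd j (pd i f) (x(i := s, j := r)) * (x j + h - x j)"
  proof (rule mean_value_real)
    fix r assume "\<bar>r - x j\<bar> \<le> \<bar>x j + h - x j\<bar>"
    then have "((\<lambda>t. pd i f ((x(i := s, j := r))(j := t))) has_real_derivative
        pd j (pd i f) (x(i := s, j := r))) (at ((x(i := s, j := r)) j))"
      by (intro Ck_has_pd[OF Ck_pd[OF f ij(1)] ij(2) inW]) (use s h in auto)
    then show "((\<lambda>r. pd i f (x(i := s, j := r))) has_real_derivative
        pd j (pd i f) (x(i := s, j := r))) (at r)" by simp
  qed
  then obtain r where r: "\<bar>r - x j\<bar> \<le> h"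
     "pd i f (x(i := s, j := x j + h)) - pd i f (x(i := s, j := x j)) =
       pd j (pd i f) (x(i := s, j := r)) * h" using h by auto
  have "f (x(i := x i + h, j := x j + h)) - f (x(i := x i + h)) - f (x(j := x j + h)) + f x =
     \<phi> (x i + h) - \<phi> (x i)"
    using ij by (simp add: \<phi>_def fun_upd_idem)
  then show ?thesis using s r inb[OF s(1) r(1)] by (intro bexI) auto
qed

lemma pd_commute:
  assumes W: "openin (Euclidean_space n) W" and f: "Ck_coord n W (Suc (Suc 0)) f"
    and x: "x \<in> W" and ij: "i < n" "j < n"
  shows "pd i (pd j f) x = pd j (pd i f) x"
proof (rule ccontr)
  assume ne: "pd i (pd j f) x \<noteq> pd j (pd i f) x"
  then have "i \<noteq> j" by auto
  \<comment> \<open>Half of the supposed gap: two equal values, each within \<open>e\<close> of one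
    of the mixed derivatives, are then impossible.\<close>
  define e where "e = \<bar>pd i (pd j f) x - pd j (pd i f) x\<bar> / 2"
  have e: "e > 0" using ne by (simp add: e_def)
  have c: "continuous_on W (pd j (pd i f))" "continuous_on W (pd i (pd j f))"
    using f ij by auto
  obtain d1 where d1: "d1 > 0" "coord_ball n x d1 \<subseteq> W"
      "\<And>y. y \<in> coord_ball n x d1 \<Longrightarrow> \<bar>pd j (pd i f) y - pd j (pd i f) x\<bar> < e"
    by (rule continuous_on_coordE[OF W c(1) x e]) blast
  obtain d2 where d2: "d2 > 0" "coord_ball n x d2 \<subseteq> W"
      "\<And>y. y \<in> coord_ball n x d2 \<Longrightarrow> \<bar>pd i (pd j f) y - pd i (pd j f) x\<bar> < e"
    by (rule continuous_on_coordE[OF W c(2) x e]) blast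
  define h where "h = min d1 d2 / 2"
  have h: "h > 0" "h < d1" "h < d2" using d1 d2 by (auto simp: h_def)
  obtain y where y: "y \<in> coord_ball n x d1"
    "f (x(i := x i + h, j := x j + h)) - f (x(i := x i + h)) - f (x(j := x j + h)) + f x =
      h * h * pd j (pd i f) y"
    using second_difference[OF W f x ij \<open>i \<noteq> j\<close> h(1) d1(2) h(2)] by blast
  obtain z where z: "z \<in> coord_ball n x d2"
    "f (x(j := x j + h, i := x i + h)) - f (x(j := x j + h)) - f (x(i := x i + h)) + f x =
      h * h * pd i (pd j f) z"
    using second_difference[OF W f x ij(2,1) \<open>i \<noteq> j\<close>[symmetric] h(1) d2(2) h(3)] by blast
  have "x(i := x i + h, j := x j + h) = x(j := x j + h, i := x i + h)"
    using \<open>i \<noteq> j\<close> by auto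
  then have "h * h * pd j (pd i f) y = h * h * pd i (pd j f) z"
    using y(2) z(2) by (simp add: algebra_simps)
  then have "pd j (pd i f) y = pd i (pd j f) z" using h(1) by simp
  then show False using d1(3)[OF y(1)] d2(3)[OF z(1)] unfolding e_def by (auto simp: abs_if split: if_splits)
qed

text \<open>Both claims are the one-dimensional conditions for \<open>f\<close> on lines through
  \<open>x\<close> in an arbitrary direction \<open>b\<close>; the first one follows with a unit
  vector.\<close>

lemma local_max_coord:
  assumes W: "openin (Euclidean_space n) W" and f: "Ck_coord n W (Suc (Suc 0)) f"
    and x: "x \<in> W" and mx: "\<And>y. y \<in> W \<Longrightarrow> f y \<le> f x"
  shows "i < n \<Longrightarrow> pd i f x = 0"
    and "(\<Sum>i<n. \<Sum>j<n. a i * a j * pd j (pd i f) x) \<le> 0"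
proof -
  have xc: "x \<in> coord_space n" using W x open_in_coord_space by blast
  obtain e where e: "e > 0" "coord_ball n x e \<subseteq> W" using W x coord_ballE by metis
  have key: "(\<Sum>i<n. pd i f x * b i) = 0 \<and> (\<Sum>i<n. \<Sum>j<n. b i * b j * pd j (pd i f) x) \<le> 0" for b
  proof -
    define \<gamma> where "\<gamma> t = (\<lambda>i. if i < n then x i + t * b i else 0)" for t :: real
    have \<gamma>0: "\<gamma> 0 = x" using xc by (auto simp: \<gamma>_def topspace_Euclidean_space)
    have \<gamma>c: "\<gamma> t \<in> coord_space n" for t by (auto simp: \<gamma>_def topspace_Euclidean_space)
    have \<gamma>D: "((\<lambda>t. \<gamma> t i) has_real_derivative b i) (at t)" if "i < n" for i t
      using that by (auto simp: \<gamma>_def intro!: derivative_eq_intros)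
    \<comment> \<open>The added 1 keeps \<open>C\<close> positive for \<open>b = 0\<close> and the
      bound on the entries strict.\<close>
    define C where "C = (\<Sum>i<n. \<bar>b i\<bar>) + 1"
    have C: "C > 0" "\<And>i. i < n \<Longrightarrow> \<bar>b i\<bar> < C"
    proof -
      show "C > 0" unfolding C_def by (simp add: add_nonneg_pos sum_nonneg)
      show "\<bar>b i\<bar> < C" if "i < n" for i
        unfolding C_def using member_le_sum[of i "{..<n}" "\<lambda>i. \<bar>b i\<bar>"] that by auto
    qed
    define d where "d = e / C"
    have d: "d > 0" using C e by (simp add: d_def)
    have inW: "\<gamma> t \<in> W" if "\<bar>t\<bar> < d" for t
    proof -
      have "\<bar>t * b i\<bar> < e" if "i < n" for i
      proof -
        have "\<bar>t\<bar> * \<bar>b i\<bar> \<le> \<bar>t\<bar> * C" using C(2)[OF that] by (intro mult_left_mono) auto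
        also have "\<dots> < d * C" using \<open>\<bar>t\<bar> < d\<close> C by simp
        also have "\<dots> = e" using C by (simp add: d_def)
        finally show ?thesis by (simp add: abs_mult)
      qed
      then have "\<gamma> t \<in> coord_ball n x e" using \<gamma>c by (auto simp: coord_ball_def \<gamma>_def)
      then show ?thesis using e by blast
    qed
    define h where "h t = f (\<gamma> t)" for t
    define h' where "h' t = (\<Sum>i<n. pd i f (\<gamma> t) * b i)" for t
    have hD: "(h has_real_derivative h' t) (at t)" if "\<bar>t\<bar> < d" for t
      unfolding h_def h'_def
      by (rule chain_rule_coord[where \<gamma>=\<gamma> and ?\<gamma>'=b, OF W _ inW[OF that]])
        (use Ck_Suc_imp[OF f] \<gamma>c \<gamma>D in \<open>auto simp del: Ck_coord.simps\<close>)
    have "((\<lambda>t. pd i f (\<gamma> t)) has_real_derivative (\<Sum>j<n. pd j (pd i f) (\<gamma> 0) * b j)) (at 0)"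
      if "i < n" for i
      by (rule chain_rule_coord[where \<gamma>=\<gamma> and ?\<gamma>'=b, OF W _ inW])
        (use Ck_pd[OF f that] \<gamma>c \<gamma>D d in \<open>auto simp del: Ck_coord.simps\<close>)
    then have "(h' has_real_derivative (\<Sum>i<n. (\<Sum>j<n. pd j (pd i f) (\<gamma> 0) * b j) * b i)) (at 0)"
      unfolding h'_def by (intro DERIV_sum DERIV_cmult_right) auto
    moreover have "(\<Sum>i<n. (\<Sum>j<n. pd j (pd i f) (\<gamma> 0) * b j) * b i) =
        (\<Sum>i<n. \<Sum>j<n. b i * b j * pd j (pd i f) x)"
      by (auto simp: \<gamma>0 sum_distrib_left sum_distrib_right algebra_simps intro!: sum.cong)
    ultimately have h'D: "(h' has_real_derivative (\<Sum>i<n. \<Sum>j<n. b i * b j * pd j (pd i f) x)) (at 0)"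
      by simp
    have hmax: "h t \<le> h 0" if "\<bar>t\<bar> < d" for t using mx inW[OF that] by (simp add: h_def \<gamma>0)
    have h'0: "h' 0 = 0"
      by (rule DERIV_local_max[OF hD d]) (use d hmax in auto)
    \<comment> \<open>Were the second derivative positive, \<open>h'\<close> would be positive just
      to the right of 0, and \<open>h\<close> would increase there.\<close>
    have "(\<Sum>i<n. \<Sum>j<n. b i * b j * pd j (pd i f) x) \<le> 0"
    proof (rule ccontr)
      assume "\<not> ?thesis"
      then obtain r where r: "r > 0" "\<And>t. t > 0 \<Longrightarrow> t < r \<Longrightarrow> h' 0 < h' (0 + t)"
        using DERIV_pos_inc_right[OF h'D] by auto
      define s where "s = min r d / 2"
      have s: "s > 0" "s < r" "s < d" using r d by (auto simp: s_def)
      have "h 0 < h s"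
      proof (rule DERIV_pos_imp_increasing_open[OF s(1)])
        fix t assume t: "0 < t" "t < s"
        have "(h has_real_derivative h' t) (at t)" "0 < h' t"
          using hD[of t] r(2)[of t] t s h'0 by auto
        then show "\<exists>y. (h has_real_derivative y) (at t) \<and> 0 < y" by blast
      next
        show "continuous_on {0..s} h"
          by (intro continuous_at_imp_continuous_on ballI DERIV_isCont[OF hD]) (use s in auto)
      qed
      then show False using hmax[of s] s by auto
    qed
    then show ?thesis using h'0 by (auto simp: h'_def \<gamma>0)
  qed
  show "pd i f x = 0" if "i < n"
  proof -
    have "(\<Sum>l<n. pd l f x * (if l = i then 1 else 0)) = pd i f x"
      using that by (simp add: if_distrib cong: if_cong)
    then show ?thesis using key[of "\<lambda>l. if l = i then 1 else 0"] by simp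
  qed
  show "(\<Sum>i<n. \<Sum>j<n. a i * a j * pd j (pd i f) x) \<le> 0" using key by blast
qed

subsection \<open>Smooth functions\<close>

lemma smooth_coord_iff:
  "openin (Euclidean_space n) W \<Longrightarrow> smooth_coord n W f \<longleftrightarrow> (\<forall>k. Ck_coord n W k f)"
  by (simp add: smooth_coord_iff_Ck openin_subset)

context
  fixes n W
  assumes W: "openin (Euclidean_space n) W"
begin

lemma smooth_coord_continuous: "smooth_coord n W f \<Longrightarrow> continuous_on W f"
  using Ck_continuous smooth_coord_iff[OF W] by blast

lemma smooth_coord_has_pd:
  "smooth_coord n W f \<Longrightarrow> i < n \<Longrightarrow> x \<in> W \<Longrightarrow>
   ((\<lambda>t. f (x(i := t))) has_real_derivative pd i f x) (at (x i))"
  using Ck_has_pd smooth_coord_iff[OF W] by blast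

lemma smooth_coord_const: "smooth_coord n W (\<lambda>x. c)"
  by (simp only: smooth_coord_iff[OF W] Ck_const[OF W] simp_thms)

lemma smooth_coord_component: "smooth_coord n W (\<lambda>x. x i)"
  by (simp only: smooth_coord_iff[OF W] Ck_component[OF W] simp_thms)

lemma smooth_coord_add:
  "smooth_coord n W f \<Longrightarrow> smooth_coord n W g \<Longrightarrow> smooth_coord n W (\<lambda>x. f x + g x)"
  unfolding smooth_coord_iff[OF W] using Ck_add[OF W] by blast

lemma smooth_coord_mult:
  "smooth_coord n W f \<Longrightarrow> smooth_coord n W g \<Longrightarrow> smooth_coord n W (\<lambda>x. f x * g x)"
  unfolding smooth_coord_iff[OF W] using Ck_mult[OF W] by blast

lemma smooth_coord_uminus: "smooth_coord n W f \<Longrightarrow> smooth_coord n W (\<lambda>x. - f x)"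
  using smooth_coord_mult[OF smooth_coord_const[of "-1"], of f] by simp

lemma smooth_coord_diff:
  "smooth_coord n W f \<Longrightarrow> smooth_coord n W g \<Longrightarrow> smooth_coord n W (\<lambda>x. f x - g x)"
  using smooth_coord_add[OF _ smooth_coord_uminus, of f g] by simp

lemma smooth_coord_sum:
  "(\<And>j. j \<in> J \<Longrightarrow> smooth_coord n W (f j)) \<Longrightarrow> smooth_coord n W (\<lambda>x. \<Sum>j\<in>J. f j x)"
  unfolding smooth_coord_iff[OF W] by (intro allI Ck_sum[OF W]) blast

lemma smooth_coord_prod:
  "(\<And>j. j \<in> J \<Longrightarrow> smooth_coord n W (f j)) \<Longrightarrow> smooth_coord n W (\<lambda>x. \<Prod>j\<in>J. f j x)"
  unfolding smooth_coord_iff[OF W] by (intro allI Ck_prod[OF W]) blast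

lemma smooth_coord_inverse:
  "smooth_coord n W f \<Longrightarrow> (\<And>x. x \<in> W \<Longrightarrow> f x \<noteq> 0) \<Longrightarrow> smooth_coord n W (\<lambda>x. inverse (f x))"
  unfolding smooth_coord_iff[OF W] using Ck_inverse[OF W] by blast

lemma smooth_coord_divide:
  "smooth_coord n W f \<Longrightarrow> smooth_coord n W g \<Longrightarrow> (\<And>x. x \<in> W \<Longrightarrow> g x \<noteq> 0) \<Longrightarrow>
   smooth_coord n W (\<lambda>x. f x / g x)"
  unfolding divide_inverse by (intro smooth_coord_mult smooth_coord_inverse) auto

lemma smooth_coord_real_compose:
  assumes "\<And>m s. s \<in> J \<Longrightarrow> (S m has_real_derivative S (Suc m) s) (at s)"
    and "\<And>x. x \<in> W \<Longrightarrow> f x \<in> J" and "smooth_coord n W f"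
  shows "smooth_coord n W (\<lambda>x. S m (f x))"
  using assms(3) unfolding smooth_coord_iff[OF W]
  using Ck_real_compose[OF W, where S = S and J = J and f = f] assms(1,2) by blast

lemma smooth_coord_cong:
  "(\<And>y. y \<in> W \<Longrightarrow> f y = g y) \<Longrightarrow> smooth_coord n W f \<Longrightarrow> smooth_coord n W g"
  unfolding smooth_coord_iff[OF W] using Ck_cong[OF W] by blast

lemma smooth_coord_local:
  assumes "\<And>x. x \<in> W \<Longrightarrow> \<exists>V. openin (Euclidean_space n) V \<and> x \<in> V \<and> V \<subseteq> W \<and> smooth_coord n V f"
  shows "smooth_coord n W f"
  unfolding smooth_coord_iff[OF W]
proof
  fix k
  show "Ck_coord n W k f"
  proof (rule Ck_local[OF W])
    fix x assume "x \<in> W"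
    then obtain V where "openin (Euclidean_space n) V" "x \<in> V" "V \<subseteq> W" "smooth_coord n V f"
      using assms by blast
    then show "\<exists>V. openin (Euclidean_space n) V \<and> x \<in> V \<and> V \<subseteq> W \<and> Ck_coord n V k f"
      using smooth_coord_iff[of n V f] by blast
  qed
qed

lemma smooth_coord_subset:
  "openin (Euclidean_space n) V \<Longrightarrow> V \<subseteq> W \<Longrightarrow> smooth_coord n W f \<Longrightarrow> smooth_coord n V f"
  using Ck_subset[of n W _ f V] smooth_coord_iff[of n V f] smooth_coord_iff[OF W, of f] by blast

lemma smooth_coord_compose:
  assumes "openin (Euclidean_space m) W'" "\<And>x. x \<in> W \<Longrightarrow> F x \<in> W'"
    "\<And>j. j < m \<Longrightarrow> smooth_coord n W (\<lambda>x. F x j)" "smooth_coord m W' f"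
  shows "smooth_coord n W (\<lambda>x. f (F x))"
  unfolding smooth_coord_iff[OF W]
proof
  fix k
  show "Ck_coord n W k (\<lambda>x. f (F x))"
    by (rule Ck_compose[OF W assms(1,2)]) (use assms smooth_coord_iff W in blast)+
qed

lemma smooth_pd_commute:
  assumes "smooth_coord n W f" "x \<in> W" "i < n" "j < n"
  shows "pd i (pd j f) x = pd j (pd i f) x"
  using pd_commute[OF W _ assms(2-4)] assms(1) smooth_coord_iff[OF W] by blast

lemma pd_add:
  assumes "smooth_coord n W f" "smooth_coord n W g" "x \<in> W" "i < n"
  shows "pd i (\<lambda>y. f y + g y) x = pd i f x + pd i g x"
  by (rule pd_eqI) (rule DERIV_add[OF smooth_coord_has_pd smooth_coord_has_pd]; use assms in blast)

lemma pd_cmult: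
  assumes "smooth_coord n W f" "x \<in> W" "i < n"
  shows "pd i (\<lambda>y. c * f y) x = c * pd i f x"
  by (rule pd_eqI) (rule DERIV_cmult[OF smooth_coord_has_pd]; use assms in blast)

lemma pd_mult:
  assumes "smooth_coord n W f" "smooth_coord n W g" "x \<in> W" "i < n"
  shows "pd i (\<lambda>y. f y * g y) x = pd i f x * g x + f x * pd i g x"
proof (rule pd_eqI)
  have "((\<lambda>t. f (x(i := t)) * g (x(i := t))) has_real_derivative
      pd i f x * g (x(i := x i)) + pd i g x * f (x(i := x i))) (at (x i))"
    by (rule DERIV_mult[OF smooth_coord_has_pd smooth_coord_has_pd]; use assms in blast)
  moreover have "pd i f x * g (x(i := x i)) + pd i g x * f (x(i := x i)) =
      pd i f x * g x + f x * pd i g x" by simp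
  ultimately show "((\<lambda>t. f (x(i := t)) * g (x(i := t))) has_real_derivative
      pd i f x * g x + f x * pd i g x) (at (x i))" by (simp only:)
qed

lemma pd_sum:
  assumes "\<And>j. j \<in> J \<Longrightarrow> smooth_coord n W (f j)" "x \<in> W" "i < n"
  shows "pd i (\<lambda>y. \<Sum>j\<in>J. f j y) x = (\<Sum>j\<in>J. pd i (f j) x)"
  by (rule pd_eqI) (rule DERIV_sum, rule smooth_coord_has_pd; use assms in blast)

lemma pd_real_compose:
  assumes S: "(S has_real_derivative S') (at (f x))" and "smooth_coord n W f" "x \<in> W" "i < n"
  shows "pd i (\<lambda>y. S (f y)) x = S' * pd i f x"
proof (rule pd_eqI)
  have "(S has_real_derivative S') (at (f (x(i := x i))))" using S by simp
  from DERIV_chain2[OF this smooth_coord_has_pd[OF assms(2,4,3)]]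
  show "((\<lambda>t. S (f (x(i := t)))) has_real_derivative S' * pd i f x) (at (x i))" .
qed

end

lemma pd_component: "pd i (\<lambda>x. x j) x = (if i = j then 1 else 0)"
  by (rule pd_eqI) auto

lemma smooth_chain_rule:
  assumes W: "openin (Euclidean_space n) W"
    and f: "smooth_coord n W f"
    and t0: "\<gamma> t0 \<in> W" and ev: "\<forall>\<^sub>F t in at t0. \<gamma> t \<in> coord_space n"
    and \<gamma>: "\<And>i. i < n \<Longrightarrow> ((\<lambda>t. \<gamma> t i) has_real_derivative \<gamma>' i) (at t0)"
  shows "((\<lambda>t. f (\<gamma> t)) has_real_derivative (\<Sum>i<n. pd i f (\<gamma> t0) * \<gamma>' i)) (at t0)"
  by (rule chain_rule_coord[OF W _ t0 ev \<gamma>]) (use f smooth_coord_iff[OF W] in blast)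

text \<open>Differentiating \<open>h (\<gamma> t)\<close> along an affine line gives a directional
  derivative of \<open>h\<close> on the line, which is smooth again; hence every iterated derivative
  is a smooth function evaluated on the line. This makes coordinate segments smooth curves.\<close>

lemma smooth_real_line:
  assumes W: "openin (Euclidean_space n) W" and f: "smooth_coord n W f"
    and J: "open J" "\<And>t. t \<in> J \<Longrightarrow> \<gamma> t \<in> W" and c: "\<And>t. \<gamma> t \<in> coord_space n"
    and \<gamma>: "\<And>t i. i < n \<Longrightarrow> \<gamma> t i = a i + t * b i"
  shows "smooth_real J (\<lambda>t. f (\<gamma> t))"
proof -
  have D: "((\<lambda>t. h (\<gamma> t)) has_real_derivative (\<Sum>j<n. pd j h (\<gamma> t) * b j)) (at t)"
    if "smooth_coord n W h" "t \<in> J" for h t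
  proof (rule smooth_chain_rule[where \<gamma> = \<gamma>, OF W that(1) J(2)[OF that(2)]])
    show "((\<lambda>t. \<gamma> t i) has_real_derivative b i) (at t)" if "i < n" for i
      using \<gamma>[OF that] by (auto intro!: derivative_eq_intros)
  qed (use c in auto)
  have "\<exists>h. smooth_coord n W h \<and> (\<forall>t\<in>J. (deriv ^^ k) (\<lambda>t. f (\<gamma> t)) t = h (\<gamma> t))" for k
  proof (induction k)
    case 0 then show ?case using f by auto
  next
    case (Suc k)
    then obtain h where h: "smooth_coord n W h" "\<And>t. t \<in> J \<Longrightarrow> (deriv ^^ k) (\<lambda>t. f (\<gamma> t)) t = h (\<gamma> t)"
      by blast
    show ?case
    proof (intro exI conjI ballI)
      show "smooth_coord n W (\<lambda>x. \<Sum>j<n. pd j h x * b j)"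
        by (intro smooth_coord_sum[OF W] smooth_coord_mult[OF W] smooth_coord_const[OF W]
            smooth_coord_pd[OF h(1)]) auto
      fix t assume t: "t \<in> J"
      have "\<forall>\<^sub>F s in nhds t. (deriv ^^ k) (\<lambda>t. f (\<gamma> t)) s = h (\<gamma> s)"
        using eventually_nhds_in_open[OF J(1) t] by (rule eventually_mono) (rule h(2))
      then have "deriv ((deriv ^^ k) (\<lambda>t. f (\<gamma> t))) t = deriv (\<lambda>t. h (\<gamma> t)) t"
        by (rule deriv_cong_ev) simp
      also have "\<dots> = (\<Sum>j<n. pd j h (\<gamma> t) * b j)" by (rule DERIV_imp_deriv[OF D[OF h(1) t]])
      finally show "(deriv ^^ Suc k) (\<lambda>t. f (\<gamma> t)) t = (\<Sum>j<n. pd j h (\<gamma> t) * b j)" by simp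
    qed
  qed
  note ex = this
  show ?thesis
    unfolding smooth_real_def
  proof (intro allI ballI)
    fix k t assume t: "t \<in> J"
    obtain h where h: "smooth_coord n W h" "\<And>t. t \<in> J \<Longrightarrow> (deriv ^^ k) (\<lambda>t. f (\<gamma> t)) t = h (\<gamma> t)"
      using ex[of k] by blast
    have ev: "\<forall>\<^sub>F s in nhds t. (deriv ^^ k) (\<lambda>t. f (\<gamma> t)) s = h (\<gamma> s)"
      using eventually_nhds_in_open[OF J(1) t] by (rule eventually_mono) (rule h(2))
    have "((deriv ^^ k) (\<lambda>t. f (\<gamma> t)) has_real_derivative (\<Sum>j<n. pd j h (\<gamma> t) * b j)) (at t)"
      using D[OF h(1) t] by (subst DERIV_cong_ev[OF refl ev refl])
    then show "(deriv ^^ k) (\<lambda>t. f (\<gamma> t)) differentiable at t"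
      by (auto simp: real_differentiable_def)
  qed
qed

subsection \<open>Hadamard's lemma\<close>

context
  fixes n :: nat and a :: "nat \<Rightarrow> real" and e :: real
  assumes a: "a \<in> coord_space n" and e: "e > 0"
begin

definition segm :: "real \<Rightarrow> (nat \<Rightarrow> real) \<Rightarrow> nat \<Rightarrow> real" where
  "segm t x = (\<lambda>j. a j + t * (x j - a j))"

lemma segm_in_ball:
  assumes "x \<in> coord_ball n a e" "0 \<le> t" "t \<le> 1"
  shows "segm t x \<in> coord_ball n a e"
proof -
  have "\<bar>t * (x j - a j)\<bar> < e" if "j < n" for j
  proof -
    have "\<bar>t * (x j - a j)\<bar> \<le> 1 * \<bar>x j - a j\<bar>"
      unfolding abs_mult using assms by (intro mult_right_mono) auto
    also have "\<dots> < e" using assms that by (auto simp: coord_ball_def)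
    finally show ?thesis .
  qed
  then show ?thesis
    using assms a by (auto simp: coord_ball_def segm_def topspace_Euclidean_space)
qed

lemma continuous_on_segm:
  assumes "continuous_on (coord_ball n a e) q"
  shows "continuous_on (coord_ball n a e \<times> cbox 0 1) (\<lambda>(x, t). (t::real) ^ m * (q (segm t x) :: real))"
proof -
  have 1: "continuous_on (coord_ball n a e \<times> cbox 0 1) (\<lambda>p. segm (snd p) (fst p))"
    unfolding segm_def
    by (intro continuous_on_coordinatewise_then_product continuous_intros
        continuous_on_product_then_coordinatewise[OF continuous_on_fst[OF continuous_on_id]])
  have "continuous_on (coord_ball n a e \<times> cbox 0 1) (\<lambda>p. q (segm (snd p) (fst p)))"
    by (rule continuous_on_compose2[OF assms 1]) (auto intro!: segm_in_ball)
  then show ?thesis by (auto simp: case_prod_beta intro!: continuous_intros)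
qed

text \<open>Differentiating \<open>q (segm t x)\<close> in a coordinate of \<open>x\<close> produces
  a factor \<open>t\<close>; the weight \<open>t ^ m\<close> with arbitrary \<open>m\<close> absorbs
  it, so that the induction closes.\<close>

lemma Ck_segm_integral:
  "Ck_coord n (coord_ball n a e) k q \<Longrightarrow>
   Ck_coord n (coord_ball n a e) k (\<lambda>x. integral (cbox 0 1) (\<lambda>t. t ^ m * q (segm t x)))"
proof (induction k arbitrary: q m)
  case 0
  show ?case
    using integral_continuous_on_param[OF continuous_on_segm] 0 by simp
next
  case (Suc k)
  let ?B = "coord_ball n a e"
  have C: "continuous_on ?B (\<lambda>x. integral (cbox 0 1) (\<lambda>t. t ^ m * q (segm t x)))"
    by (rule integral_continuous_on_param[OF continuous_on_segm[OF Ck_continuous[OF Suc.prems]]])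
  show ?case
  proof (rule Ck_SucI[OF openin_coord_ball C])
    show "Ck_coord n ?B k (\<lambda>x. integral (cbox 0 1) (\<lambda>t. t ^ Suc m * pd i q (segm t x)))" if "i < n" for i
      by (rule Suc.IH[OF Ck_pd[OF Suc.prems that]])
    fix i x assume i: "i < n" and x: "x \<in> ?B"
    define U where "U = ball (a i) e"
    have xU: "x(i := s) \<in> ?B" if "s \<in> U" for s
      using x i that fun_upd_in_coord_space[of x n i s]
      by (auto simp: coord_ball_def U_def dist_real_def abs_minus_commute)
    have contU: "continuous_on (U \<times> cbox 0 1) (\<lambda>(s, t). t ^ l * (p (segm t (x(i := s))) :: real))"
      if "continuous_on ?B p" for p l
    proof -
      have 1: "continuous_on (U \<times> cbox 0 (1::real)) (\<lambda>z. (x(i := fst z), snd z))"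
      proof (intro continuous_on_Pair continuous_on_coordinatewise_then_product)
        fix j
        show "continuous_on (U \<times> cbox 0 (1::real)) (\<lambda>z. (x(i := fst z)) j)"
          by (cases "j = i") (auto intro!: continuous_intros)
      qed (intro continuous_intros)
      have "continuous_on (U \<times> cbox 0 1) (\<lambda>z. (\<lambda>(x, t). t ^ l * p (segm t x)) (x(i := fst z), snd z))"
        by (rule continuous_on_compose2[OF continuous_on_segm[OF that] 1]) (auto intro: xU)
      then show ?thesis by (simp add: case_prod_beta)
    qed
    have "((\<lambda>s. integral (cbox 0 1) (\<lambda>t. t ^ m * q (segm t (x(i := s))))) has_field_derivative
        integral (cbox 0 1) (\<lambda>t. t ^ Suc m * pd i q (segm t (x(i := x i))))) (at (x i) within U)"
    proof (rule leibniz_rule_field_derivative)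
      fix s t assume st: "s \<in> U" "t \<in> cbox 0 (1::real)"
      let ?y = "segm t (x(i := s))"
      have y: "?y \<in> ?B" using segm_in_ball[OF xU[OF st(1)]] st by auto
      have eq: "segm t (x(i := r)) = ?y(i := a i + t * (r - a i))" for r
        by (auto simp: segm_def)
      have yi: "?y i = a i + t * (s - a i)" by (simp add: segm_def)
      have 1: "((\<lambda>r. q (?y(i := r))) has_real_derivative pd i q ?y) (at (a i + t * (s - a i)))"
        using Ck_has_pd[OF Suc.prems i y] unfolding yi .
      have 2: "((\<lambda>r. a i + t * (r - a i)) has_real_derivative t) (at s)"
        by (auto intro!: derivative_eq_intros)
      have fe: "(\<lambda>r. q (segm t (x(i := r)))) = (\<lambda>r. q (?y(i := a i + t * (r - a i))))"
        by (intro ext arg_cong[of _ _ q] eq)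
      have "((\<lambda>r. q (segm t (x(i := r)))) has_real_derivative pd i q ?y * t) (at s)"
        unfolding fe by (rule DERIV_chain2[OF 1 2])
      then have "((\<lambda>r. t ^ m * q (segm t (x(i := r)))) has_real_derivative t ^ m * (pd i q ?y * t)) (at s)"
        by (rule DERIV_cmult)
      moreover have "t ^ m * (pd i q ?y * t) = t ^ Suc m * pd i q ?y" by simp
      ultimately show "((\<lambda>s. t ^ m * q (segm t (x(i := s)))) has_real_derivative
          t ^ Suc m * pd i q ?y) (at s within U)"
        by (simp only: has_field_derivative_at_within)
    next
      fix s assume s: "s \<in> U"
      have "continuous_on (cbox 0 1) (\<lambda>t. (\<lambda>(s, t). t ^ m * q (segm t (x(i := s)))) (s, t))"
        by (rule continuous_on_compose2[OF contU[OF Ck_continuous[OF Suc.prems]]])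
          (use s in \<open>auto intro!: continuous_intros\<close>)
      then show "(\<lambda>t. t ^ m * q (segm t (x(i := s)))) integrable_on cbox 0 1"
        by (intro integrable_continuous) simp
    next
      show "continuous_on (U \<times> cbox 0 1) (\<lambda>(s, t). t ^ Suc m * pd i q (segm t (x(i := s))))"
        by (rule contU[OF Ck_continuous[OF Ck_pd[OF Suc.prems i]]])
      show "x i \<in> U" using x i by (auto simp: coord_ball_def U_def dist_real_def abs_minus_commute)
      show "convex U" by (simp add: U_def)
    qed
    moreover have "x i \<in> U" "open U"
      using x i by (auto simp: coord_ball_def U_def dist_real_def abs_minus_commute)
    ultimately show "((\<lambda>s. integral (cbox 0 1) (\<lambda>t. t ^ m * q (segm t (x(i := s))))) has_real_derivative
        integral (cbox 0 1) (\<lambda>t. t ^ Suc m * pd i q (segm t x))) (at (x i))"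
      by (simp only: at_within_open fun_upd_triv)
  qed
qed

text \<open>The factors are the averages of \<open>pd i f\<close> over the segment from
  \<open>a\<close> to \<open>x\<close>, by the fundamental theorem of calculus. Their smoothness is
  what the Leibniz rule for derivations requires.\<close>

lemma hadamard_ball:
  assumes f: "smooth_coord n (coord_ball n a e) f"
  obtains h where "\<And>i. i < n \<Longrightarrow> smooth_coord n (coord_ball n a e) (h i)"
    "\<And>i. i < n \<Longrightarrow> h i a = pd i f a"
    "\<And>x. x \<in> coord_ball n a e \<Longrightarrow> f x = f a + (\<Sum>i<n. (x i - a i) * h i x)"
proof
  let ?B = "coord_ball n a e"
  note B = openin_coord_ball[of n a e]
  define h where "h i x = integral (cbox 0 1) (\<lambda>t. t ^ 0 * pd i f (segm t x))" for i x
  show "smooth_coord n ?B (h i)" if "i < n" for i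
    unfolding h_def smooth_coord_iff[OF B]
    using Ck_segm_integral[of _ "pd i f" 0] smooth_coord_pd[OF f that] smooth_coord_iff[OF B] by blast
  show "h i a = pd i f a" if "i < n" for i
    by (simp add: h_def segm_def)
  fix x assume x: "x \<in> ?B"
  have D: "((\<lambda>t. f (segm t x)) has_real_derivative (\<Sum>i<n. pd i f (segm t x) * (x i - a i))) (at t)"
    if "t \<in> {0..1}" for t
  proof (rule smooth_chain_rule[OF B f])
    show "segm t x \<in> ?B" using segm_in_ball[OF x] that by auto
    have "segm s x \<in> coord_space n" for s
      using x a by (auto simp: segm_def coord_ball_def topspace_Euclidean_space)
    then show "\<forall>\<^sub>F t in at t. segm t x \<in> coord_space n" by simp
    show "((\<lambda>t. segm t x i) has_real_derivative x i - a i) (at t)" for i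
      by (auto simp: segm_def intro!: derivative_eq_intros)
  qed
  have I: "((\<lambda>t. \<Sum>i<n. pd i f (segm t x) * (x i - a i)) has_integral (f (segm 1 x) - f (segm 0 x))) {0..1}"
    by (rule fundamental_theorem_of_calculus)
      (use D in \<open>auto simp: has_real_derivative_iff_has_vector_derivative[symmetric] intro: has_field_derivative_at_within\<close>)
  have int: "(\<lambda>t. pd i f (segm t x)) integrable_on {0..1}" if "i < n" for i
  proof -
    have "continuous_on (cbox 0 1) (\<lambda>t. (\<lambda>(x, t). t ^ 0 * pd i f (segm t x)) (x, t))"
      by (rule continuous_on_compose2[OF continuous_on_segm[OF smooth_coord_continuous[OF B smooth_coord_pd[OF f that]]]])
        (use x in \<open>auto intro!: continuous_intros\<close>)
    then show ?thesis using integrable_continuous[of 0 1 "\<lambda>t. pd i f (segm t x)"] by simp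
  qed
  have "f (segm 1 x) - f (segm 0 x) = integral {0..1} (\<lambda>t. \<Sum>i<n. pd i f (segm t x) * (x i - a i))"
    using I by (simp add: integral_unique)
  also have "\<dots> = (\<Sum>i<n. integral {0..1} (\<lambda>t. pd i f (segm t x) * (x i - a i)))"
    by (rule integral_sum) (auto intro!: integrable_on_mult_left int)
  also have "\<dots> = (\<Sum>i<n. (x i - a i) * h i x)"
    by (intro sum.cong refl) (simp add: h_def integral_mult_left mult.commute)
  finally have "f (segm 1 x) - f (segm 0 x) = (\<Sum>i<n. (x i - a i) * h i x)" .
  moreover have "segm 1 x = x" "segm 0 x = a" by (auto simp: segm_def)
  ultimately show "f x = f a + (\<Sum>i<n. (x i - a i) * h i x)" by simp
qed

end

subsection \<open>Bump functions\<close>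

text \<open>With an arbitrary polynomial in \<open>1 / s\<close> the family is closed under
  differentiation, so a single derivative lemma proves the smoothness of the classical function
  \<open>exp (- (1 / s))\<close> extended by 0.\<close>

definition flat :: "real poly \<Rightarrow> real \<Rightarrow> real" where
  "flat p s = (if s > 0 then poly p (1 / s) * exp (- (1 / s)) else 0)"

text \<open>With y = 1 / s, differentiating p(y) exp(-y) in s gives the factor y^2 and the
  polynomial p - p'.\<close>

definition flat_deriv :: "real poly \<Rightarrow> real poly" where
  "flat_deriv p = [:0, 0, 1:] * (p - pderiv p)"

lemma poly_times_exp_tendsto_0: "((\<lambda>y::real. poly p y * exp (- y)) \<longlongrightarrow> 0) at_top"
proof -
  have "((\<lambda>y::real. \<Sum>i\<le>degree p. coeff p i * (y ^ i / exp y)) \<longlongrightarrow> (\<Sum>i\<le>degree p. coeff p i * 0)) at_top"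
    by (intro tendsto_intros tendsto_power_div_exp_0)
  moreover have "(\<Sum>i\<le>degree p. coeff p i * (y ^ i / exp y)) = poly p y * exp (- y)" for y :: real
    by (simp add: poly_altdef exp_minus sum_distrib_right divide_inverse mult.assoc)
  ultimately show ?thesis by simp
qed

lemma DERIV_flat: "(flat p has_real_derivative flat (flat_deriv p) s) (at s)"
proof -
  consider "s > 0" | "s < 0" | "s = 0" by linarith
  then show ?thesis
  proof cases
    case 1
    have ev: "\<forall>\<^sub>F t in nhds s. flat p t = poly p (1 / t) * exp (- (1 / t))"
      using eventually_nhds_in_open[of "{0<..}" s] 1 by (auto simp: flat_def elim!: eventually_mono)
    have inv: "((\<lambda>t. 1 / t) has_real_derivative - (1 / s\<^sup>2)) (at s)"
      using 1 by (auto intro!: derivative_eq_intros simp: power2_eq_square)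
    have 2: "((\<lambda>t. poly p (1 / t)) has_real_derivative poly (pderiv p) (1 / s) * - (1 / s\<^sup>2)) (at s)"
      by (rule DERIV_chain2[OF poly_DERIV inv])
    have 3: "((\<lambda>t. exp (- (1 / t))) has_real_derivative exp (- (1 / s)) * (1 / s\<^sup>2)) (at s)"
      by (rule DERIV_chain2[OF DERIV_exp]) (use DERIV_minus[OF inv] in simp)
    have "((\<lambda>t. poly p (1 / t) * exp (- (1 / t))) has_real_derivative flat (flat_deriv p) s) (at s)"
      using DERIV_mult[OF 2 3] 1
      by (simp add: flat_def flat_deriv_def algebra_simps power2_eq_square)
    then show ?thesis by (subst DERIV_cong_ev[OF refl ev refl])
  next
    case 2
    have ev: "\<forall>\<^sub>F t in nhds s. flat p t = 0"
      using eventually_nhds_in_open[of "{..<0}" s] 2 by (auto simp: flat_def elim!: eventually_mono)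
    show ?thesis using 2 by (subst DERIV_cong_ev[OF refl ev refl]) (auto simp: flat_def)
  next
    case 3
    \<comment> \<open>The difference quotient at 0 is p(y) exp(-y) / h with y = 1 / h; dividing by h
      multiplies the polynomial by y, that is, turns \<open>p\<close> into
      \<open>pCons 0 p\<close>.\<close>
    have "((\<lambda>y. poly (pCons 0 p) y * exp (- y)) \<longlongrightarrow> 0) at_top"
      by (rule poly_times_exp_tendsto_0)
    then have "((\<lambda>h. poly (pCons 0 p) (inverse h) * exp (- inverse h)) \<longlongrightarrow> (0::real)) (at_right 0)"
      by (rule filterlim_compose[OF _ filterlim_inverse_at_top_right])
    moreover have "\<forall>\<^sub>F h in at_right 0. poly (pCons 0 p) (inverse h) * exp (- inverse h) = flat p h / h"
      by (auto simp: eventually_at_filter flat_def divide_inverse)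
    ultimately have R: "((\<lambda>h. flat p h / h) \<longlongrightarrow> 0) (at_right 0)"
      by (rule Lim_transform_eventually)
    have "\<forall>\<^sub>F h in at_left 0. 0 = flat p h / h"
      by (auto simp: eventually_at_filter flat_def)
    then have L: "((\<lambda>h. flat p h / h) \<longlongrightarrow> 0) (at_left 0)"
      by (rule Lim_transform_eventually[OF tendsto_const])
    show ?thesis
      unfolding has_field_derivative_iff 3 using filterlim_split_at[OF L R] by (simp add: flat_def)
  qed
qed

definition bump :: "nat \<Rightarrow> (nat \<Rightarrow> real) \<Rightarrow> real \<Rightarrow> (nat \<Rightarrow> real) \<Rightarrow> real" where
  "bump n a e x = (\<Prod>i<n. flat 1 (1 - ((x i - a i) / e)\<^sup>2))"

lemma smooth_coord_bump:
  assumes W: "openin (Euclidean_space n) W"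
  shows "smooth_coord n W (bump n a e)"
proof -
  have "smooth_coord n W (\<lambda>x. (\<lambda>m. flat ((flat_deriv ^^ m) 1)) 0 (1 - (1 / e) * (1 / e) * ((x i - a i) * (x i - a i))))" for i
  proof (rule smooth_coord_real_compose[OF W, where J = UNIV and S = "\<lambda>m. flat ((flat_deriv ^^ m) 1)" and m = 0])
    show "(flat ((flat_deriv ^^ m) 1) has_real_derivative flat ((flat_deriv ^^ Suc m) 1) s) (at s)" for m s
      using DERIV_flat[of "(flat_deriv ^^ m) 1"] by simp
    show "smooth_coord n W (\<lambda>x. 1 - (1 / e) * (1 / e) * ((x i - a i) * (x i - a i)))"
      by (intro smooth_coord_diff[OF W] smooth_coord_mult[OF W] smooth_coord_const[OF W]
          smooth_coord_component[OF W])
  qed simp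
  then have "smooth_coord n W (\<lambda>x. flat 1 (1 - ((x i - a i) / e)\<^sup>2))" for i
    by (simp add: power2_eq_square)
  then show ?thesis unfolding bump_def by (intro smooth_coord_prod[OF W])
qed

lemma bump_pos: "e > 0 \<Longrightarrow> x \<in> coord_ball n a e \<Longrightarrow> bump n a e x > 0"
  unfolding bump_def
proof (rule prod_pos)
  fix i assume "e > 0" "x \<in> coord_ball n a e" "i \<in> {..<n}"
  then have "\<bar>(x i - a i) / e\<bar> < 1" by (auto simp: coord_ball_def)
  then have "((x i - a i) / e)\<^sup>2 < 1" by (simp add: abs_square_less_1)
  then show "0 < flat 1 (1 - ((x i - a i) / e)\<^sup>2)" by (simp add: flat_def)
qed

lemma bump_eq_0:
  assumes "e > 0" "x \<in> coord_space n" "x \<notin> coord_ball n a e"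
  shows "bump n a e x = 0"
proof -
  obtain i where i: "i < n" "\<bar>x i - a i\<bar> \<ge> e" using assms by (auto simp: coord_ball_def not_less)
  then have "\<bar>(x i - a i) / e\<bar> \<ge> 1" using assms(1) by simp
  then have "flat 1 (1 - ((x i - a i) / e)\<^sup>2) = 0"
    using abs_square_less_1[of "(x i - a i) / e"] by (auto simp: flat_def)
  then show ?thesis unfolding bump_def using i(1) by (intro prod_zero) auto
qed

section \<open>Positive definite matrices\<close>

definition posdef :: "nat \<Rightarrow> (nat \<Rightarrow> nat \<Rightarrow> real) \<Rightarrow> bool" where
  "posdef n A \<longleftrightarrow> (\<forall>i<n. \<forall>j<n. A i j = A j i) \<and>
     (\<forall>v. (\<exists>i<n. v i \<noteq> 0) \<longrightarrow> (\<Sum>i<n. \<Sum>j<n. A i j * v i * v j) > 0)"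

text \<open>The inverse by bordering: \<open>w\<close> is the vector that \<open>A\<close> maps to \<open>s\<close> times the last unit
  vector, where \<open>s\<close> is the Schur complement.\<close>

primrec pdinv :: "nat \<Rightarrow> (nat \<Rightarrow> nat \<Rightarrow> real) \<Rightarrow> nat \<Rightarrow> nat \<Rightarrow> real" where
  "pdinv 0 A = (\<lambda>i j. 0)"
| "pdinv (Suc n) A =
     (let w = (\<lambda>i. if i < n then - (\<Sum>j<n. pdinv n A i j * A j n) else if i = n then 1 else 0);
          s = A n n - (\<Sum>i<n. \<Sum>j<n. A n i * (pdinv n A i j * A j n))
      in (\<lambda>i j. pdinv n A i j + w i * w j / s))"

lemma posdef_Suc: "posdef (Suc n) A \<Longrightarrow> posdef n A"
  unfolding posdef_def
proof (intro conjI allI impI)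
  assume A: "(\<forall>i<Suc n. \<forall>j<Suc n. A i j = A j i) \<and>
     (\<forall>v. (\<exists>i<Suc n. v i \<noteq> 0) \<longrightarrow> (\<Sum>i<Suc n. \<Sum>j<Suc n. A i j * v i * v j) > 0)"
  fix v :: "nat \<Rightarrow> real" assume "\<exists>i<n. v i \<noteq> 0"
  then obtain i where "i < n" "v i \<noteq> 0" by blast
  then have "\<exists>i<Suc n. (v(n := 0)) i \<noteq> 0" by (intro exI[of _ i]) auto
  then have "(\<Sum>i<Suc n. \<Sum>j<Suc n. A i j * (v(n := 0)) i * (v(n := 0)) j) > 0"
    using conjunct2[OF A] by blast
  then show "(\<Sum>i<n. \<Sum>j<n. A i j * v i * v j) > 0" by simp
qed auto

text \<open>The Gram form with the matrix \<open>E\<close> stands in for a square root of the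
  inverse in all later sign arguments, and gives the symmetry of the inverse in the induction step.
  The Schur complements of the last claim are the denominators of the recursion.\<close>

lemma pdinv_correct:
  "posdef n A \<Longrightarrow>
    (\<forall>i j. n \<le> i \<or> n \<le> j \<longrightarrow> pdinv n A i j = 0) \<and>
    (\<forall>i<n. \<forall>j<n. (\<Sum>k<n. A i k * pdinv n A k j) = of_bool (i = j)) \<and>
    (\<exists>E. \<forall>i j. pdinv n A i j = (\<Sum>a<n. E a i * E a j)) \<and>
    (\<forall>m<n. A m m - (\<Sum>i<m. \<Sum>j<m. A m i * (pdinv m A i j * A j m)) > 0)"
proof (induction n)
  case (Suc n)
  define B where "B = pdinv n A"
  define w where "w = (\<lambda>i. if i < n then - (\<Sum>j<n. B i j * A j n) else if i = n then 1 else 0)"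
  define s where "s = A n n - (\<Sum>i<n. \<Sum>j<n. A n i * (B i j * A j n))"
  have Bw: "pdinv (Suc n) A = (\<lambda>i j. B i j + w i * w j / s)"
    unfolding pdinv.simps Let_def B_def w_def s_def ..
  have IH: "\<And>i j. n \<le> i \<or> n \<le> j \<Longrightarrow> B i j = 0"
    "\<And>i j. i < n \<Longrightarrow> j < n \<Longrightarrow> (\<Sum>k<n. A i k * B k j) = of_bool (i = j)"
    "\<exists>E. \<forall>i j. B i j = (\<Sum>a<n. E a i * E a j)"
    "\<And>m. m < n \<Longrightarrow> A m m - (\<Sum>i<m. \<Sum>j<m. A m i * (pdinv m A i j * A j m)) > 0"
    using Suc.IH[OF posdef_Suc[OF Suc.prems]] unfolding B_def by blast+
  have sym: "\<And>i j. i < Suc n \<Longrightarrow> j < Suc n \<Longrightarrow> A i j = A j i"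
    using Suc.prems unfolding posdef_def by blast
  obtain E where E: "\<And>i j. B i j = (\<Sum>a<n. E a i * E a j)" using IH(3) by blast
  have Bsym: "B i j = B j i" for i j unfolding E by (simp add: mult.commute)
  have Aw: "(\<Sum>k<Suc n. A i k * w k) = (if i = n then s else 0)" if "i < Suc n" for i
  proof -
    have "(\<Sum>k<Suc n. A i k * w k) = A i n - (\<Sum>k<n. \<Sum>j<n. A i k * (B k j * A j n))"
      by (simp add: w_def sum_distrib_left sum_negf)
    also have "\<dots> = (if i = n then s else 0)"
    proof (cases "i = n")
      case False
      then have i: "i < n" using that by simp
      have "(\<Sum>k<n. \<Sum>j<n. A i k * (B k j * A j n)) = (\<Sum>j<n. (\<Sum>k<n. A i k * B k j) * A j n)"
        by (subst sum.swap) (simp add: sum_distrib_right mult.assoc)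
      also have "\<dots> = (\<Sum>j<n. of_bool (i = j) * A j n)" using IH(2) i by simp
      also have "\<dots> = A i n" using i by (simp add: of_bool_def if_distrib if_distribR cong: if_cong)
      finally show ?thesis using False by simp
    qed (simp add: s_def)
    finally show ?thesis .
  qed
  \<comment> \<open>The Schur complement is the value of the quadratic form on \<open>w\<close>,
    because \<open>A\<close> maps \<open>w\<close> to \<open>s\<close> times the last unit vector
    and \<open>w n = 1\<close>.\<close>
  have "0 < (\<Sum>i<Suc n. \<Sum>j<Suc n. A i j * w i * w j)"
  proof -
    have "w n \<noteq> 0" by (simp add: w_def)
    then show ?thesis using Suc.prems unfolding posdef_def by blast
  qed
  also have "\<dots> = (\<Sum>i<Suc n. w i * (\<Sum>j<Suc n. A i j * w j))"
    unfolding sum_distrib_left by (intro sum.cong refl) (simp add: mult_ac)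
  also have "\<dots> = (\<Sum>i<Suc n. w i * (if i = n then s else 0))"
    by (intro sum.cong refl) (simp only: Aw lessThan_iff)
  also have "\<dots> = s" by (simp add: w_def)
  finally have s: "s > 0" .
  show ?case unfolding Bw
  proof (intro conjI allI impI)
    show "B i j + w i * w j / s = 0" if "Suc n \<le> i \<or> Suc n \<le> j" for i j
      using that IH(1)[of i j] by (auto simp: w_def)
    show "(\<Sum>k<Suc n. A i k * (B k j + w k * w j / s)) = of_bool (i = j)"
      if ij: "i < Suc n" "j < Suc n" for i j
    proof -
      have "(\<Sum>k<Suc n. A i k * (B k j + w k * w j / s)) =
          (\<Sum>k<Suc n. A i k * B k j) + (\<Sum>k<Suc n. A i k * w k) * (w j / s)"
        by (simp only: sum_distrib_right sum.distrib[symmetric]) (simp add: algebra_simps)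
      also have "\<dots> = (\<Sum>k<n. A i k * B k j) + (if i = n then w j else 0)"
        using Aw[OF ij(1)] s IH(1)[of n j] by simp
      also have "\<dots> = of_bool (i = j)"
      proof (cases "i = n")
        case True
        show ?thesis
        proof (cases "j = n")
          case jn: True
          then show ?thesis using True IH(1) by (simp add: w_def)
        next
          case False
          then have j: "j < n" using ij by simp
          have "(\<Sum>k<n. A n k * B k j) = (\<Sum>k<n. B j k * A k n)"
            by (intro sum.cong refl) (use sym Bsym in \<open>auto simp: mult.commute\<close>)
          then show ?thesis using True False j by (simp add: w_def)
        qed
      next
        case False
        then have "i < n" using ij by simp
        then show ?thesis using False IH(1,2) ij by (cases "j = n") auto
      qed
      finally show ?thesis .
    qed
    \<comment> \<open>The new row \<open>w / sqrt s\<close> produces the rank one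
      correction.\<close>
    show "\<exists>E. \<forall>i j. B i j + w i * w j / s = (\<Sum>a<Suc n. E a i * E a j)"
      by (rule exI[of _ "\<lambda>a i. if a < n then E a i else w i / sqrt s"])
        (use s in \<open>auto simp: E\<close>)
    show "A m m - (\<Sum>i<m. \<Sum>j<m. A m i * (pdinv m A i j * A j m)) > 0" if "m < Suc n" for m
      using that IH(4)[of m] s by (cases "m = n") (auto simp: s_def B_def)
  qed
qed auto

text \<open>By symmetry \<open>pdinv\<close> is also a left inverse, and a left inverse equals every
  right inverse. This replaces the description operator by an explicit recursion.\<close>

lemma inverse_coeffs_eq_pdinv:
  assumes A: "posdef n A"
  shows "inverse_coeffs n A = pdinv n A"
  unfolding inverse_coeffs_def
proof (rule the_equality)
  show "(\<forall>i j. n \<le> i \<or> n \<le> j \<longrightarrow> pdinv n A i j = 0) \<and>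
      (\<forall>i<n. \<forall>j<n. (\<Sum>k<n. A i k * pdinv n A k j) = of_bool (i = j))"
    using pdinv_correct[OF A] by blast
  fix B assume B: "(\<forall>i j. n \<le> i \<or> n \<le> j \<longrightarrow> B i j = 0) \<and>
      (\<forall>i<n. \<forall>j<n. (\<Sum>k<n. A i k * B k j) = of_bool (i = j))"
  have "\<exists>E. \<forall>i j. pdinv n A i j = (\<Sum>a<n. E a i * E a j)"
    using pdinv_correct[OF A] by (elim conjE)
  then obtain E where E: "\<And>i j. pdinv n A i j = (\<Sum>a<n. E a i * E a j)" by blast
  have sym: "pdinv n A i j = pdinv n A j i" for i j unfolding E by (simp add: mult.commute)
  have "B i j = pdinv n A i j" for i j
  proof (cases "i < n \<and> j < n")
    case True
    have left: "(\<Sum>l<n. pdinv n A i l * A l k) = of_bool (i = k)" if "k < n" for k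
    proof -
      have "(\<Sum>l<n. pdinv n A i l * A l k) = (\<Sum>l<n. A k l * pdinv n A l i)"
        using A that sym unfolding posdef_def by (intro sum.cong refl) (auto simp: mult.commute)
      then show ?thesis using pdinv_correct[OF A] that True by auto
    qed
    have "(\<Sum>k<n. (\<Sum>l<n. pdinv n A i l * A l k) * B k j) = (\<Sum>l<n. pdinv n A i l * (\<Sum>k<n. A l k * B k j))"
      unfolding sum_distrib_left sum_distrib_right by (subst sum.swap) (simp add: mult.assoc)
    moreover have "(\<Sum>k<n. (\<Sum>l<n. pdinv n A i l * A l k) * B k j) = B i j"
    proof -
      have "(\<Sum>k<n. (\<Sum>l<n. pdinv n A i l * A l k) * B k j) = (\<Sum>k<n. if i = k then B k j else 0)"
        by (intro sum.cong refl) (simp only: left lessThan_iff, simp)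
      then show ?thesis using True by simp
    qed
    moreover have "(\<Sum>l<n. pdinv n A i l * (\<Sum>k<n. A l k * B k j)) = pdinv n A i j"
    proof -
      have "(\<Sum>l<n. pdinv n A i l * (\<Sum>k<n. A l k * B k j)) = (\<Sum>l<n. if l = j then pdinv n A i l else 0)"
        using B True by (intro sum.cong refl) auto
      then show ?thesis using True by simp
    qed
    ultimately show ?thesis by simp
  next
    case False
    then show ?thesis using B pdinv_correct[OF A] by (metis not_less)
  qed
  then show "B = pdinv n A" by blast
qed

text \<open>The recursion consists of sums, products and divisions by Schur complements, which are
  positive; so smooth dependence on the entries passes through each step.\<close>

lemma smooth_coord_pdinv:
  assumes W: "openin (Euclidean_space m) W"
    and "\<And>i j. i < n \<Longrightarrow> j < n \<Longrightarrow> smooth_coord m W (\<lambda>x. A x i j)"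
    and "\<And>x. x \<in> W \<Longrightarrow> posdef n (A x)"
  shows "smooth_coord m W (\<lambda>x. pdinv n (A x) i j)"
  using assms(2,3)
proof (induction n arbitrary: i j)
  case 0
  then show ?case using smooth_coord_const[OF W] by simp
next
  case (Suc n)
  have B: "smooth_coord m W (\<lambda>x. pdinv n (A x) i j)" for i j
    by (rule Suc.IH) (use Suc.prems posdef_Suc in auto)
  define w where "w x = (\<lambda>i. if i < n then - (\<Sum>j<n. pdinv n (A x) i j * A x j n) else if i = n then 1 else 0)" for x
  define s where "s x = A x n n - (\<Sum>i<n. \<Sum>j<n. A x n i * (pdinv n (A x) i j * A x j n))" for x
  have w: "smooth_coord m W (\<lambda>x. w x i)" for i
    unfolding w_def
    by (cases "i < n"; cases "i = n")
      (auto intro!: smooth_coord_uminus[OF W] smooth_coord_sum[OF W] smooth_coord_mult[OF W] B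
        smooth_coord_const[OF W] Suc.prems)
  have s: "smooth_coord m W s"
    unfolding s_def
    by (intro smooth_coord_diff[OF W] smooth_coord_sum[OF W] smooth_coord_mult[OF W] B Suc.prems) auto
  have "s x > 0" if "x \<in> W" for x
    using pdinv_correct[OF Suc.prems(2)[OF that]] by (simp add: s_def)
  then have "smooth_coord m W (\<lambda>x. pdinv n (A x) i j + w x i * w x j / s x)"
    by (intro smooth_coord_add[OF W] smooth_coord_divide[OF W] smooth_coord_mult[OF W] B w s) force
  then show ?case by (simp add: Let_def w_def s_def)
qed

section \<open>Riemannian calculus in coordinates\<close>

text \<open>The Bochner identity \<open>div (\<nabla>\<^sub>V V) = tr (\<nabla>V)\<^sup>2 + V (div V) + Ric V V\<close> for a torsion-free
  connection, in terms of the 2-jet of \<open>V\<close> (\<open>v\<close>, \<open>dv\<close>, \<open>ddv\<close>) and the 1-jet of the connection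
  coefficients (\<open>c\<close>, \<open>dc\<close>); the index of differentiation precedes the others in \<open>dc\<close> and follows
  them in \<open>dv\<close> and \<open>ddv\<close>.\<close>

lemma bochner_algebra:
  fixes v :: "nat \<Rightarrow> real"
  assumes c: "\<And>i j k. i < n \<Longrightarrow> j < n \<Longrightarrow> k < n \<Longrightarrow> c i j k = c i k j"
    and dc: "\<And>m i j k. m < n \<Longrightarrow> i < n \<Longrightarrow> j < n \<Longrightarrow> k < n \<Longrightarrow> dc m i j k = dc m i k j"
    and ddv: "\<And>i j m. i < n \<Longrightarrow> j < n \<Longrightarrow> m < n \<Longrightarrow> ddv i j m = ddv i m j"
    and A: "\<And>i j. A i j = dv i j + (\<Sum>k<n. c i j k * v k)"
  shows "(\<Sum>i<n. (\<Sum>j<n. (ddv i j i + (\<Sum>k<n. dc i i j k * v k + c i j k * dv k i)) * v j + A i j * dv j i)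
            + (\<Sum>j<n. c i i j * (\<Sum>k<n. A j k * v k)))
    = (\<Sum>i<n. \<Sum>j<n. A i j * A j i)
      + (\<Sum>j<n. v j * (\<Sum>i<n. ddv i i j + (\<Sum>k<n. dc j i i k * v k + c i i k * dv k j)))
      + (\<Sum>j<n. \<Sum>k<n. (\<Sum>i<n. dc i i j k - dc k i j i + (\<Sum>l<n. c i i l * c l j k - c i k l * c l j i)) * v j * v k)"
proof -
  \<comment> \<open>The left-hand side is the sum of \<open>L1\<close> to \<open>L5\<close>, the
    right-hand side is \<open>R0 + R1 + R2 + R3 + R4 - R5 + R6 - R7\<close>. Expanding
    \<open>A\<close> gives \<open>L4 = R0 - Q1 - Q2\<close> and \<open>L5 = P1 + P2\<close>.
    Renaming indices matches \<open>L1 = R1\<close>, \<open>L2 = R4\<close>, \<open>L3 = Q1\<close>,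
    \<open>P1 = R3\<close>, \<open>R2 = R5\<close>, \<open>P2 = R6\<close> and
    \<open>Q2 = R7\<close>; the symmetry assumptions enter for \<open>L1\<close>, \<open>L3\<close>,
    \<open>R2\<close> and \<open>Q2\<close>.\<close>
  define L1 where "L1 = (\<Sum>i<n. \<Sum>j<n. ddv i j i * v j)"
  define L2 where "L2 = (\<Sum>i<n. \<Sum>j<n. \<Sum>k<n. dc i i j k * v k * v j)"
  define L3 where "L3 = (\<Sum>i<n. \<Sum>j<n. \<Sum>k<n. c i j k * dv k i * v j)"
  define L4 where "L4 = (\<Sum>i<n. \<Sum>j<n. A i j * dv j i)"
  define L5 where "L5 = (\<Sum>i<n. \<Sum>j<n. \<Sum>k<n. c i i j * (A j k * v k))"
  define P1 where "P1 = (\<Sum>i<n. \<Sum>j<n. \<Sum>k<n. c i i j * dv j k * v k)"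
  define P2 where "P2 = (\<Sum>i<n. \<Sum>j<n. \<Sum>k<n. \<Sum>l<n. c i i j * (c j k l * v l * v k))"
  define Q1 where "Q1 = (\<Sum>i<n. \<Sum>j<n. \<Sum>k<n. dv i j * (c j i k * v k))"
  define Q2 where "Q2 = (\<Sum>i<n. \<Sum>j<n. \<Sum>k<n. \<Sum>l<n. c i j l * v l * (c j i k * v k))"
  define R0 where "R0 = (\<Sum>i<n. \<Sum>j<n. A i j * A j i)"
  define R1 where "R1 = (\<Sum>j<n. \<Sum>i<n. v j * ddv i i j)"
  define R2 where "R2 = (\<Sum>j<n. \<Sum>i<n. \<Sum>k<n. v j * (dc j i i k * v k))"
  define R3 where "R3 = (\<Sum>j<n. \<Sum>i<n. \<Sum>k<n. v j * (c i i k * dv k j))"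
  define R4 where "R4 = (\<Sum>j<n. \<Sum>k<n. \<Sum>i<n. dc i i j k * v j * v k)"
  define R5 where "R5 = (\<Sum>j<n. \<Sum>k<n. \<Sum>i<n. dc k i j i * v j * v k)"
  define R6 where "R6 = (\<Sum>j<n. \<Sum>k<n. \<Sum>i<n. \<Sum>l<n. c i i l * c l j k * v j * v k)"
  define R7 where "R7 = (\<Sum>j<n. \<Sum>k<n. \<Sum>i<n. \<Sum>l<n. c i k l * c l j i * v j * v k)"
  have "(\<Sum>i<n. (\<Sum>j<n. (ddv i j i + (\<Sum>k<n. dc i i j k * v k + c i j k * dv k i)) * v j + A i j * dv j i)
            + (\<Sum>j<n. c i i j * (\<Sum>k<n. A j k * v k))) = L1 + L2 + L3 + L4 + L5"
    unfolding L1_def L2_def L3_def L4_def L5_def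
    by (simp add: sum.distrib sum_distrib_left sum_distrib_right distrib_right)
  moreover have "(\<Sum>j<n. v j * (\<Sum>i<n. ddv i i j + (\<Sum>k<n. dc j i i k * v k + c i i k * dv k j))) = R1 + R2 + R3"
    unfolding R1_def R2_def R3_def
    by (simp add: sum.distrib sum_distrib_left sum_distrib_right distrib_left)
  moreover have "(\<Sum>j<n. \<Sum>k<n. (\<Sum>i<n. dc i i j k - dc k i j i + (\<Sum>l<n. c i i l * c l j k - c i k l * c l j i)) * v j * v k)
      = R4 - R5 + R6 - R7"
    unfolding R4_def R5_def R6_def R7_def
    by (simp add: sum.distrib sum_subtractf sum_distrib_left sum_distrib_right distrib_right left_diff_distrib)
  moreover have "L4 = R0 - Q1 - Q2"
  proof -
    have "L4 = (\<Sum>i<n. \<Sum>j<n. A i j * A j i - A i j * (\<Sum>k<n. c j i k * v k))"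
      unfolding L4_def by (intro sum.cong refl) (simp add: A[of j i for i j] distrib_left)
    also have "\<dots> = R0 - (\<Sum>i<n. \<Sum>j<n. A i j * (\<Sum>k<n. c j i k * v k))"
      unfolding R0_def by (simp add: sum_subtractf)
    also have "(\<Sum>i<n. \<Sum>j<n. A i j * (\<Sum>k<n. c j i k * v k)) = Q1 + Q2"
      unfolding Q1_def Q2_def A
      by (simp add: sum.distrib sum_distrib_left sum_distrib_right distrib_right)
    finally show ?thesis by simp
  qed
  moreover have "L5 = P1 + P2"
    unfolding L5_def P1_def P2_def A
    by (simp add: sum.distrib sum_distrib_left sum_distrib_right distrib_right distrib_left mult.assoc)
  moreover have "L1 = R1"
    unfolding L1_def R1_def sum.cartesian_product
    by (rule sum.reindex_bij_witness[of _ "\<lambda>(j, i). (i, j)" "\<lambda>(i, j). (j, i)"])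
      (auto simp: ddv)
  moreover have "L2 = R4"
    unfolding L2_def R4_def sum.cartesian_product
    by (rule sum.reindex_bij_witness[of _ "\<lambda>(j, k, i). (i, j, k)" "\<lambda>(i, j, k). (j, k, i)"]) auto
  moreover have "L3 = Q1"
    unfolding L3_def Q1_def sum.cartesian_product
    by (rule sum.reindex_bij_witness[of _ "\<lambda>(k, i, j). (i, j, k)" "\<lambda>(i, j, k). (k, i, j)"])
      (auto simp: c)
  moreover have "P1 = R3"
    unfolding P1_def R3_def sum.cartesian_product
    by (rule sum.reindex_bij_witness[of _ "\<lambda>(k, i, j). (i, j, k)" "\<lambda>(i, j, k). (k, i, j)"]) auto
  moreover have "R2 = R5"
    unfolding R2_def R5_def sum.cartesian_product
    by (rule sum.reindex_bij_witness[of _ "\<lambda>(k, j, i). (j, i, k)" "\<lambda>(j, i, k). (k, j, i)"])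
      (auto simp: dc)
  moreover have "P2 = R6"
    unfolding P2_def R6_def sum.cartesian_product
    by (rule sum.reindex_bij_witness[of _ "\<lambda>(k, l, i, j). (i, j, k, l)" "\<lambda>(i, j, k, l). (k, l, i, j)"]) auto
  moreover have "Q2 = R7"
    unfolding Q2_def R7_def sum.cartesian_product
    by (rule sum.reindex_bij_witness[of _ "\<lambda>(k, l, i, j). (i, j, k, l)" "\<lambda>(i, j, k, l). (k, l, i, j)"])
      (auto simp: c)
  ultimately show ?thesis unfolding R0_def by linarith
qed

text \<open>The operators below depend on \<open>n\<close> and \<open>G\<close> but not on
  \<open>W\<close>. So a chart can be treated on its whole image or on a small open set where a
  given function is smooth, with the same operators.\<close>

locale coord_metric =
  fixes n :: nat and W :: "(nat \<Rightarrow> real) set" and G :: "nat \<Rightarrow> nat \<Rightarrow> (nat \<Rightarrow> real) \<Rightarrow> real"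
  assumes openW: "openin (Euclidean_space n) W"
    and smoothG: "\<And>i j. i < n \<Longrightarrow> j < n \<Longrightarrow> smooth_coord n W (G i j)"
    and posdefG: "\<And>x. x \<in> W \<Longrightarrow> posdef n (\<lambda>i j. G i j x)"
begin

definition Gi :: "nat \<Rightarrow> nat \<Rightarrow> (nat \<Rightarrow> real) \<Rightarrow> real" where
  "Gi i j x = inverse_coeffs n (\<lambda>a b. G a b x) i j"

definition Chr :: "nat \<Rightarrow> nat \<Rightarrow> nat \<Rightarrow> (nat \<Rightarrow> real) \<Rightarrow> real" where
  "Chr k i j x = (\<Sum>l<n. Gi k l x * (pd i (G j l) x + pd j (G i l) x - pd l (G i j) x)) / 2"

definition Ric :: "nat \<Rightarrow> nat \<Rightarrow> (nat \<Rightarrow> real) \<Rightarrow> real" where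
  "Ric j k x = (\<Sum>i<n. pd i (Chr i j k) x - pd k (Chr i j i) x
             + (\<Sum>l<n. Chr i i l x * Chr l j k x - Chr i k l x * Chr l j i x))"

definition grd :: "((nat \<Rightarrow> real) \<Rightarrow> real) \<Rightarrow> nat \<Rightarrow> (nat \<Rightarrow> real) \<Rightarrow> real" where
  "grd f i x = (\<Sum>j<n. Gi i j x * pd j f x)"

text \<open>The component \<open>i\<close> of the covariant derivative of \<open>V\<close> in
  coordinate direction \<open>j\<close>.\<close>

definition cov :: "(nat \<Rightarrow> (nat \<Rightarrow> real) \<Rightarrow> real) \<Rightarrow> nat \<Rightarrow> nat \<Rightarrow> (nat \<Rightarrow> real) \<Rightarrow> real" where
  "cov V i j x = pd j (V i) x + (\<Sum>k<n. Chr i j k x * V k x)"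

definition dvg :: "(nat \<Rightarrow> (nat \<Rightarrow> real) \<Rightarrow> real) \<Rightarrow> (nat \<Rightarrow> real) \<Rightarrow> real" where
  "dvg V x = (\<Sum>i<n. pd i (V i) x + (\<Sum>j<n. Chr i i j x * V j x))"

abbreviation lap :: "((nat \<Rightarrow> real) \<Rightarrow> real) \<Rightarrow> (nat \<Rightarrow> real) \<Rightarrow> real" where
  "lap f \<equiv> dvg (grd f)"

definition inn :: "((nat \<Rightarrow> real) \<Rightarrow> real) \<Rightarrow> ((nat \<Rightarrow> real) \<Rightarrow> real) \<Rightarrow> (nat \<Rightarrow> real) \<Rightarrow> real" where
  "inn f h x = (\<Sum>k<n. pd k f x * grd h k x)"

text \<open>The covariant Hessian, as the covariant derivative of the gradient with its first index
  lowered; its symmetry becomes visible in \<open>hess_eq\<close>.\<close>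

definition hess :: "((nat \<Rightarrow> real) \<Rightarrow> real) \<Rightarrow> nat \<Rightarrow> nat \<Rightarrow> (nat \<Rightarrow> real) \<Rightarrow> real" where
  "hess f k j x = (\<Sum>i<n. G k i x * cov (grd f) i j x)"

lemmas W_intros = smooth_coord_add[OF openW] smooth_coord_diff[OF openW] smooth_coord_mult[OF openW]
  smooth_coord_sum[OF openW] smooth_coord_const[OF openW]

section \<open>Raising and lowering indices\<close>

lemma Gsym: "x \<in> W \<Longrightarrow> i < n \<Longrightarrow> j < n \<Longrightarrow> G i j x = G j i x"
  using posdefG unfolding posdef_def by blast

lemma Gi_pdinv: "x \<in> W \<Longrightarrow> Gi i j x = pdinv n (\<lambda>a b. G a b x) i j"
  unfolding Gi_def using inverse_coeffs_eq_pdinv[OF posdefG] by simp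

lemma Gi_squares:
  assumes "x \<in> W"
  shows "\<exists>E. \<forall>i j. Gi i j x = (\<Sum>a<n. E a i * E a j)"
  using pdinv_correct[OF posdefG[OF assms]] unfolding Gi_pdinv[OF assms] by (elim conjE)

lemma Gi_sym: "x \<in> W \<Longrightarrow> Gi i j x = Gi j i x"
  using Gi_squares[of x] by (auto simp: mult.commute)

lemma G_Gi: "x \<in> W \<Longrightarrow> i < n \<Longrightarrow> j < n \<Longrightarrow> (\<Sum>k<n. G i k x * Gi k j x) = (if i = j then 1 else 0)"
  using pdinv_correct[OF posdefG[of x]] Gi_pdinv by (simp add: of_bool_def)

lemma Gi_G: "x \<in> W \<Longrightarrow> i < n \<Longrightarrow> j < n \<Longrightarrow> (\<Sum>k<n. Gi i k x * G k j x) = (if i = j then 1 else 0)"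
proof -
  assume x: "x \<in> W" "i < n" "j < n"
  have "(\<Sum>k<n. Gi i k x * G k j x) = (\<Sum>k<n. G j k x * Gi k i x)"
    by (intro sum.cong refl) (use x Gsym Gi_sym in \<open>auto simp: mult.commute\<close>)
  then show ?thesis using G_Gi[OF x(1,3,2)] by auto
qed

lemma lower_raise:
  assumes "x \<in> W" "l < n"
  shows "(\<Sum>k<n. G l k x * (\<Sum>j<n. Gi k j x * u j)) = u l"
proof -
  have "(\<Sum>k<n. G l k x * (\<Sum>j<n. Gi k j x * u j)) = (\<Sum>j<n. (\<Sum>k<n. G l k x * Gi k j x) * u j)"
    unfolding sum_distrib_left sum_distrib_right by (subst sum.swap) (simp add: mult.assoc)
  also have "\<dots> = (\<Sum>j<n. if l = j then u j else 0)"
    by (intro sum.cong refl) (simp only: G_Gi[OF assms] lessThan_iff, simp)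
  finally show ?thesis using assms by simp
qed

lemma raise_lower:
  assumes "x \<in> W" "l < n"
  shows "(\<Sum>k<n. Gi l k x * (\<Sum>j<n. G k j x * u j)) = u l"
proof -
  have "(\<Sum>k<n. Gi l k x * (\<Sum>j<n. G k j x * u j)) = (\<Sum>j<n. (\<Sum>k<n. Gi l k x * G k j x) * u j)"
    unfolding sum_distrib_left sum_distrib_right by (subst sum.swap) (simp add: mult.assoc)
  also have "\<dots> = (\<Sum>j<n. if l = j then u j else 0)"
    by (intro sum.cong refl) (simp only: Gi_G[OF assms] lessThan_iff, simp)
  finally show ?thesis using assms by simp
qed

text \<open>The inner product of two covectors, computed after raising both; it serves to contract
  the metric of one chart with gradients of its coordinate functions.\<close>

lemma G_raise_raise:
  assumes "x \<in> W"
  shows "(\<Sum>i<n. \<Sum>j<n. G i j x * (\<Sum>m<n. Gi m i x * a m) * (\<Sum>l<n. Gi l j x * b l)) =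
    (\<Sum>m<n. \<Sum>l<n. Gi m l x * a m * b l)"
proof -
  have "(\<Sum>i<n. \<Sum>j<n. G i j x * (\<Sum>m<n. Gi m i x * a m) * (\<Sum>l<n. Gi l j x * b l)) =
      (\<Sum>i<n. (\<Sum>m<n. Gi m i x * a m) * (\<Sum>j<n. G i j x * (\<Sum>l<n. Gi j l x * b l)))"
  proof (rule sum.cong[OF refl])
    fix i
    have "(\<Sum>l<n. Gi l j x * b l) = (\<Sum>l<n. Gi j l x * b l)" for j
      by (simp only: Gi_sym[OF assms, of _ j])
    then show "(\<Sum>j<n. G i j x * (\<Sum>m<n. Gi m i x * a m) * (\<Sum>l<n. Gi l j x * b l)) =
      (\<Sum>m<n. Gi m i x * a m) * (\<Sum>j<n. G i j x * (\<Sum>l<n. Gi j l x * b l))"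
      unfolding sum_distrib_left[of "\<Sum>m<n. Gi m i x * a m"]
      by (intro sum.cong refl) (simp only: mult_ac)
  qed
  also have "\<dots> = (\<Sum>i<n. (\<Sum>m<n. Gi m i x * a m) * b i)"
    by (intro sum.cong refl) (simp add: lower_raise[OF assms])
  also have "\<dots> = (\<Sum>m<n. \<Sum>l<n. Gi m l x * a m * b l)"
    unfolding sum_distrib_right by (rule sum.swap)
  finally show ?thesis .
qed

section \<open>Smoothness of the coordinate operators\<close>

lemma smooth_Gi: "smooth_coord n W (Gi i j)"
proof -
  have "smooth_coord n W (\<lambda>x. pdinv n (\<lambda>a b. G a b x) i j)"
    by (rule smooth_coord_pdinv[OF openW]) (use smoothG posdefG in auto)
  then show ?thesis by (rule smooth_coord_cong[OF openW, rotated]) (simp add: Gi_pdinv)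
qed

lemma smooth_Chr: "i < n \<Longrightarrow> j < n \<Longrightarrow> smooth_coord n W (Chr k i j)"
proof -
  assume ij: "i < n" "j < n"
  have "smooth_coord n W (\<lambda>x. (1/2) * (\<Sum>l<n. Gi k l x * (pd i (G j l) x + pd j (G i l) x - pd l (G i j) x)))"
    by (intro W_intros smooth_Gi smooth_coord_pd smoothG ij) (use ij in auto)
  then show ?thesis by (simp add: Chr_def[abs_def])
qed

lemma smooth_grd: "smooth_coord n W f \<Longrightarrow> smooth_coord n W (grd f i)"
  unfolding grd_def[abs_def] by (intro W_intros smooth_Gi smooth_coord_pd) auto

lemma smooth_cov:
  "(\<And>k. k < n \<Longrightarrow> smooth_coord n W (V k)) \<Longrightarrow> i < n \<Longrightarrow> j < n \<Longrightarrow> smooth_coord n W (cov V i j)"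
  unfolding cov_def[abs_def] by (intro W_intros smooth_Chr smooth_coord_pd) auto

lemma smooth_inn: "smooth_coord n W f \<Longrightarrow> smooth_coord n W h \<Longrightarrow> smooth_coord n W (inn f h)"
  unfolding inn_def[abs_def] by (intro W_intros smooth_grd smooth_coord_pd) auto

section \<open>The Levi-Civita connection and the Hessian\<close>

lemma pd_Gsym: "x \<in> W \<Longrightarrow> i < n \<Longrightarrow> j < n \<Longrightarrow> l < n \<Longrightarrow> pd l (G i j) x = pd l (G j i) x"
  by (rule pd_cong[OF openW]) (auto simp: Gsym)

lemma Chr_sym: "x \<in> W \<Longrightarrow> i < n \<Longrightarrow> j < n \<Longrightarrow> Chr k i j x = Chr k j i x"
  unfolding Chr_def by (intro arg_cong[of _ _ "\<lambda>x. x / 2"] sum.cong refl) (simp add: pd_Gsym[of x i j])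

text \<open>The Christoffel symbols of the first kind, that is, with the upper index lowered to
  \<open>l\<close>.\<close>

definition Chr_first :: "nat \<Rightarrow> nat \<Rightarrow> nat \<Rightarrow> (nat \<Rightarrow> real) \<Rightarrow> real" where
  "Chr_first l i j x = (pd i (G j l) x + pd j (G i l) x - pd l (G i j) x) / 2"

lemma lower_Chr: "x \<in> W \<Longrightarrow> l < n \<Longrightarrow> (\<Sum>k<n. G l k x * Chr k i j x) = Chr_first l i j x"
  using lower_raise[of x l "\<lambda>l. Chr_first l i j x"]
  by (simp add: Chr_def Chr_first_def sum_divide_distrib)

text \<open>This says that the metric is parallel: of the six terms on the right, four cancel in
  pairs.\<close>

lemma metric_compat:
  "x \<in> W \<Longrightarrow> i < n \<Longrightarrow> j < n \<Longrightarrow> k < n \<Longrightarrow> pd j (G i k) x = Chr_first k j i x + Chr_first i j k x"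
  unfolding Chr_first_def using pd_Gsym[of x k i j] pd_Gsym[of x k j i] pd_Gsym[of x j i k] by (simp add: field_simps)

lemma lower_grd: "x \<in> W \<Longrightarrow> k < n \<Longrightarrow> (\<Sum>i<n. G k i x * grd f i x) = pd k f x"
  unfolding grd_def by (rule lower_raise)

text \<open>Differentiate \<open>pd k f\<close> written as the lowered gradient. By
  \<open>metric_compat\<close> the derivative of \<open>G\<close> splits into two Christoffel terms:
  one completes the covariant derivative of the gradient, the other is the correction on the
  right.\<close>

lemma hess_eq:
  assumes f: "smooth_coord n W f" and x: "x \<in> W" and kj: "k < n" "j < n"
  shows "hess f k j x = pd j (pd k f) x - (\<Sum>l<n. Chr l j k x * pd l f x)"
proof -
  let ?V = "grd f"
  have "pd j (pd k f) x = pd j (\<lambda>y. \<Sum>i<n. G k i y * ?V i y) x"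
    by (rule pd_cong[OF openW x kj(2)]) (simp add: lower_grd kj)
  also have "\<dots> = (\<Sum>i<n. pd j (\<lambda>y. G k i y * ?V i y) x)"
    by (rule pd_sum[OF openW _ x kj(2)]) (intro W_intros smoothG smooth_grd f, use kj in auto)
  also have "\<dots> = (\<Sum>i<n. pd j (G k i) x * ?V i x + G k i x * pd j (?V i) x)"
    by (intro sum.cong refl pd_mult[OF openW _ _ x kj(2)] smoothG smooth_grd f) (use kj in auto)
  also have "\<dots> = (\<Sum>i<n. Chr_first i j k x * ?V i x) + (\<Sum>i<n. Chr_first k j i x * ?V i x) + (\<Sum>i<n. G k i x * pd j (?V i) x)"
    unfolding sum.distrib[symmetric]
    by (intro sum.cong refl) (use x kj in \<open>auto simp: metric_compat algebra_simps\<close>)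
  also have "(\<Sum>i<n. Chr_first i j k x * ?V i x) = (\<Sum>i<n. \<Sum>l<n. G i l x * Chr l j k x * ?V i x)"
    by (intro sum.cong refl) (simp only: lower_Chr[OF x, symmetric] lessThan_iff sum_distrib_right)
  also have "\<dots> = (\<Sum>l<n. Chr l j k x * (\<Sum>i<n. G l i x * ?V i x))"
    unfolding sum_distrib_left
    by (subst sum.swap) (intro sum.cong refl, use x in \<open>auto simp: Gsym mult_ac\<close>)
  also have "\<dots> = (\<Sum>l<n. Chr l j k x * pd l f x)"
    by (intro sum.cong refl) (simp only: lower_grd[OF x] lessThan_iff)
  also have "(\<Sum>i<n. Chr_first k j i x * ?V i x) = (\<Sum>i<n. G k i x * (\<Sum>m<n. Chr i j m x * ?V m x))"
  proof -
    have "(\<Sum>i<n. Chr_first k j i x * ?V i x) = (\<Sum>i<n. \<Sum>l<n. G k l x * Chr l j i x * ?V i x)"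
      by (intro sum.cong refl) (simp only: lower_Chr[OF x kj(1), symmetric] lessThan_iff sum_distrib_right)
    also have "\<dots> = (\<Sum>i<n. G k i x * (\<Sum>m<n. Chr i j m x * ?V m x))"
      unfolding sum_distrib_left by (subst sum.swap) (simp add: mult_ac)
    finally show ?thesis .
  qed
  finally show ?thesis
    by (simp add: hess_def cov_def distrib_left sum.distrib)
qed

lemma hess_sym:
  assumes f: "smooth_coord n W f" and x: "x \<in> W" and kj: "k < n" "j < n"
  shows "hess f k j x = hess f j k x"
  unfolding hess_eq[OF f x kj] hess_eq[OF f x kj(2,1)]
  using smooth_pd_commute[OF openW f x kj] Chr_sym[OF x kj] by simp

lemma cov_grd_eq:
  assumes "x \<in> W" "i < n"
  shows "cov (grd f) i j x = (\<Sum>k<n. Gi i k x * hess f k j x)"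
  unfolding hess_def by (rule raise_lower[OF assms, symmetric])

lemma lap_trace:
  assumes x: "x \<in> W"
  shows "lap f x = (\<Sum>i<n. \<Sum>k<n. Gi i k x * hess f k i x)"
  unfolding dvg_def cov_def[symmetric]
  by (intro sum.cong refl cov_grd_eq[OF x]) simp

text \<open>The product rule for the Levi-Civita connection: once both derivatives are written
  covariantly, the Christoffel terms of the two factors cancel.\<close>

lemma pd_inn:
  assumes f: "smooth_coord n W f" and h: "smooth_coord n W h" and x: "x \<in> W" and j: "j < n"
  shows "pd j (inn f h) x = (\<Sum>k<n. hess f k j x * grd h k x + hess h k j x * grd f k x)"
proof -
  have "pd j (inn f h) x = (\<Sum>k<n. pd j (\<lambda>x. pd k f x * grd h k x) x)"
    unfolding inn_def[abs_def]
    by (rule pd_sum[OF openW _ x j]) (intro W_intros smooth_coord_pd[OF f] smooth_grd h, auto)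
  also have "\<dots> = (\<Sum>k<n. pd j (pd k f) x * grd h k x + pd k f x * pd j (grd h k) x)"
    by (intro sum.cong refl pd_mult[OF openW _ _ x j] smooth_coord_pd[OF f] smooth_grd h) auto
  also have "\<dots> = (\<Sum>k<n. (hess f k j x + (\<Sum>l<n. Chr l j k x * pd l f x)) * grd h k x
      + pd k f x * (cov (grd h) k j x - (\<Sum>m<n. Chr k j m x * grd h m x)))"
    by (intro sum.cong refl) (use hess_eq[OF f x _ j] in \<open>auto simp: cov_def\<close>)
  also have "\<dots> = (\<Sum>k<n. hess f k j x * grd h k x) + (\<Sum>k<n. pd k f x * cov (grd h) k j x)
      + (\<Sum>k<n. \<Sum>l<n. Chr l j k x * pd l f x * grd h k x)
      - (\<Sum>k<n. \<Sum>m<n. pd k f x * (Chr k j m x * grd h m x))"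
    by (simp add: sum.distrib sum_subtractf distrib_right right_diff_distrib sum_distrib_left sum_distrib_right)
  also have "(\<Sum>k<n. \<Sum>l<n. Chr l j k x * pd l f x * grd h k x) =
      (\<Sum>k<n. \<Sum>m<n. pd k f x * (Chr k j m x * grd h m x))"
    by (subst sum.swap) (simp add: mult_ac)
  also have "(\<Sum>k<n. pd k f x * cov (grd h) k j x) = (\<Sum>k<n. \<Sum>i<n. G k i x * grd f i x * cov (grd h) k j x)"
    by (intro sum.cong refl) (simp only: lower_grd[OF x, symmetric] lessThan_iff sum_distrib_right)
  also have "\<dots> = (\<Sum>k<n. hess h k j x * grd f k x)"
    unfolding hess_def sum_distrib_right
    by (subst sum.swap) (intro sum.cong refl, use x in \<open>auto simp: Gsym mult_ac\<close>)
  finally show ?thesis by (simp add: sum.distrib)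
qed

text \<open>By \<open>pd_inn\<close> every term on the left is a sum of two Hessian terms; as
  Hessians are symmetric, those of \<open>a\<close> and \<open>b\<close> cancel and that of
  \<open>f\<close> appears twice. The left-hand side contains only gradients acting on functions, so
  it makes sense without coordinates.\<close>

lemma koszul_hess:
  assumes f: "smooth_coord n W f" and a: "smooth_coord n W a" and b: "smooth_coord n W b" and x: "x \<in> W"
  shows "(\<Sum>j<n. grd a j x * pd j (inn f b) x) + (\<Sum>j<n. grd b j x * pd j (inn f a) x)
     - (\<Sum>j<n. grd f j x * pd j (inn a b) x) = 2 * (\<Sum>j<n. \<Sum>k<n. hess f k j x * grd a j x * grd b k x)"
proof -
  define H where "H f a b = (\<Sum>j<n. \<Sum>k<n. hess f k j x * grd a j x * grd b k x)" for f a b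
  have Hs: "H f a b = H f b a" if "smooth_coord n W f" for f a b
    unfolding H_def
    by (subst sum.swap) (intro sum.cong refl, use hess_sym[OF that x] in \<open>auto simp: mult_ac\<close>)
  have *: "(\<Sum>j<n. grd c j x * pd j (inn f b) x) = H f c b + H b c f"
    if "smooth_coord n W f" "smooth_coord n W b" for c f b
    unfolding H_def sum.distrib[symmetric]
    by (intro sum.cong refl) (simp add: pd_inn[OF that x] sum_distrib_left sum.distrib distrib_left mult_ac)
  show ?thesis
    unfolding *[OF f b] *[OF f a] *[OF a b] H_def[symmetric]
    using Hs[OF f, of a b] Hs[OF a, of b f] Hs[OF b, of a f] by simp
qed

text \<open>At a critical point the Christoffel term of the Hessian drops out. The Gram form of the
  inverse metric then turns the trace into a sum of second derivatives in the directions of the rows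
  of \<open>E\<close>, none of them positive.\<close>

lemma lap_local_max:
  assumes f: "smooth_coord n W f" and x: "x \<in> W" and mx: "\<And>y. y \<in> W \<Longrightarrow> f y \<le> f x"
  shows "lap f x \<le> 0" and "i < n \<Longrightarrow> pd i f x = 0"
proof -
  have f2: "Ck_coord n W (Suc (Suc 0)) f" using f smooth_coord_iff[OF openW] by blast
  show p0: "\<And>i. i < n \<Longrightarrow> pd i f x = 0" using local_max_coord(1)[OF openW f2 x mx] by blast
  obtain E where E: "\<And>i j. Gi i j x = (\<Sum>a<n. E a i * E a j)" using Gi_squares[OF x] by blast
  have "lap f x = (\<Sum>i<n. \<Sum>k<n. Gi i k x * pd i (pd k f) x)"
    unfolding lap_trace[OF x]
    by (intro sum.cong refl) (simp add: hess_eq[OF f x] p0)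
  also have "\<dots> = (\<Sum>i<n. \<Sum>k<n. \<Sum>a<n. E a i * E a k * pd i (pd k f) x)"
    by (simp add: E sum_distrib_right)
  also have "\<dots> = (\<Sum>i<n. \<Sum>a<n. \<Sum>k<n. E a i * E a k * pd i (pd k f) x)"
    by (intro sum.cong refl sum.swap)
  also have "\<dots> = (\<Sum>a<n. \<Sum>i<n. \<Sum>k<n. E a i * E a k * pd i (pd k f) x)"
    by (rule sum.swap)
  also have "\<dots> = (\<Sum>a<n. \<Sum>i<n. \<Sum>k<n. E a i * E a k * pd k (pd i f) x)"
    by (intro sum.cong refl) (use smooth_pd_commute[OF openW f x] in auto)
  also have "\<dots> \<le> 0"
    by (rule sum_nonpos) (use local_max_coord(2)[OF openW f2 x mx] in auto)
  finally show "lap f x \<le> 0" .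
qed

text \<open>The trace of the square of a matrix can be negative, but this matrix is the inverse
  metric times a symmetric Hessian. With the Gram form of the inverse metric the trace becomes that
  of the square of the symmetric matrix \<open>h\<close>, a sum of squares.\<close>

lemma hess_square_nonneg:
  assumes f: "smooth_coord n W f" and x: "x \<in> W"
  shows "(\<Sum>i<n. \<Sum>j<n. cov (grd f) i j x * cov (grd f) j i x) \<ge> 0"
proof -
  obtain E where E: "\<And>i j. Gi i j x = (\<Sum>a<n. E a i * E a j)" using Gi_squares[OF x] by blast
  define q where "q a j = (\<Sum>k<n. E a k * hess f k j x)" for a j
  define h where "h a b = (\<Sum>j<n. q a j * E b j)" for a b
  have A: "cov (grd f) i j x = (\<Sum>a<n. E a i * q a j)" if "i < n" for i j
    unfolding cov_grd_eq[OF x that] E q_def sum_distrib_right sum_distrib_left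
    by (subst sum.swap) (simp add: mult.assoc)
  have hs: "h a b = h b a" for a b
    unfolding h_def q_def sum_distrib_right
    by (subst sum.swap) (intro sum.cong refl, use hess_sym[OF f x] in \<open>auto simp: mult_ac\<close>)
  have "(\<Sum>i<n. \<Sum>j<n. cov (grd f) i j x * cov (grd f) j i x) =
      (\<Sum>i<n. \<Sum>j<n. \<Sum>a<n. \<Sum>b<n. (E a i * q a j) * (E b j * q b i))"
    by (intro sum.cong refl) (simp add: A sum_product)
  also have "\<dots> = (\<Sum>a<n. \<Sum>b<n. \<Sum>j<n. \<Sum>i<n. (q a j * E b j) * (q b i * E a i))"
    unfolding sum.cartesian_product
    by (rule sum.reindex_bij_witness[of _ "\<lambda>(a, b, j, i). (i, j, a, b)" "\<lambda>(i, j, a, b). (a, b, j, i)"]) auto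
  also have "\<dots> = (\<Sum>a<n. \<Sum>b<n. h a b * h b a)"
    unfolding h_def sum_product ..
  also have "\<dots> \<ge> 0" by (intro sum_nonneg) (simp add: hs[of _ _])
  finally show ?thesis .
qed

text \<open>The product rule expresses all partial derivatives by the jets of \<open>V\<close> and
  of the Christoffel symbols at \<open>x\<close>; what remains is the algebraic identity for these
  jets.\<close>

lemma dvg_cov:
  assumes V: "\<And>k. k < n \<Longrightarrow> smooth_coord n W (V k)" and x: "x \<in> W"
  shows "dvg (\<lambda>i y. \<Sum>j<n. cov V i j y * V j y) x =
     (\<Sum>i<n. \<Sum>j<n. cov V i j x * cov V j i x) + (\<Sum>j<n. V j x * pd j (dvg V) x)
     + (\<Sum>j<n. \<Sum>k<n. Ric j k x * V j x * V k x)"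
proof -
  have pdChrV: "pd m (\<lambda>y. \<Sum>k<n. Chr i j k y * V k y) x =
      (\<Sum>k<n. pd m (Chr i j k) x * V k x + Chr i j k x * pd m (V k) x)" if "m < n" "j < n" for m i j
  proof -
    have "pd m (\<lambda>y. \<Sum>k<n. Chr i j k y * V k y) x = (\<Sum>k<n. pd m (\<lambda>y. Chr i j k y * V k y) x)"
      by (rule pd_sum[OF openW _ x that(1)]) (intro W_intros smooth_Chr V, use that in auto)
    then show ?thesis
      by (simp add: pd_mult[OF openW smooth_Chr V x that(1)] that)
  qed
  have smCV: "smooth_coord n W (\<lambda>y. \<Sum>k<n. Chr i j k y * V k y)" if "j < n" for i j
    by (intro W_intros smooth_Chr V) (use that in auto)
  have pdcov: "pd m (cov V i j) x = pd m (pd j (V i)) x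
      + (\<Sum>k<n. pd m (Chr i j k) x * V k x + Chr i j k x * pd m (V k) x)" if "m < n" "j < n" "i < n" for m i j
    unfolding cov_def[abs_def]
    using pd_add[OF openW smooth_coord_pd[OF V[OF that(3)] that(2)] smCV[OF that(2)] x that(1)] pdChrV[OF that(1,2)]
    by simp
  have pdZ: "pd i (\<lambda>y. \<Sum>j<n. cov V i j y * V j y) x =
      (\<Sum>j<n. (pd i (pd j (V i)) x + (\<Sum>k<n. pd i (Chr i j k) x * V k x + Chr i j k x * pd i (V k) x)) * V j x
        + cov V i j x * pd i (V j) x)" if "i < n" for i
  proof -
    have "pd i (\<lambda>y. \<Sum>j<n. cov V i j y * V j y) x = (\<Sum>j<n. pd i (\<lambda>y. cov V i j y * V j y) x)"
      by (rule pd_sum[OF openW _ x that]) (intro W_intros smooth_cov V, use that in auto)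
    also have "\<dots> = (\<Sum>j<n. pd i (cov V i j) x * V j x + cov V i j x * pd i (V j) x)"
      by (intro sum.cong refl pd_mult[OF openW _ _ x that] smooth_cov V) (use that in auto)
    finally show ?thesis using pdcov that by simp
  qed
  have pddvg: "pd j (dvg V) x = (\<Sum>i<n. pd j (pd i (V i)) x
      + (\<Sum>k<n. pd j (Chr i i k) x * V k x + Chr i i k x * pd j (V k) x))" if "j < n" for j
  proof -
    have "pd j (dvg V) x = (\<Sum>i<n. pd j (\<lambda>y. pd i (V i) y + (\<Sum>k<n. Chr i i k y * V k y)) x)"
      unfolding dvg_def[abs_def]
      by (rule pd_sum[OF openW _ x that]) (intro W_intros smooth_Chr smooth_coord_pd V, use that in auto)
    then show ?thesis
      using pd_add[OF openW smooth_coord_pd[OF V] smCV x that] pdChrV[OF that] by simp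
  qed
  have "dvg (\<lambda>i y. \<Sum>j<n. cov V i j y * V j y) x =
    (\<Sum>i<n. (\<Sum>j<n. (pd i (pd j (V i)) x + (\<Sum>k<n. pd i (Chr i j k) x * V k x + Chr i j k x * pd i (V k) x)) * V j x
        + cov V i j x * pd i (V j) x) + (\<Sum>j<n. Chr i i j x * (\<Sum>k<n. cov V j k x * V k x)))"
    unfolding dvg_def by (intro sum.cong refl) (simp add: pdZ)
  also have "\<dots> = (\<Sum>i<n. \<Sum>j<n. cov V i j x * cov V j i x)
      + (\<Sum>j<n. V j x * (\<Sum>i<n. pd j (pd i (V i)) x + (\<Sum>k<n. pd j (Chr i i k) x * V k x + Chr i i k x * pd j (V k) x)))
      + (\<Sum>j<n. \<Sum>k<n. (\<Sum>i<n. pd i (Chr i j k) x - pd k (Chr i j i) x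
          + (\<Sum>l<n. Chr i i l x * Chr l j k x - Chr i k l x * Chr l j i x)) * V j x * V k x)"
  proof (rule bochner_algebra[where v = "\<lambda>j. V j x" and c = "\<lambda>i j k. Chr i j k x" and dc = "\<lambda>m i j k. pd m (Chr i j k) x"
        and dv = "\<lambda>i j. pd j (V i) x" and ddv = "\<lambda>i j m. pd m (pd j (V i)) x" and A = "\<lambda>i j. cov V i j x"])
    show "pd m (Chr i j k) x = pd m (Chr i k j) x" if "m < n" "j < n" "k < n" for m i j k
      by (rule pd_cong[OF openW x that(1)]) (use Chr_sym that in auto)
    show "pd m (pd j (V i)) x = pd j (pd m (V i)) x" if "i < n" "j < n" "m < n" for i j m
      by (rule smooth_pd_commute[OF openW V[OF that(1)] x that(3,2)])
  qed (use x in \<open>auto simp: cov_def Chr_sym\<close>)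
  finally show ?thesis by (simp add: pddvg Ric_def)
qed

lemma dvg_cong:
  assumes "\<And>k y. k < n \<Longrightarrow> y \<in> W \<Longrightarrow> V k y = V' k y" "x \<in> W"
  shows "dvg V x = dvg V' x"
  unfolding dvg_def
  by (intro sum.cong refl arg_cong2[of _ _ _ _ "(+)"] pd_cong[OF openW assms(2)]) (use assms in auto)

lemma dvg_cmult:
  assumes "\<And>k. k < n \<Longrightarrow> smooth_coord n W (V k)" "x \<in> W"
  shows "dvg (\<lambda>k y. c * V k y) x = c * dvg V x"
  unfolding dvg_def sum_distrib_left
  by (intro sum.cong refl) (simp add: pd_cmult[OF openW assms(1) assms(2)] distrib_left sum_distrib_left mult_ac)

text \<open>At a maximum of \<open>|\<nabla>f|\<^sup>2\<close>, the identity \<open>\<nabla>|\<nabla>f|\<^sup>2 = 2 \<nabla>\<^sub>V V\<close> with \<open>V = \<nabla>f\<close> turns the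
  Bochner identity into the following inequality.\<close>

lemma bochner_max:
  assumes f: "smooth_coord n W f" and x: "x \<in> W" and mx: "\<And>y. y \<in> W \<Longrightarrow> inn f f y \<le> inn f f x"
  shows "(\<Sum>j<n. grd f j x * pd j (lap f) x) + (\<Sum>j<n. \<Sum>k<n. Ric j k x * grd f j x * grd f k x) \<le> 0"
proof -
  let ?V = "grd f" and ?P = "inn f f"
  have V: "smooth_coord n W (?V k)" for k by (rule smooth_grd[OF f])
  have P: "smooth_coord n W ?P" by (rule smooth_inn[OF f f])
  have Z: "(\<Sum>j<n. cov ?V i j y * ?V j y) = (1/2) * grd ?P i y" if i: "i < n" and y: "y \<in> W" for i y
  proof -
    have "(\<Sum>j<n. cov ?V i j y * ?V j y) = (\<Sum>k<n. Gi i k y * (\<Sum>j<n. hess f k j y * ?V j y))"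
      unfolding cov_grd_eq[OF y i] sum_distrib_left sum_distrib_right
      by (subst sum.swap) (simp add: mult.assoc)
    also have "\<dots> = (\<Sum>k<n. Gi i k y * ((1/2) * pd k ?P y))"
    proof (intro sum.cong refl arg_cong2[of _ _ _ _ "(*)"])
      fix k assume "k \<in> {..<n}"
      then have k: "k < n" by simp
      have "pd k ?P y = 2 * (\<Sum>j<n. hess f j k y * ?V j y)"
        unfolding pd_inn[OF f f y k] by (simp only: sum.distrib mult_2)
      also have "(\<Sum>j<n. hess f j k y * ?V j y) = (\<Sum>j<n. hess f k j y * ?V j y)"
        by (intro sum.cong refl) (use hess_sym[OF f y _ k] in auto)
      finally show "(\<Sum>j<n. hess f k j y * ?V j y) = (1/2) * pd k ?P y" by simp
    qed
    also have "\<dots> = (1/2) * grd ?P i y"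
      unfolding grd_def sum_distrib_left by (simp add: mult_ac)
    finally show ?thesis .
  qed
  have "dvg (\<lambda>i y. \<Sum>j<n. cov ?V i j y * ?V j y) x = dvg (\<lambda>i y. (1/2) * grd ?P i y) x"
    by (rule dvg_cong[OF Z x])
  also have "\<dots> = (1/2) * lap ?P x" by (rule dvg_cmult[OF smooth_grd[OF P] x])
  also have "\<dots> \<le> 0" using lap_local_max(1)[OF P x mx] by simp
  finally show ?thesis using dvg_cov[OF V x] hess_square_nonneg[OF f x] by simp
qed

lemma grd_compose:
  assumes S: "(S has_real_derivative S') (at (f x))" and f: "smooth_coord n W f" and x: "x \<in> W"
  shows "grd (\<lambda>y. S (f y)) i x = S' * grd f i x"
  unfolding grd_def sum_distrib_left
  by (intro sum.cong refl) (simp add: pd_real_compose[OF openW S f x] mult_ac)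

lemma lap_compose:
  assumes S: "\<And>s. s \<in> J \<Longrightarrow> (S has_real_derivative S' s) (at s)"
    and S': "\<And>s. s \<in> J \<Longrightarrow> (S' has_real_derivative S'' s) (at s)"
    and fJ: "\<And>y. y \<in> W \<Longrightarrow> f y \<in> J"
    and f: "smooth_coord n W f" and x: "x \<in> W"
  shows "lap (\<lambda>y. S (f y)) x = S' (f x) * lap f x + S'' (f x) * inn f f x"
proof -
  have "lap (\<lambda>y. S (f y)) x = dvg (\<lambda>i y. S' (f y) * grd f i y) x"
    by (rule dvg_cong[OF grd_compose[OF S[OF fJ] f] x])
  also have "\<dots> = (\<Sum>i<n. S'' (f x) * pd i f x * grd f i x + S' (f x) * pd i (grd f i) x
      + (\<Sum>j<n. Chr i i j x * (S' (f x) * grd f j x)))"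
    unfolding dvg_def
  proof (intro sum.cong refl arg_cong2[of _ _ _ _ "(+)"])
    fix i assume "i \<in> {..<n}"
    then have i: "i < n" by simp
    have xi: "x(i := x i) = x" by simp
    have 1: "((\<lambda>t. S' (f (x(i := t)))) has_real_derivative S'' (f x) * pd i f x) (at (x i))"
      by (rule DERIV_chain2[OF _ smooth_coord_has_pd[OF openW f i x]]) (use S' fJ x in auto)
    have 2: "((\<lambda>t. grd f i (x(i := t))) has_real_derivative pd i (grd f i) x) (at (x i))"
      by (rule smooth_coord_has_pd[OF openW smooth_grd[OF f] i x])
    show "pd i (\<lambda>y. S' (f y) * grd f i y) x = S'' (f x) * pd i f x * grd f i x + S' (f x) * pd i (grd f i) x"
      using DERIV_mult[OF 1 2] unfolding xi by (intro pd_eqI) (simp only: mult.commute)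
  qed
  also have "\<dots> = S' (f x) * lap f x + S'' (f x) * inn f f x"
    unfolding dvg_def inn_def sum_distrib_left sum.distrib[symmetric]
    by (intro sum.cong refl) (simp add: distrib_left sum_distrib_left mult_ac)
  finally show ?thesis .
qed

end

section \<open>Charts and tangent vectors\<close>

locale manifold =
  fixes M :: "'a mfd"
  assumes mfd: "smooth_manifold M"
begin

abbreviation "n \<equiv> mdim M"

abbreviation img :: "'a chart \<Rightarrow> (nat \<Rightarrow> real) set" where
  "img c \<equiv> snd c ` fst c"

abbreviation loc :: "'a chart \<Rightarrow> ('a \<Rightarrow> real) \<Rightarrow> (nat \<Rightarrow> real) \<Rightarrow> real" where
  "loc c f \<equiv> \<lambda>x. f (chart_inv c x)"

section \<open>Charts as homeomorphisms onto open sets\<close>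

lemma chart_props:
  assumes "c \<in> matlas M"
  shows "openin (mtop M) (fst c)" "openin (Euclidean_space n) (img c)"
    "homeomorphic_map (subtopology (mtop M) (fst c)) (subtopology (Euclidean_space n) (img c)) (snd c)"
proof -
  have "\<forall>(U, \<phi>)\<in>matlas M.
        openin (mtop M) U \<and> openin (Euclidean_space n) (\<phi> ` U) \<and>
        homeomorphic_map (subtopology (mtop M) U) (subtopology (Euclidean_space n) (\<phi> ` U)) \<phi>"
    using mfd unfolding smooth_manifold_def by blast
  from bspec[OF this assms]
  show "openin (mtop M) (fst c)" "openin (Euclidean_space n) (img c)"
    "homeomorphic_map (subtopology (mtop M) (fst c)) (subtopology (Euclidean_space n) (img c)) (snd c)"
    by (auto simp: case_prod_beta)
qed

lemma transition_smooth:
  assumes "c \<in> matlas M" "d \<in> matlas M" "i < n"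
  shows "smooth_coord n (snd c ` (fst c \<inter> fst d)) (\<lambda>x. snd d (chart_inv c x) i)"
proof -
  have "\<forall>(U, \<phi>)\<in>matlas M. \<forall>(V, \<psi>)\<in>matlas M. \<forall>i<n.
        smooth_coord n (\<phi> ` (U \<inter> V)) (\<lambda>x. \<psi> (inv_into U \<phi> x) i)"
    using mfd unfolding smooth_manifold_def by blast
  from bspec[OF this assms(1)] show ?thesis
    using assms(2,3) by (fastforce simp: case_prod_beta)
qed

lemma chart_exists: "p \<in> mcarrier M \<Longrightarrow> \<exists>c\<in>matlas M. p \<in> fst c"
  using mfd unfolding smooth_manifold_def by blast

lemma chart_at: "p \<in> mcarrier M \<Longrightarrow> chart_at M p \<in> matlas M \<and> p \<in> fst (chart_at M p)"
  unfolding chart_at_def by (rule someI_ex) (use chart_exists[of p] in blast)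

context
  fixes c assumes c: "c \<in> matlas M"
begin

lemma chart_dom_subset: "fst c \<subseteq> mcarrier M"
  using chart_props(1)[OF c] by (rule openin_subset)

lemma chart_topspaces:
  "topspace (subtopology (mtop M) (fst c)) = fst c"
  "topspace (subtopology (Euclidean_space n) (img c)) = img c"
  using chart_props(1,2)[OF c] by (auto dest: openin_subset)

lemma chart_inj: "inj_on (snd c) (fst c)"
  using homeomorphic_imp_injective_map[OF chart_props(3)[OF c]] unfolding chart_topspaces .

lemma chart_inv_chart: "p \<in> fst c \<Longrightarrow> chart_inv c (snd c p) = p"
  using chart_inj by (rule inv_into_f_f)

lemma chart_chart_inv: "x \<in> img c \<Longrightarrow> snd c (chart_inv c x) = x"
  by (rule f_inv_into_f)

lemma chart_inv_in: "x \<in> img c \<Longrightarrow> chart_inv c x \<in> fst c"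
  by (rule inv_into_into)

lemma img_subset: "img c \<subseteq> coord_space n"
  using chart_props(2)[OF c] by (rule openin_subset)

lemma open_chart_image:
  assumes "openin (mtop M) S"
  shows "openin (Euclidean_space n) (snd c ` (fst c \<inter> S))"
proof -
  have "openin (subtopology (mtop M) (fst c)) (fst c \<inter> S)"
    using assms by (rule openin_subtopology_Int2)
  then have "openin (subtopology (Euclidean_space n) (img c)) (snd c ` (fst c \<inter> S))"
    using homeomorphic_imp_open_map[OF chart_props(3)[OF c]] unfolding open_map_def by blast
  then show ?thesis using openin_open_subtopology[OF chart_props(2)[OF c]] by blast
qed

lemma chart_inv_continuous:
  "continuous_map (subtopology (Euclidean_space n) (img c)) (subtopology (mtop M) (fst c)) (chart_inv c)"
proof -
  obtain h where h: "homeomorphic_maps (subtopology (mtop M) (fst c)) (subtopology (Euclidean_space n) (img c)) (snd c) h"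
    using chart_props(3)[OF c] homeomorphic_map_maps by blast
  have "h x = chart_inv c x" if x: "x \<in> img c" for x
  proof -
    obtain p where p: "p \<in> fst c" "x = snd c p" using x by blast
    then have "h x = p" using h unfolding homeomorphic_maps_def chart_topspaces by blast
    then show ?thesis using chart_inv_chart p by simp
  qed
  moreover have "continuous_map (subtopology (Euclidean_space n) (img c)) (subtopology (mtop M) (fst c)) h"
    using h unfolding homeomorphic_maps_def by blast
  ultimately show ?thesis
    by (rule continuous_map_eq[rotated]) (simp add: chart_topspaces)
qed

lemma chart_continuous: "continuous_map (subtopology (mtop M) (fst c)) (Euclidean_space n) (snd c)"
  using homeomorphic_imp_continuous_map[OF chart_props(3)[OF c]] continuous_map_into_fulltopology by blast

lemma open_chart_preimage:
  assumes "openin (Euclidean_space n) V"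
  shows "openin (mtop M) {p \<in> fst c. snd c p \<in> V}"
proof -
  have "openin (subtopology (mtop M) (fst c)) {p \<in> topspace (subtopology (mtop M) (fst c)). snd c p \<in> V}"
    by (rule openin_continuous_map_preimage[OF chart_continuous assms])
  then show ?thesis unfolding chart_topspaces openin_open_subtopology[OF chart_props(1)[OF c]] by blast
qed

end

section \<open>Functions that are smooth near a point\<close>

lemma smooth_on_iff:
  "smooth_on M W f \<longleftrightarrow> (\<forall>c\<in>matlas M. smooth_coord n (snd c ` (fst c \<inter> W)) (loc c f))"
  by (auto simp: smooth_on_def case_prod_beta)

lemma smooth_nearD:
  assumes f: "smooth_near M p f" and c: "c \<in> matlas M" "p \<in> fst c"
  obtains V where "openin (Euclidean_space n) V" "snd c p \<in> V" "V \<subseteq> img c" "smooth_coord n V (loc c f)"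
proof -
  obtain W where W: "openin (mtop M) W" "p \<in> W" "smooth_on M W f"
    using f unfolding smooth_near_def by blast
  show thesis
    by (rule that[of "snd c ` (fst c \<inter> W)"])
      (use W c open_chart_image[OF c(1) W(1)] smooth_on_iff in auto)
qed

text \<open>Smoothness near a point is defined through all charts; by the smooth transition maps,
  one chart around the point controls the others.\<close>

lemma smooth_nearI:
  assumes c: "c \<in> matlas M" "p \<in> fst c"
    and V: "openin (Euclidean_space n) V" "snd c p \<in> V" "V \<subseteq> img c" "smooth_coord n V (loc c f)"
  shows "smooth_near M p f"
  unfolding smooth_near_def
proof (intro exI conjI)
  let ?W = "{q \<in> fst c. snd c q \<in> V}"
  show "openin (mtop M) ?W" by (rule open_chart_preimage[OF c(1) V(1)])
  show "p \<in> ?W" using c V by simp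
  show "smooth_on M ?W f" unfolding smooth_on_iff
  proof
    fix d assume d: "d \<in> matlas M"
    let ?D = "snd d ` (fst d \<inter> ?W)" and ?F = "\<lambda>x. snd c (chart_inv d x)"
    have oD: "openin (Euclidean_space n) ?D"
      by (rule open_chart_image[OF d open_chart_preimage[OF c(1) V(1)]])
    have oI: "openin (Euclidean_space n) (snd d ` (fst d \<inter> fst c))"
      by (rule open_chart_image[OF d chart_props(1)[OF c(1)]])
    have "smooth_coord n ?D (\<lambda>x. loc c f (?F x))"
    proof (rule smooth_coord_compose[OF oD V(1) _ _ V(4)])
      show "?F x \<in> V" if "x \<in> ?D" for x
        using that chart_inv_chart[OF d] by auto
      show "smooth_coord n ?D (\<lambda>x. ?F x j)" if "j < n" for j
        by (rule smooth_coord_subset[OF oI oD _ transition_smooth[OF d c(1) that]]) auto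
    qed
    then show "smooth_coord n ?D (loc d f)"
      by (rule smooth_coord_cong[OF oD, rotated]) (auto simp: chart_inv_chart[OF d] chart_inv_chart[OF c(1)])
  qed
qed

lemma smooth_near_carrier: "smooth_near M p f \<Longrightarrow> p \<in> mcarrier M"
  unfolding smooth_near_def using openin_subset by blast

lemma smooth_near_chartD:
  assumes "smooth_near M p f"
  obtains c V where "c \<in> matlas M" "p \<in> fst c"
    "openin (Euclidean_space n) V" "snd c p \<in> V" "V \<subseteq> img c" "smooth_coord n V (loc c f)"
  using smooth_nearD[OF assms] chart_exists[OF smooth_near_carrier[OF assms]] by metis

lemma smooth_near2:
  assumes f: "smooth_near M p f" and h: "smooth_near M p h" and c: "c \<in> matlas M" "p \<in> fst c"
  obtains V where "openin (Euclidean_space n) V" "snd c p \<in> V" "V \<subseteq> img c"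
    "smooth_coord n V (loc c f)" "smooth_coord n V (loc c h)"
proof -
  obtain V where V: "openin (Euclidean_space n) V" "snd c p \<in> V" "V \<subseteq> img c" "smooth_coord n V (loc c f)"
    using smooth_nearD[OF f c] by blast
  obtain V' where V': "openin (Euclidean_space n) V'" "snd c p \<in> V'" "V' \<subseteq> img c" "smooth_coord n V' (loc c h)"
    using smooth_nearD[OF h c] by blast
  have o: "openin (Euclidean_space n) (V \<inter> V')" using V(1) V'(1) by (rule openin_Int)
  show thesis
    by (rule that[OF o _ _ smooth_coord_subset[OF V(1) o _ V(4)] smooth_coord_subset[OF V'(1) o _ V'(4)]])
      (use V V' in auto)
qed

lemma smooth_near_cong:
  assumes f: "smooth_near M p f" and S: "openin (mtop M) S" "p \<in> S" and eq: "\<And>q. q \<in> S \<Longrightarrow> f q = h q"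
  shows "smooth_near M p h"
proof -
  obtain c V where c: "c \<in> matlas M" "p \<in> fst c"
    and V: "openin (Euclidean_space n) V" "snd c p \<in> V" "V \<subseteq> img c" "smooth_coord n V (loc c f)"
    using smooth_near_chartD[OF f] .
  let ?V = "V \<inter> snd c ` (fst c \<inter> S)"
  have o: "openin (Euclidean_space n) ?V" using V(1) open_chart_image[OF c(1) S(1)] by (rule openin_Int)
  have "smooth_coord n ?V (loc c f)" by (rule smooth_coord_subset[OF V(1) o _ V(4)]) auto
  then have "smooth_coord n ?V (loc c h)"
    by (rule smooth_coord_cong[OF o, rotated]) (auto simp: chart_inv_chart[OF c(1)] eq)
  then show ?thesis by (intro smooth_nearI[OF c o]) (use V c S in auto)
qed

lemma smooth_near_binop:
  assumes f: "smooth_near M p f" and h: "smooth_near M p h"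
    and op: "\<And>V f h. openin (Euclidean_space n) V \<Longrightarrow> smooth_coord n V f \<Longrightarrow> smooth_coord n V h \<Longrightarrow>
      smooth_coord n V (\<lambda>x. F (f x) (h x))"
  shows "smooth_near M p (\<lambda>q. F (f q) (h q))"
proof -
  obtain c where c: "c \<in> matlas M" "p \<in> fst c" using chart_exists[OF smooth_near_carrier[OF f]] by blast
  obtain V where "openin (Euclidean_space n) V" "snd c p \<in> V" "V \<subseteq> img c"
    "smooth_coord n V (loc c f)" "smooth_coord n V (loc c h)" using smooth_near2[OF f h c] .
  then show ?thesis by (intro smooth_nearI[OF c]) (auto intro: op)
qed

lemma smooth_near_const: "p \<in> mcarrier M \<Longrightarrow> smooth_near M p (\<lambda>q. a)"
  using chart_exists[of p] by (auto intro!: smooth_nearI[OF _ _ chart_props(2)] smooth_coord_const chart_props(2))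

lemma smooth_near_add: "smooth_near M p f \<Longrightarrow> smooth_near M p h \<Longrightarrow> smooth_near M p (\<lambda>q. f q + h q)"
  by (rule smooth_near_binop[where F = "(+)"]) (auto intro: smooth_coord_add)

lemma smooth_near_mult: "smooth_near M p f \<Longrightarrow> smooth_near M p h \<Longrightarrow> smooth_near M p (\<lambda>q. f q * h q)"
  by (rule smooth_near_binop[where F = "(*)"]) (auto intro: smooth_coord_mult)

lemma smooth_near_diff: "smooth_near M p f \<Longrightarrow> smooth_near M p h \<Longrightarrow> smooth_near M p (\<lambda>q. f q - h q)"
  by (rule smooth_near_binop[where F = "(-)"]) (auto intro: smooth_coord_diff)

lemma smooth_near_cmult: "smooth_near M p f \<Longrightarrow> smooth_near M p (\<lambda>q. a * f q)"
  by (rule smooth_near_mult[OF smooth_near_const]) (auto dest: smooth_near_carrier)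

lemma smooth_near_sum:
  "finite J \<Longrightarrow> p \<in> mcarrier M \<Longrightarrow> (\<And>j. j \<in> J \<Longrightarrow> smooth_near M p (f j)) \<Longrightarrow> smooth_near M p (\<lambda>q. \<Sum>j\<in>J. f j q)"
  by (induction J rule: finite_induct) (auto intro: smooth_near_const smooth_near_add)

lemma smooth_near_chart:
  assumes c: "c \<in> matlas M" "p \<in> fst c"
  shows "smooth_near M p (\<lambda>q. snd c q i)"
proof (rule smooth_nearI[OF c chart_props(2)[OF c(1)]])
  have "smooth_coord n (img c) (\<lambda>x. x i)" by (rule smooth_coord_component[OF chart_props(2)[OF c(1)]])
  then show "smooth_coord n (img c) (loc c (\<lambda>q. snd c q i))"
    by (rule smooth_coord_cong[OF chart_props(2)[OF c(1)], rotated]) (simp add: chart_chart_inv[OF c(1)])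
qed (use c in auto)

lemma smooth_near_compose_chart:
  assumes c: "c \<in> matlas M" "p \<in> fst c"
    and V: "openin (Euclidean_space n) V" "snd c p \<in> V" "V \<subseteq> img c" "smooth_coord n V h"
  shows "smooth_near M p (\<lambda>q. h (snd c q))"
proof (rule smooth_nearI[OF c V(1-3)])
  show "smooth_coord n V (loc c (\<lambda>q. h (snd c q)))"
    by (rule smooth_coord_cong[OF V(1) _ V(4)]) (use V(3) chart_chart_inv[OF c(1)] in auto)
qed

lemma smooth_function_near: "smooth_function M f \<Longrightarrow> p \<in> mcarrier M \<Longrightarrow> smooth_near M p f"
  unfolding smooth_near_def by blast

lemma smooth_function_loc:
  assumes "smooth_function M f" "c \<in> matlas M"
  shows "smooth_coord n (img c) (loc c f)"
proof -
  have "fst c \<inter> mcarrier M = fst c" using chart_dom_subset[OF assms(2)] by blast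
  then show ?thesis using assms by (auto simp: smooth_on_iff)
qed

lemma smooth_functionI:
  assumes "\<And>p. p \<in> mcarrier M \<Longrightarrow> smooth_near M p f"
  shows "smooth_function M f"
  unfolding smooth_on_iff
proof
  fix c assume c: "c \<in> matlas M"
  have eq: "fst c \<inter> mcarrier M = fst c" using chart_dom_subset[OF c] by blast
  show "smooth_coord n (snd c ` (fst c \<inter> mcarrier M)) (loc c f)"
    unfolding eq
  proof (rule smooth_coord_local[OF chart_props(2)[OF c]])
    fix x assume "x \<in> img c"
    then obtain p where p: "p \<in> fst c" "x = snd c p" by blast
    then have "smooth_near M p f" using assms chart_dom_subset[OF c] by blast
    from smooth_nearD[OF this c p(1)] show "\<exists>V. openin (Euclidean_space n) V \<and> x \<in> V \<and> V \<subseteq> img c \<and> smooth_coord n V (loc c f)"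
      using p by metis
  qed
qed

subsection \<open>Tangent vectors\<close>

context
  fixes p v assumes v: "v \<in> tangent_space M p"
begin

lemma tv_not_smooth: "\<not> smooth_near M p f \<Longrightarrow> v f = 0"
  using v unfolding tangent_space_def by blast

lemma tv_add: "smooth_near M p f \<Longrightarrow> smooth_near M p h \<Longrightarrow> v (\<lambda>q. f q + h q) = v f + v h"
  using v unfolding tangent_space_def by blast

lemma tv_mult: "smooth_near M p f \<Longrightarrow> smooth_near M p h \<Longrightarrow> v (\<lambda>q. f q * h q) = f p * v h + h p * v f"
  using v unfolding tangent_space_def by blast

lemma tv_cmult: "smooth_near M p f \<Longrightarrow> v (\<lambda>q. a * f q) = a * v f"
  using v unfolding tangent_space_def by blast

lemma tv_const: "p \<in> mcarrier M \<Longrightarrow> v (\<lambda>q. a) = 0"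
proof -
  assume p: "p \<in> mcarrier M"
  have "v (\<lambda>q. 1 * 1) = 1 * v (\<lambda>q. 1) + 1 * v (\<lambda>q. 1)"
    by (rule tv_mult) (use smooth_near_const[OF p] in auto)
  then have "v (\<lambda>q. 1) = 0" by simp
  then show ?thesis using tv_cmult[OF smooth_near_const[OF p], of a 1] by simp
qed

lemma tv_sum:
  "finite J \<Longrightarrow> p \<in> mcarrier M \<Longrightarrow> (\<And>j. j \<in> J \<Longrightarrow> smooth_near M p (f j)) \<Longrightarrow>
    v (\<lambda>q. \<Sum>j\<in>J. f j q) = (\<Sum>j\<in>J. v (f j))"
  by (induction J rule: finite_induct) (auto simp: tv_const tv_add smooth_near_sum)

lemma tv_local:
  assumes f: "smooth_near M p f" and S: "openin (mtop M) S" "p \<in> S" and eq: "\<And>q. q \<in> S \<Longrightarrow> f q = h q"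
  shows "v f = v h"
proof -
  have p: "p \<in> mcarrier M" by (rule smooth_near_carrier[OF f])
  have h: "smooth_near M p h" by (rule smooth_near_cong[OF f S eq])
  let ?e = "\<lambda>q. if q \<in> S then 1 else 0 :: real"
  have e: "smooth_near M p ?e" by (rule smooth_near_cong[OF smooth_near_const[OF p, of 1] S]) auto
  have "v (\<lambda>q. ?e q * ?e q) = ?e p * v ?e + ?e p * v ?e" by (rule tv_mult[OF e e])
  moreover have "(\<lambda>q. ?e q * ?e q) = ?e" by auto
  ultimately have "v ?e = 0" using S by auto
  have d: "smooth_near M p (\<lambda>q. f q + (-1) * h q)"
    by (intro smooth_near_add smooth_near_cmult f h)
  have "v (\<lambda>q. ?e q * (f q + (-1) * h q)) = ?e p * v (\<lambda>q. f q + (-1) * h q) + (f p + (-1) * h p) * v ?e"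
    by (rule tv_mult[OF e d])
  moreover have "(\<lambda>q. ?e q * (f q + (-1) * h q)) = (\<lambda>q. 0)" using eq by auto
  ultimately have "v (\<lambda>q. f q + (-1) * h q) = 0"
    using \<open>v ?e = 0\<close> S tv_const[OF p, of 0] by simp
  then show ?thesis using tv_add[OF f smooth_near_cmult[OF h, of "-1"]] tv_cmult[OF h, of "-1"] by simp
qed

end

lemma coord_vec_eq: "smooth_near M p f \<Longrightarrow> coord_vec M c i p f = pd i (loc c f) (snd c p)"
  by (simp add: coord_vec_def)

lemma coord_vec_tangent:
  assumes c: "c \<in> matlas M" "p \<in> fst c" and i: "i < n"
  shows "coord_vec M c i p \<in> tangent_space M p"
  unfolding tangent_space_def
proof (intro CollectI conjI allI impI)
  show "coord_vec M c i p f = 0" if "\<not> smooth_near M p f" for f using that by (simp add: coord_vec_def)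
next
  fix f h assume f: "smooth_near M p f" and h: "smooth_near M p h"
  obtain V where V: "openin (Euclidean_space n) V" "snd c p \<in> V" "V \<subseteq> img c"
    "smooth_coord n V (loc c f)" "smooth_coord n V (loc c h)" using smooth_near2[OF f h c] .
  show "coord_vec M c i p (\<lambda>q. f q + h q) = coord_vec M c i p f + coord_vec M c i p h"
    unfolding coord_vec_eq[OF f] coord_vec_eq[OF h] coord_vec_eq[OF smooth_near_add[OF f h]]
    by (rule pd_add[OF V(1,4,5,2) i])
  show "coord_vec M c i p (\<lambda>q. f q * h q) = f p * coord_vec M c i p h + h p * coord_vec M c i p f"
    unfolding coord_vec_eq[OF f] coord_vec_eq[OF h] coord_vec_eq[OF smooth_near_mult[OF f h]]
    using pd_mult[OF V(1,4,5,2) i] chart_inv_chart[OF c] by simp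
next
  fix f a assume f: "smooth_near M p f"
  obtain V where V: "openin (Euclidean_space n) V" "snd c p \<in> V" "V \<subseteq> img c"
    "smooth_coord n V (loc c f)" using smooth_nearD[OF f c] .
  show "coord_vec M c i p (\<lambda>q. a * f q) = a * coord_vec M c i p f"
    unfolding coord_vec_eq[OF f] coord_vec_eq[OF smooth_near_cmult[OF f]]
    by (rule pd_cmult[OF V(1,4,2) i])
qed

lemma tangent_zero: "(\<lambda>f. 0) \<in> tangent_space M p"
  by (simp add: tangent_space_def)

lemma tangent_comb:
  assumes "u \<in> tangent_space M p" "v \<in> tangent_space M p"
  shows "(\<lambda>f. a * u f + b * v f) \<in> tangent_space M p"
  unfolding tangent_space_def
  by (auto simp: tv_not_smooth[OF assms(1)] tv_not_smooth[OF assms(2)] tv_add[OF assms(1)] tv_add[OF assms(2)]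
      tv_mult[OF assms(1)] tv_mult[OF assms(2)] tv_cmult[OF assms(1)] tv_cmult[OF assms(2)] algebra_simps)

lemma lincomb_tangent:
  assumes "\<And>i. i < m \<Longrightarrow> u i \<in> tangent_space M p"
  shows "lincomb m a u \<in> tangent_space M p"
  using assms
proof (induction m)
  case 0
  then show ?case using tangent_zero by (simp add: lincomb_def)
next
  case (Suc m)
  have "(\<lambda>f. 1 * lincomb m a u f + a m * u m f) \<in> tangent_space M p"
    by (rule tangent_comb) (use Suc in auto)
  then show ?case by (simp add: lincomb_def)
qed

lemma vcomp_coord_vec:
  assumes c: "c \<in> matlas M" "p \<in> fst c" and i: "i < n"
  shows "vcomp c j (coord_vec M c i p) = (if i = j then 1 else 0)"
proof -
  have "vcomp c j (coord_vec M c i p) = pd i (loc c (\<lambda>q. snd c q j)) (snd c p)"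
    unfolding vcomp_def by (rule coord_vec_eq[OF smooth_near_chart[OF c]])
  also have "\<dots> = pd i (\<lambda>x. x j) (snd c p)"
    by (rule pd_cong[OF chart_props(2)[OF c(1)] _ i]) (use c chart_chart_inv[OF c(1)] in auto)
  finally show ?thesis by (simp add: pd_component)
qed

text \<open>By Hadamard's lemma, derivations are determined by their values on coordinate functions.\<close>

lemma tangent_coords:
  assumes v: "v \<in> tangent_space M p" and c: "c \<in> matlas M" "p \<in> fst c"
  shows "v = lincomb n (\<lambda>i. vcomp c i v) (\<lambda>i. coord_vec M c i p)"
proof
  fix f
  have pM: "p \<in> mcarrier M" using c chart_dom_subset by blast
  show "v f = lincomb n (\<lambda>i. vcomp c i v) (\<lambda>i. coord_vec M c i p) f"
  proof (cases "smooth_near M p f")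
    case False
    then show ?thesis using tv_not_smooth[OF v] by (simp add: lincomb_def coord_vec_def)
  next
    case f: True
    let ?a = "snd c p"
    obtain V where V: "openin (Euclidean_space n) V" "?a \<in> V" "V \<subseteq> img c" "smooth_coord n V (loc c f)"
      using smooth_nearD[OF f c] .
    obtain e where e: "e > 0" "coord_ball n ?a e \<subseteq> V" using coord_ballE[OF V(1,2)] .
    let ?B = "coord_ball n ?a e"
    have aC: "?a \<in> coord_space n" using open_in_coord_space[OF V(1,2)] .
    have aB: "?a \<in> ?B" by (rule centre_in_coord_ball[OF aC e(1)])
    have "smooth_coord n ?B (loc c f)" by (rule smooth_coord_subset[OF V(1) openin_coord_ball e(2) V(4)])
    then obtain h where h: "\<And>i. i < n \<Longrightarrow> smooth_coord n ?B (h i)"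
      "\<And>i. i < n \<Longrightarrow> h i ?a = pd i (loc c f) ?a"
      "\<And>x. x \<in> ?B \<Longrightarrow> loc c f x = loc c f ?a + (\<Sum>i<n. (x i - ?a i) * h i x)"
      using hadamard_ball[OF aC e(1)] by blast
    let ?h = "\<lambda>i q. h i (snd c q)" and ?x = "\<lambda>i q. snd c q i - ?a i"
    have sh: "smooth_near M p (?h i)" if "i < n" for i
      by (rule smooth_near_compose_chart[OF c openin_coord_ball aB _ h(1)[OF that]]) (use e V in auto)
    have sx: "smooth_near M p (?x i)" for i
      by (intro smooth_near_diff smooth_near_const[OF pM] smooth_near_chart[OF c])
    have vx: "v (?x i) = vcomp c i v" for i
      unfolding vcomp_def
      using tv_add[OF v smooth_near_chart[OF c] smooth_near_const[OF pM], of i "- ?a i"] tv_const[OF v pM] by simp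
    have "v f = v (\<lambda>q. f p + (\<Sum>i<n. ?x i q * ?h i q))"
    proof (rule tv_local[OF v f])
      show "openin (mtop M) {q \<in> fst c. snd c q \<in> ?B}" by (rule open_chart_preimage[OF c(1) openin_coord_ball])
      show "p \<in> {q \<in> fst c. snd c q \<in> ?B}" using c aB by simp
      show "f q = f p + (\<Sum>i<n. ?x i q * ?h i q)" if "q \<in> {q \<in> fst c. snd c q \<in> ?B}" for q
        using h(3)[of "snd c q"] that chart_inv_chart[OF c(1)] c by simp
    qed
    also have "\<dots> = v (\<lambda>q. f p) + v (\<lambda>q. \<Sum>i<n. ?x i q * ?h i q)"
      by (rule tv_add[OF v]) (auto intro!: smooth_near_const[OF pM] smooth_near_sum[OF _ pM] smooth_near_mult sx sh)
    also have "v (\<lambda>q. \<Sum>i<n. ?x i q * ?h i q) = (\<Sum>i<n. v (\<lambda>q. ?x i q * ?h i q))"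
      by (rule tv_sum[OF v _ pM]) (auto intro!: smooth_near_mult sx sh)
    \<comment> \<open>The functions \<open>?x i\<close> vanish at \<open>p\<close>, so the Leibniz
      rule leaves the value of \<open>v\<close> on the coordinate function times \<open>h i\<close>
      at the centre, which is the partial derivative.\<close>
    also have "\<dots> = (\<Sum>i<n. vcomp c i v * coord_vec M c i p f)"
      by (intro sum.cong refl) (simp add: tv_mult[OF v sx sh] vx h(2) coord_vec_eq[OF f])
    finally show ?thesis using tv_const[OF v pM] by (simp add: lincomb_def)
  qed
qed

lemma vcomp_lincomb:
  assumes c: "c \<in> matlas M" "p \<in> fst c" and i: "i < n"
  shows "vcomp c i (lincomb n a (\<lambda>i. coord_vec M c i p)) = a i"
proof -
  have "vcomp c i (lincomb n a (\<lambda>i. coord_vec M c i p)) = (\<Sum>j<n. a j * vcomp c i (coord_vec M c j p))"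
    by (simp add: vcomp_def lincomb_def)
  also have "\<dots> = (\<Sum>j<n. if j = i then a j else 0)"
    by (intro sum.cong refl) (simp add: vcomp_coord_vec[OF c])
  finally show ?thesis using i by simp
qed

end

section \<open>Riemannian manifolds in charts\<close>

locale riemannian = manifold M for M :: "'a mfd" +
  fixes g :: "'a rmetric"
  assumes metric: "riemannian_metric M g"
begin

section \<open>The metric tensor and its coefficients in a chart\<close>

lemma g_sym: "u \<in> tangent_space M p \<Longrightarrow> v \<in> tangent_space M p \<Longrightarrow> p \<in> mcarrier M \<Longrightarrow> g p u v = g p v u"
  using metric unfolding riemannian_metric_def by blast

lemma g_pos: "u \<in> tangent_space M p \<Longrightarrow> p \<in> mcarrier M \<Longrightarrow> u \<noteq> (\<lambda>f. 0) \<Longrightarrow> g p u u > 0"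
  using metric unfolding riemannian_metric_def by blast

lemma g_lin:
  "u \<in> tangent_space M p \<Longrightarrow> v \<in> tangent_space M p \<Longrightarrow> w \<in> tangent_space M p \<Longrightarrow> p \<in> mcarrier M \<Longrightarrow>
    g p (\<lambda>f. a * u f + b * v f) w = a * g p u w + b * g p v w"
  using metric unfolding riemannian_metric_def by blast

lemma g_zero: "w \<in> tangent_space M p \<Longrightarrow> p \<in> mcarrier M \<Longrightarrow> g p (\<lambda>f. 0) w = 0"
  using g_lin[of w p w w 0 0] by simp

lemma g_lincomb:
  assumes w: "w \<in> tangent_space M p" and p: "p \<in> mcarrier M"
    and u: "\<And>i. i < m \<Longrightarrow> u i \<in> tangent_space M p"
  shows "g p (lincomb m a u) w = (\<Sum>i<m. a i * g p (u i) w)"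
  using u
proof (induction m)
  case 0
  then show ?case using g_zero[OF w p] by (simp add: lincomb_def)
next
  case (Suc m)
  have "lincomb (Suc m) a u = (\<lambda>f. 1 * lincomb m a u f + a m * u m f)"
    by (simp add: lincomb_def)
  then show ?case
    using g_lin[OF lincomb_tangent _ w p, of m u "u m" 1 a "a m"] Suc by simp
qed

lemma metric_coeff_chart:
  assumes "c \<in> matlas M" "p \<in> fst c"
  shows "metric_coeff M g c i j (snd c p) = g p (coord_vec M c i p) (coord_vec M c j p)"
  using chart_inv_chart[OF assms] by (simp add: metric_coeff_def)

lemma g_coords:
  assumes c: "c \<in> matlas M" "p \<in> fst c" and u: "u \<in> tangent_space M p" and v: "v \<in> tangent_space M p"
  shows "g p u v = (\<Sum>i<n. \<Sum>j<n. metric_coeff M g c i j (snd c p) * vcomp c i u * vcomp c j v)"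
proof -
  have p: "p \<in> mcarrier M" using c chart_dom_subset by blast
  note cv = coord_vec_tangent[OF c]
  have "g p u v = g p (lincomb n (\<lambda>i. vcomp c i u) (\<lambda>i. coord_vec M c i p)) v"
    using tangent_coords[OF u c] by simp
  also have "\<dots> = (\<Sum>i<n. vcomp c i u * g p (coord_vec M c i p) v)"
    by (rule g_lincomb[OF v p cv])
  also have "\<dots> = (\<Sum>i<n. vcomp c i u * (\<Sum>j<n. vcomp c j v * metric_coeff M g c i j (snd c p)))"
  proof (intro sum.cong refl arg_cong2[of _ _ _ _ "(*)"])
    fix i assume "i \<in> {..<n}"
    then have i: "i < n" by simp
    have "g p (coord_vec M c i p) v = g p v (coord_vec M c i p)" by (rule g_sym[OF cv[OF i] v p])
    also have "\<dots> = g p (lincomb n (\<lambda>j. vcomp c j v) (\<lambda>j. coord_vec M c j p)) (coord_vec M c i p)"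
      using tangent_coords[OF v c] by simp
    also have "\<dots> = (\<Sum>j<n. vcomp c j v * g p (coord_vec M c j p) (coord_vec M c i p))"
      by (rule g_lincomb[OF cv[OF i] p cv])
    also have "\<dots> = (\<Sum>j<n. vcomp c j v * metric_coeff M g c i j (snd c p))"
      by (intro sum.cong refl) (simp add: metric_coeff_chart[OF c] g_sym[OF cv cv[OF i] p])
    finally show "g p (coord_vec M c i p) v = (\<Sum>j<n. vcomp c j v * metric_coeff M g c i j (snd c p))" .
  qed
  also have "\<dots> = (\<Sum>i<n. \<Sum>j<n. metric_coeff M g c i j (snd c p) * vcomp c i u * vcomp c j v)"
    by (simp add: sum_distrib_left mult_ac)
  finally show ?thesis .
qed

text \<open>A nonzero coefficient vector yields a nonzero tangent vector, since \<open>vcomp\<close>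
  recovers the coefficients.\<close>

lemma posdef_metric:
  assumes c: "c \<in> matlas M" and x: "x \<in> img c"
  shows "posdef n (\<lambda>i j. metric_coeff M g c i j x)"
proof -
  obtain p where p: "p \<in> fst c" "x = snd c p" using x by blast
  have pM: "p \<in> mcarrier M" using c p chart_dom_subset by blast
  note cv = coord_vec_tangent[OF c p(1)]
  show ?thesis
    unfolding posdef_def
  proof (intro conjI allI impI)
    show "metric_coeff M g c i j x = metric_coeff M g c j i x" if "i < n" "j < n" for i j
      unfolding p metric_coeff_chart[OF c p(1)] by (rule g_sym[OF cv[OF that(1)] cv[OF that(2)] pM])
    fix a :: "nat \<Rightarrow> real" assume "\<exists>i<n. a i \<noteq> 0"
    then obtain i where i: "i < n" "a i \<noteq> 0" by blast
    let ?v = "lincomb n a (\<lambda>i. coord_vec M c i p)"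
    have v: "?v \<in> tangent_space M p" by (rule lincomb_tangent[OF cv])
    have "vcomp c i ?v = a i" by (rule vcomp_lincomb[OF c p(1) i(1)])
    then have "?v \<noteq> (\<lambda>f. 0)" using i by (auto simp: vcomp_def)
    then have "0 < g p ?v ?v" by (rule g_pos[OF v pM])
    also have "g p ?v ?v = (\<Sum>i<n. \<Sum>j<n. metric_coeff M g c i j x * a i * a j)"
      unfolding g_coords[OF c p(1) v v] p(2)
      by (intro sum.cong refl) (simp add: vcomp_lincomb[OF c p(1)])
    finally show "(\<Sum>i<n. \<Sum>j<n. metric_coeff M g c i j x * a i * a j) > 0" .
  qed
qed

text \<open>Coordinate fields multiplied by a bump function are global vector fields, to which the
  smoothness of the metric applies.\<close>

lemma smooth_metric_coeff:
  assumes c: "c \<in> matlas M" and ij: "i < n" "j < n"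
  shows "smooth_coord n (img c) (metric_coeff M g c i j)"
proof (rule smooth_coord_local[OF chart_props(2)[OF c]])
  fix x0 assume x0: "x0 \<in> img c"
  obtain e' where e': "e' > 0" "coord_ball n x0 e' \<subseteq> img c" using coord_ballE[OF chart_props(2)[OF c] x0] .
  \<comment> \<open>Half the radius, so that the closed cube \<open>K\<close> still lies in the
    image of the chart.\<close>
  define e where "e = e' / 2"
  have e: "e > 0" "e < e'" using e' by (auto simp: e_def)
  let ?B = "coord_ball n x0 e" and ?b = "bump n x0 e"
  have x0c: "x0 \<in> coord_space n" using img_subset[OF c] x0 by blast
  define K where "K = {y \<in> coord_space n. \<forall>i<n. \<bar>y i - x0 i\<bar> \<le> e}"
  have KI: "K \<subseteq> img c" using e e'(2) by (fastforce simp: K_def coord_ball_def)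
  have Kcomp: "compactin (Euclidean_space n) K"
  proof -
    have K: "y \<in> K \<longleftrightarrow> (\<forall>i. y i \<in> (if i < n then {x0 i - e..x0 i + e} else {0}))" for y
    proof -
      have "y \<in> K \<longleftrightarrow> (\<forall>i. (i < n \<longrightarrow> \<bar>y i - x0 i\<bar> \<le> e) \<and> (\<not> i < n \<longrightarrow> y i = 0))"
        by (auto simp: K_def topspace_Euclidean_space not_less)
      also have "\<dots> \<longleftrightarrow> (\<forall>i. y i \<in> (if i < n then {x0 i - e..x0 i + e} else {0}))"
        by (rule iff_allI) (auto simp: abs_le_iff)
      finally show ?thesis .
    qed
    have "K = (\<Pi>\<^sub>E i\<in>UNIV. if i < n then {x0 i - e..x0 i + e} else {0})"
      unfolding PiE_UNIV_domain by (rule set_eqI) (simp only: K Pi_iff UNIV_I simp_thms ball_UNIV)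
    moreover have "compactin (powertop_real UNIV) (\<Pi>\<^sub>E i\<in>UNIV. if i < n then {x0 i - e..x0 i + e} else {0})"
      unfolding compactin_PiE by (auto simp: compactin_euclidean_iff)
    ultimately have "compactin (powertop_real UNIV) K" by simp
    then show ?thesis
      unfolding Euclidean_space_def compactin_subtopology by (auto simp: K_def topspace_Euclidean_space)
  qed
  \<comment> \<open>Compact sets in a Hausdorff space are closed. The field extended by 0 therefore
    vanishes on an open set around every point outside the chart domain, which makes it smooth
    there.\<close>
  have Kclosed: "closedin (mtop M) (chart_inv c ` K)"
  proof -
    have "compactin (subtopology (Euclidean_space n) (img c)) K"
      using Kcomp KI by (simp add: compactin_subtopology)
    then have "compactin (subtopology (mtop M) (fst c)) (chart_inv c ` K)"
      using image_compactin chart_inv_continuous[OF c] by blast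
    then have "compactin (mtop M) (chart_inv c ` K)" by (simp add: compactin_subtopology)
    moreover have "Hausdorff_space (mtop M)" using mfd unfolding smooth_manifold_def by blast
    ultimately show ?thesis using compactin_imp_closedin by blast
  qed
  define X where "X i q = (if q \<in> fst c then (\<lambda>f. ?b (snd c q) * coord_vec M c i q f) else (\<lambda>f. 0))" for i q
  have X: "smooth_vector_field M (X i)" if i: "i < n" for i
    unfolding smooth_vector_field_def
  proof (intro conjI ballI allI impI)
    fix q assume "q \<in> mcarrier M"
    show "X i q \<in> tangent_space M q"
    proof (cases "q \<in> fst c")
      case True
      have "(\<lambda>f. ?b (snd c q) * coord_vec M c i q f + 0 * coord_vec M c i q f) \<in> tangent_space M q"
        by (intro tangent_comb coord_vec_tangent[OF c True i])
      then show ?thesis using True by (simp add: X_def)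
    qed (simp add: X_def tangent_zero)
  next
    fix f assume f: "smooth_function M f"
    show "smooth_function M (\<lambda>q. X i q f)"
    proof (rule smooth_functionI)
      fix q assume q: "q \<in> mcarrier M"
      show "smooth_near M q (\<lambda>q. X i q f)"
      proof (cases "q \<in> fst c")
        case True
        note I = chart_props(2)[OF c]
        have "smooth_coord n (img c) (\<lambda>x. ?b x * pd i (loc c f) x)"
          by (intro smooth_coord_mult[OF I] smooth_coord_bump[OF I] smooth_coord_pd[OF smooth_function_loc[OF f c] i])
        then have "smooth_near M q (\<lambda>q. ?b (snd c q) * pd i (loc c f) (snd c q))"
          by (rule smooth_near_compose_chart[OF c True I, rotated 2]) (use True in auto)
        then show ?thesis
        proof (rule smooth_near_cong[OF _ chart_props(1)[OF c] True])
          fix r assume r: "r \<in> fst c"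
          then have "smooth_near M r f" using smooth_function_near[OF f] chart_dom_subset[OF c] by blast
          then show "?b (snd c r) * pd i (loc c f) (snd c r) = X i r f"
            using r by (simp add: X_def coord_vec_eq)
        qed
      next
        case False
        show ?thesis
        proof (rule smooth_near_cong[OF smooth_near_const[OF q, of 0]])
          show "openin (mtop M) (mcarrier M - chart_inv c ` K)" using Kclosed by blast
          show "q \<in> mcarrier M - chart_inv c ` K"
            using q False chart_inv_in[OF c] KI by blast
          fix r assume r: "r \<in> mcarrier M - chart_inv c ` K"
          show "0 = X i r f"
          proof (cases "r \<in> fst c")
            case True
            have "snd c r \<notin> K" using r chart_inv_chart[OF c True] by (metis DiffD2 imageI)
            moreover have "snd c r \<in> coord_space n" using True img_subset[OF c] by blast
            ultimately have "?b (snd c r) = 0"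
              by (intro bump_eq_0[OF e(1)]) (auto simp: K_def coord_ball_def less_imp_le)
            then show ?thesis using True by (simp add: X_def)
          qed (simp add: X_def)
        qed
      qed
    qed
  qed
  have "smooth_function M (\<lambda>p. g p (X i p) (X j p))"
    using metric X ij unfolding riemannian_metric_def by blast
  then have sm: "smooth_coord n (img c) (loc c (\<lambda>p. g p (X i p) (X j p)))" by (rule smooth_function_loc[OF _ c])
  have BI: "?B \<subseteq> img c" using e e'(2) by (force simp: coord_ball_def)
  have o: "openin (Euclidean_space n) ?B" by (rule openin_coord_ball)
  have bp: "?b y > 0" if "y \<in> ?B" for y by (rule bump_pos[OF e(1) that])
  \<comment> \<open>The metric on the two cut-off fields is the coefficient times the square of the
    bump function, which is positive on the cube and can be divided out.\<close>
  have "smooth_coord n ?B (\<lambda>y. loc c (\<lambda>p. g p (X i p) (X j p)) y / (?b y * ?b y))"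
    by (intro smooth_coord_divide[OF o] smooth_coord_mult[OF o] smooth_coord_bump[OF o]
        smooth_coord_subset[OF chart_props(2)[OF c] o BI sm]) (use bp in force)
  then have "smooth_coord n ?B (metric_coeff M g c i j)"
  proof (rule smooth_coord_cong[OF o, rotated])
    fix y assume y: "y \<in> ?B"
    let ?p = "chart_inv c y"
    have p: "?p \<in> fst c" "snd c ?p = y" using chart_inv_in[OF c] chart_chart_inv[OF c] y BI by auto
    have pM: "?p \<in> mcarrier M" using p chart_dom_subset[OF c] by blast
    note cv = coord_vec_tangent[OF c p(1)]
    have sc: "g ?p (\<lambda>f. a * u f) w = a * g ?p u w" if "u \<in> tangent_space M ?p" "w \<in> tangent_space M ?p" for a u w
      using g_lin[OF that(1) that(1) that(2) pM, of a 0] by simp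
    have Xt: "X k ?p \<in> tangent_space M ?p" if "k < n" for k
      using X[OF that] pM unfolding smooth_vector_field_def by blast
    have Xk: "X k ?p = (\<lambda>f. ?b y * coord_vec M c k ?p f)" for k using p by (simp add: X_def)
    have "g ?p (X i ?p) (X j ?p) = ?b y * g ?p (coord_vec M c i ?p) (X j ?p)"
      unfolding Xk[of i] by (rule sc[OF cv[OF ij(1)] Xt[OF ij(2)]])
    also have "g ?p (coord_vec M c i ?p) (X j ?p) = g ?p (X j ?p) (coord_vec M c i ?p)"
      by (rule g_sym[OF cv[OF ij(1)] Xt[OF ij(2)] pM])
    also have "\<dots> = ?b y * g ?p (coord_vec M c j ?p) (coord_vec M c i ?p)"
      unfolding Xk[of j] by (rule sc[OF cv[OF ij(2)] cv[OF ij(1)]])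
    also have "g ?p (coord_vec M c j ?p) (coord_vec M c i ?p) = metric_coeff M g c i j y"
      unfolding metric_coeff_def Let_def by (rule g_sym[OF cv[OF ij(2)] cv[OF ij(1)] pM])
    finally show "loc c (\<lambda>p. g p (X i p) (X j p)) y / (?b y * ?b y) = metric_coeff M g c i j y"
      using bp[OF y] by simp
  qed
  then show "\<exists>V. openin (Euclidean_space n) V \<and> x0 \<in> V \<and> V \<subseteq> img c \<and> smooth_coord n V (metric_coeff M g c i j)"
    using o BI centre_in_coord_ball[OF x0c e(1)] by blast
qed

lemma coord_metric_chart:
  assumes c: "c \<in> matlas M" and V: "openin (Euclidean_space n) V" "V \<subseteq> img c"
  shows "coord_metric n V (metric_coeff M g c)"
proof
  show "smooth_coord n V (metric_coeff M g c i j)" if "i < n" "j < n" for i j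
    by (rule smooth_coord_subset[OF chart_props(2)[OF c] V smooth_metric_coeff[OF c that]])
qed (use posdef_metric[OF c] V in auto)

abbreviation "grdc c \<equiv> coord_metric.grd n (metric_coeff M g c)"
abbreviation "lapc c \<equiv> coord_metric.lap n (metric_coeff M g c)"
abbreviation "innc c \<equiv> coord_metric.inn n (metric_coeff M g c)"
abbreviation "hessc c \<equiv> coord_metric.hess n (metric_coeff M g c)"

subsection \<open>Gradient and Laplacian\<close>

lemma tangent_apply:
  assumes v: "v \<in> tangent_space M p" and c: "c \<in> matlas M" "p \<in> fst c" and f: "smooth_near M p f"
  shows "v f = (\<Sum>i<n. vcomp c i v * pd i (loc c f) (snd c p))"
proof -
  have "v f = lincomb n (\<lambda>i. vcomp c i v) (\<lambda>i. coord_vec M c i p) f"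
    using tangent_coords[OF v c] by simp
  then show ?thesis by (simp add: lincomb_def coord_vec_eq[OF f])
qed

text \<open>The coordinate field satisfies the defining condition because lowering the raised
  differential gives it back; positive definiteness gives uniqueness. This resolves the description
  operator in \<open>gradient\<close>.\<close>

lemma gradient_eq:
  assumes c: "c \<in> matlas M" "p \<in> fst c" and f: "smooth_near M p f"
  shows "gradient M g f p = lincomb n (\<lambda>i. grdc c (loc c f) i (snd c p)) (\<lambda>i. coord_vec M c i p)"
  unfolding gradient_def
proof (rule the_equality)
  have p: "p \<in> mcarrier M" using c chart_dom_subset by blast
  interpret C: coord_metric n "img c" "metric_coeff M g c"
    by (rule coord_metric_chart[OF c(1) chart_props(2)[OF c(1)]]) simp
  let ?v = "lincomb n (\<lambda>i. C.grd (loc c f) i (snd c p)) (\<lambda>i. coord_vec M c i p)"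
  have x: "snd c p \<in> img c" using c by blast
  have v: "?v \<in> tangent_space M p" by (rule lincomb_tangent[OF coord_vec_tangent[OF c]])
  have gv: "g p ?v w = w f" if w: "w \<in> tangent_space M p" for w
  proof -
    have "g p w ?v = (\<Sum>i<n. vcomp c i w * (\<Sum>j<n. metric_coeff M g c i j (snd c p) * C.grd (loc c f) j (snd c p)))"
      unfolding g_coords[OF c w v] sum_distrib_left
      by (intro sum.cong refl) (simp add: vcomp_lincomb[OF c] mult_ac)
    also have "\<dots> = w f" unfolding tangent_apply[OF w c f]
      by (intro sum.cong refl) (simp add: C.lower_grd[OF x])
    finally show ?thesis using g_sym[OF v w p] by simp
  qed
  then show "?v \<in> tangent_space M p \<and> (\<forall>w\<in>tangent_space M p. g p ?v w = w f)" using v by blast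
  fix u assume u: "u \<in> tangent_space M p \<and> (\<forall>w\<in>tangent_space M p. g p u w = w f)"
  let ?d = "\<lambda>h. 1 * u h + (-1) * ?v h"
  have d: "?d \<in> tangent_space M p" using u v by (intro tangent_comb) auto
  have "g p ?d ?d = 1 * g p u ?d + (-1) * g p ?v ?d" using u by (intro g_lin[OF _ v d p]) auto
  also have "\<dots> = 0" using u d gv[OF d] by auto
  finally have "?d = (\<lambda>f. 0)" using g_pos[OF d p] by fastforce
  then have "u h = ?v h" for h by (drule_tac fun_cong[of _ _ h]) simp
  then show "u = ?v" by blast
qed

lemma gradient_tangent:
  assumes "smooth_near M p f"
  shows "gradient M g f p \<in> tangent_space M p"
proof -
  obtain c where c: "c \<in> matlas M" "p \<in> fst c" using chart_exists[OF smooth_near_carrier[OF assms]] by blast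
  show ?thesis unfolding gradient_eq[OF c assms] by (rule lincomb_tangent[OF coord_vec_tangent[OF c]])
qed

lemma vcomp_gradient:
  assumes "c \<in> matlas M" "p \<in> fst c" "smooth_near M p f" "i < n"
  shows "vcomp c i (gradient M g f p) = grdc c (loc c f) i (snd c p)"
  unfolding gradient_eq[OF assms(1-3)] by (rule vcomp_lincomb[OF assms(1,2,4)])

lemma g_gradient:
  assumes f: "smooth_near M p f" and w: "w \<in> tangent_space M p"
  shows "g p (gradient M g f p) w = w f"
proof -
  have pM: "p \<in> mcarrier M" by (rule smooth_near_carrier[OF f])
  obtain c where c: "c \<in> matlas M" "p \<in> fst c" using chart_exists[OF pM] by blast
  interpret C: coord_metric n "img c" "metric_coeff M g c"
    by (rule coord_metric_chart[OF c(1) chart_props(2)[OF c(1)]]) simp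
  have x: "snd c p \<in> img c" using c by blast
  have v: "gradient M g f p \<in> tangent_space M p" by (rule gradient_tangent[OF f])
  have "g p w (gradient M g f p) = (\<Sum>i<n. vcomp c i w * (\<Sum>j<n. metric_coeff M g c i j (snd c p) * C.grd (loc c f) j (snd c p)))"
    unfolding g_coords[OF c w v] sum_distrib_left
    by (intro sum.cong refl) (simp add: vcomp_gradient[OF c f] mult_ac)
  also have "\<dots> = w f" unfolding tangent_apply[OF w c f]
    by (intro sum.cong refl) (simp add: C.lower_grd[OF x])
  finally show ?thesis using g_sym[OF v w pM] by simp
qed

definition ginn :: "('a \<Rightarrow> real) \<Rightarrow> ('a \<Rightarrow> real) \<Rightarrow> 'a \<Rightarrow> real" where
  "ginn f h q = g q (gradient M g f q) (gradient M g h q)"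

lemma gradient_apply:
  assumes c: "c \<in> matlas M" "p \<in> fst c" and f: "smooth_near M p f" and h: "smooth_near M p h"
  shows "gradient M g f p h = (\<Sum>j<n. grdc c (loc c f) j (snd c p) * pd j (loc c h) (snd c p))"
  unfolding tangent_apply[OF gradient_tangent[OF f] c h]
  by (intro sum.cong refl) (simp add: vcomp_gradient[OF c f])

lemma ginn_apply: "smooth_near M p f \<Longrightarrow> smooth_near M p h \<Longrightarrow> ginn f h p = gradient M g h p f"
  unfolding ginn_def by (rule g_gradient[OF _ gradient_tangent])

lemma ginn_chart:
  assumes c: "c \<in> matlas M" "p \<in> fst c" and f: "smooth_near M p f" and h: "smooth_near M p h"
  shows "ginn f h p = innc c (loc c f) (loc c h) (snd c p)"
proof -
  interpret C: coord_metric n "img c" "metric_coeff M g c"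
    by (rule coord_metric_chart[OF c(1) chart_props(2)[OF c(1)]]) simp
  show ?thesis
    unfolding ginn_apply[OF f h] gradient_apply[OF c h f] C.inn_def by (simp add: mult.commute)
qed

lemma smooth_near_ginn:
  assumes f: "smooth_near M p f" and h: "smooth_near M p h"
  shows "smooth_near M p (ginn f h)"
proof -
  obtain c where c: "c \<in> matlas M" "p \<in> fst c" using chart_exists[OF smooth_near_carrier[OF f]] by blast
  obtain V where V: "openin (Euclidean_space n) V" "snd c p \<in> V" "V \<subseteq> img c"
    "smooth_coord n V (loc c f)" "smooth_coord n V (loc c h)" using smooth_near2[OF f h c] .
  interpret C: coord_metric n V "metric_coeff M g c" by (rule coord_metric_chart[OF c(1) V(1,3)])
  have "smooth_near M p (\<lambda>q. C.inn (loc c f) (loc c h) (snd c q))"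
    by (rule smooth_near_compose_chart[OF c V(1-3) C.smooth_inn[OF V(4,5)]])
  then show ?thesis
  proof (rule smooth_near_cong)
    show "openin (mtop M) {q \<in> fst c. snd c q \<in> V}" by (rule open_chart_preimage[OF c(1) V(1)])
    show "p \<in> {q \<in> fst c. snd c q \<in> V}" using c V by simp
    fix q assume "q \<in> {q \<in> fst c. snd c q \<in> V}"
    then have q: "q \<in> fst c" "snd c q \<in> V" by auto
    show "C.inn (loc c f) (loc c h) (snd c q) = ginn f h q"
      by (rule ginn_chart[OF c(1) q(1) smooth_nearI[OF c(1) q(1) V(1) q(2) V(3,4)]
            smooth_nearI[OF c(1) q(1) V(1) q(2) V(3,5)], symmetric])
  qed
qed

lemma pd_loc_ginn:
  assumes c: "c \<in> matlas M" "p \<in> fst c"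
    and V: "openin (Euclidean_space n) V" "snd c p \<in> V" "V \<subseteq> img c" "smooth_coord n V (loc c f)" "smooth_coord n V (loc c h)"
    and j: "j < n"
  shows "pd j (loc c (ginn f h)) (snd c p) = pd j (innc c (loc c f) (loc c h)) (snd c p)"
proof (rule pd_cong[OF V(1,2) j])
  fix y assume y: "y \<in> V"
  have q: "chart_inv c y \<in> fst c" "snd c (chart_inv c y) = y"
    using y V(3) chart_inv_in[OF c(1)] chart_chart_inv[OF c(1)] by auto
  show "loc c (ginn f h) y = innc c (loc c f) (loc c h) y"
    using ginn_chart[OF c(1) q(1) smooth_nearI[OF c(1) q(1) V(1) _ V(3,4)] smooth_nearI[OF c(1) q(1) V(1) _ V(3,5)]]
    unfolding q(2) using y by blast
qed

text \<open>Twice the Hessian of \<open>f\<close> on \<open>\<nabla>a\<close>, \<open>\<nabla>b\<close>, expressed without coordinates.\<close>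

definition nabla2 :: "('a \<Rightarrow> real) \<Rightarrow> ('a \<Rightarrow> real) \<Rightarrow> ('a \<Rightarrow> real) \<Rightarrow> 'a \<Rightarrow> real" where
  "nabla2 f a b p = gradient M g a p (ginn f b) + gradient M g b p (ginn f a) - gradient M g f p (ginn a b)"

lemma nabla2_chart:
  assumes c: "c \<in> matlas M" "p \<in> fst c"
    and f: "smooth_near M p f" and a: "smooth_near M p a" and b: "smooth_near M p b"
  shows "nabla2 f a b p = 2 * (\<Sum>j<n. \<Sum>k<n. hessc c (loc c f) k j (snd c p) *
     grdc c (loc c a) j (snd c p) * grdc c (loc c b) k (snd c p))"
proof -
  obtain V1 where V1: "openin (Euclidean_space n) V1" "snd c p \<in> V1" "V1 \<subseteq> img c"
    "smooth_coord n V1 (loc c f)" "smooth_coord n V1 (loc c a)" using smooth_near2[OF f a c] .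
  obtain V2 where V2: "openin (Euclidean_space n) V2" "snd c p \<in> V2" "V2 \<subseteq> img c"
    "smooth_coord n V2 (loc c b)" using smooth_nearD[OF b c] .
  define V where "V = V1 \<inter> V2"
  have V: "openin (Euclidean_space n) V" "snd c p \<in> V" "V \<subseteq> img c"
    using V1 V2 by (auto simp: V_def intro: openin_Int)
  have sm: "smooth_coord n V (loc c f)" "smooth_coord n V (loc c a)" "smooth_coord n V (loc c b)"
    using smooth_coord_subset[OF V1(1) V(1) _ V1(4)] smooth_coord_subset[OF V1(1) V(1) _ V1(5)]
      smooth_coord_subset[OF V2(1) V(1) _ V2(4)] by (auto simp: V_def)
  interpret C: coord_metric n V "metric_coeff M g c" by (rule coord_metric_chart[OF c(1) V(1,3)])
  show ?thesis
    unfolding nabla2_def gradient_apply[OF c a smooth_near_ginn[OF f b]] gradient_apply[OF c b smooth_near_ginn[OF f a]]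
      gradient_apply[OF c f smooth_near_ginn[OF a b]] C.koszul_hess[OF sm V(2), symmetric]
    by (simp add: pd_loc_ginn[OF c V(1-3) sm(1,3)] pd_loc_ginn[OF c V(1-3) sm(1,2)] pd_loc_ginn[OF c V(1-3) sm(2,3)])
qed

end

context riemannian
begin

text \<open>The left-hand side does not mention the chart \<open>c\<close>; hence the Laplacian computed in a chart
  does not depend on the chart.\<close>

lemma nabla2_trace:
  assumes c: "c \<in> matlas M" "p \<in> fst c" and d: "d \<in> matlas M" "p \<in> fst d" and f: "smooth_near M p f"
  shows "(\<Sum>\<alpha><n. \<Sum>\<beta><n. metric_coeff M g d \<alpha> \<beta> (snd d p) * nabla2 f (\<lambda>q. snd d q \<alpha>) (\<lambda>q. snd d q \<beta>) p)
    = 2 * lapc c (loc c f) (snd c p)"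
proof -
  interpret C: coord_metric n "img c" "metric_coeff M g c"
    by (rule coord_metric_chart[OF c(1) chart_props(2)[OF c(1)]]) simp
  interpret D: coord_metric n "img d" "metric_coeff M g d"
    by (rule coord_metric_chart[OF d(1) chart_props(2)[OF d(1)]]) simp
  let ?x = "snd c p" and ?y = "snd d p"
  have xC: "?x \<in> img c" and yD: "?y \<in> img d" using c d by auto
  define Y where "Y \<alpha> = (\<lambda>q. snd d q \<alpha>)" for \<alpha> :: nat
  define X where "X j = (\<lambda>q. snd c q j)" for j :: nat
  have Y: "smooth_near M p (Y \<alpha>)" for \<alpha> unfolding Y_def by (rule smooth_near_chart[OF d])
  have X: "smooth_near M p (X \<alpha>)" for \<alpha> unfolding X_def by (rule smooth_near_chart[OF c])
  have pdY: "pd m (loc d (Y \<alpha>)) ?y = (if m = \<alpha> then 1 else 0)" if "m < n" for m \<alpha>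
  proof -
    have "pd m (loc d (Y \<alpha>)) ?y = pd m (\<lambda>x. x \<alpha>) ?y"
      by (rule pd_cong[OF chart_props(2)[OF d(1)] yD that]) (simp add: Y_def chart_chart_inv[OF d(1)])
    then show ?thesis by (simp add: pd_component)
  qed
  have pdX: "pd m (loc c (X \<alpha>)) ?x = (if m = \<alpha> then 1 else 0)" if "m < n" for m \<alpha>
  proof -
    have "pd m (loc c (X \<alpha>)) ?x = pd m (\<lambda>x. x \<alpha>) ?x"
      by (rule pd_cong[OF chart_props(2)[OF c(1)] xC that]) (simp add: X_def chart_chart_inv[OF c(1)])
    then show ?thesis by (simp add: pd_component)
  qed
  define J where "J j m = pd m (loc d (X j)) ?y" for j m
  have grdY: "D.grd (loc d (Y \<alpha>)) m ?y = D.Gi m \<alpha> ?y" if "\<alpha> < n" for m \<alpha>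
  proof -
    have "D.grd (loc d (Y \<alpha>)) m ?y = (\<Sum>l<n. if l = \<alpha> then D.Gi m l ?y else 0)"
      unfolding D.grd_def by (intro sum.cong refl) (simp add: pdY)
    then show ?thesis using that by simp
  qed
  \<comment> \<open>The components in \<open>c\<close> of the gradient of \<open>Y \<alpha>\<close>
    are its values on the functions \<open>X j\<close>, which can be computed in the chart
    \<open>d\<close> as well.\<close>
  have A: "C.grd (loc c (Y \<alpha>)) j ?x = (\<Sum>m<n. D.Gi m \<alpha> ?y * J j m)" if "\<alpha> < n" "j < n" for \<alpha> j
  proof -
    have "C.grd (loc c (Y \<alpha>)) j ?x = vcomp c j (gradient M g (Y \<alpha>) p)"
      by (rule vcomp_gradient[OF c Y that(2), symmetric])
    also have "\<dots> = gradient M g (Y \<alpha>) p (X j)" by (simp add: vcomp_def X_def)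
    also have "\<dots> = (\<Sum>m<n. D.Gi m \<alpha> ?y * J j m)"
      unfolding gradient_apply[OF d Y X] J_def by (simp add: grdY[OF that(1)])
    finally show ?thesis .
  qed
  \<comment> \<open>The transformation law of the inverse metric under the Jacobian
    \<open>J\<close>: both sides are the inner product of the gradients of \<open>X j\<close> and
    \<open>X k\<close>, computed in \<open>d\<close> and in \<open>c\<close>.\<close>
  have GiC: "(\<Sum>m<n. \<Sum>l<n. D.Gi m l ?y * J j m * J k l) = C.Gi j k ?x" if "j < n" "k < n" for j k
  proof -
    have "(\<Sum>m<n. \<Sum>l<n. D.Gi m l ?y * J j m * J k l) = D.inn (loc d (X j)) (loc d (X k)) ?y"
      unfolding D.inn_def D.grd_def J_def by (simp add: sum_distrib_left mult_ac)
    also have "\<dots> = C.inn (loc c (X j)) (loc c (X k)) ?x"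
      unfolding ginn_chart[OF d X X, symmetric] ginn_chart[OF c X X, symmetric] ..
    also have "\<dots> = (\<Sum>m<n. if m = j then C.grd (loc c (X k)) m ?x else 0)"
      unfolding C.inn_def by (intro sum.cong refl) (simp add: pdX)
    also have "\<dots> = C.grd (loc c (X k)) j ?x" using that by simp
    also have "\<dots> = (\<Sum>l<n. if l = k then C.Gi j l ?x else 0)"
      unfolding C.grd_def by (intro sum.cong refl) (simp add: pdX)
    finally show ?thesis using that by simp
  qed
  have "(\<Sum>\<alpha><n. \<Sum>\<beta><n. metric_coeff M g d \<alpha> \<beta> ?y * nabla2 f (Y \<alpha>) (Y \<beta>) p) =
     (\<Sum>\<alpha><n. \<Sum>\<beta><n. \<Sum>j<n. \<Sum>k<n. 2 * (C.hess (loc c f) k j ?x * (metric_coeff M g d \<alpha> \<beta> ?y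
        * C.grd (loc c (Y \<alpha>)) j ?x * C.grd (loc c (Y \<beta>)) k ?x)))"
    by (simp add: nabla2_chart[OF c f Y Y] sum_distrib_left mult_ac)
  also have "\<dots> = (\<Sum>j<n. \<Sum>k<n. \<Sum>\<alpha><n. \<Sum>\<beta><n. 2 * (C.hess (loc c f) k j ?x * (metric_coeff M g d \<alpha> \<beta> ?y
        * C.grd (loc c (Y \<alpha>)) j ?x * C.grd (loc c (Y \<beta>)) k ?x)))"
    unfolding sum.cartesian_product
    by (rule sum.reindex_bij_witness[of _ "\<lambda>(j, k, \<alpha>, \<beta>). (\<alpha>, \<beta>, j, k)" "\<lambda>(\<alpha>, \<beta>, j, k). (j, k, \<alpha>, \<beta>)"]) auto
  also have "\<dots> = (\<Sum>j<n. \<Sum>k<n. 2 * (C.Gi j k ?x * C.hess (loc c f) k j ?x))"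
  proof (intro sum.cong refl)
    fix j k assume "j \<in> {..<n}" "k \<in> {..<n}"
    then have jk: "j < n" "k < n" by auto
    have "(\<Sum>\<alpha><n. \<Sum>\<beta><n. metric_coeff M g d \<alpha> \<beta> ?y * C.grd (loc c (Y \<alpha>)) j ?x * C.grd (loc c (Y \<beta>)) k ?x)
       = (\<Sum>\<alpha><n. \<Sum>\<beta><n. metric_coeff M g d \<alpha> \<beta> ?y * (\<Sum>m<n. D.Gi m \<alpha> ?y * J j m) * (\<Sum>l<n. D.Gi l \<beta> ?y * J k l))"
      by (intro sum.cong refl) (simp add: A jk)
    also have "\<dots> = C.Gi j k ?x" unfolding D.G_raise_raise[OF yD] by (rule GiC[OF jk])
    finally have "(\<Sum>\<alpha><n. \<Sum>\<beta><n. metric_coeff M g d \<alpha> \<beta> ?y * C.grd (loc c (Y \<alpha>)) j ?x * C.grd (loc c (Y \<beta>)) k ?x)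
       = C.Gi j k ?x" .
    then show "(\<Sum>\<alpha><n. \<Sum>\<beta><n. 2 * (C.hess (loc c f) k j ?x * (metric_coeff M g d \<alpha> \<beta> ?y
        * C.grd (loc c (Y \<alpha>)) j ?x * C.grd (loc c (Y \<beta>)) k ?x))) = 2 * (C.Gi j k ?x * C.hess (loc c f) k j ?x)"
      unfolding sum_distrib_left[symmetric] by simp
  qed
  also have "\<dots> = 2 * C.lap (loc c f) ?x"
    unfolding C.lap_trace[OF xC] by (simp add: sum_distrib_left)
  finally show ?thesis unfolding Y_def .
qed

lemma christoffel_eq: "christoffel M g c = coord_metric.Chr n (metric_coeff M g c)"
  if "c \<in> matlas M"
proof -
  interpret C: coord_metric n "img c" "metric_coeff M g c"
    by (rule coord_metric_chart[OF that chart_props(2)[OF that]]) simp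
  show ?thesis by (intro ext) (simp add: christoffel_def C.Chr_def C.Gi_def)
qed

lemma ricci_coeff_eq: "ricci_coeff M g c = coord_metric.Ric n (metric_coeff M g c)"
  if "c \<in> matlas M"
proof -
  interpret C: coord_metric n "img c" "metric_coeff M g c"
    by (rule coord_metric_chart[OF that chart_props(2)[OF that]]) simp
  show ?thesis
    unfolding ricci_coeff_def[abs_def] christoffel_eq[OF that] Let_def C.Ric_def[abs_def] ..
qed

text \<open>The definition uses the chart \<open>d\<close> selected at \<open>p\<close>. One and the
  same trace over the coordinate functions of \<open>d\<close> is twice the Laplacian computed in
  \<open>d\<close> and twice the one computed in \<open>c\<close>. This allows the Laplacian to be
  differentiated in a fixed chart.\<close>

lemma laplacian_chart:
  assumes f: "smooth_near M p f" and c: "c \<in> matlas M" "p \<in> fst c"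
  shows "laplacian M g f p = lapc c (loc c f) (snd c p)"
proof -
  have p: "p \<in> mcarrier M" by (rule smooth_near_carrier[OF f])
  define d where "d = chart_at M p"
  have d: "d \<in> matlas M" "p \<in> fst d" using chart_at[OF p] by (auto simp: d_def)
  obtain V where V: "openin (Euclidean_space n) V" "snd d p \<in> V" "V \<subseteq> img d" "smooth_coord n V (loc d f)"
    using smooth_nearD[OF f d] .
  interpret D: coord_metric n V "metric_coeff M g d" by (rule coord_metric_chart[OF d(1) V(1,3)])
  have near: "vcomp d i (gradient M g f q) = D.grd (loc d f) i (snd d q)"
    if "q \<in> fst d" "snd d q \<in> V" "i < n" for q i
    by (rule vcomp_gradient[OF d(1) that(1) smooth_nearI[OF d(1) that(1) V(1) that(2) V(3,4)] that(3)])
  have sm: "smooth_near M p (\<lambda>q. vcomp d i (gradient M g f q))" if "i < n" for i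
  proof (rule smooth_near_cong)
    show "smooth_near M p (\<lambda>q. D.grd (loc d f) i (snd d q))"
      by (rule smooth_near_compose_chart[OF d V(1-3) D.smooth_grd[OF V(4)]])
    show "openin (mtop M) {q \<in> fst d. snd d q \<in> V}" by (rule open_chart_preimage[OF d(1) V(1)])
    show "p \<in> {q \<in> fst d. snd d q \<in> V}" using d V by simp
  qed (use near that in auto)
  have cv: "coord_vec M d i p (\<lambda>q. vcomp d i (gradient M g f q)) = pd i (D.grd (loc d f) i) (snd d p)"
    if "i < n" for i
    unfolding coord_vec_eq[OF sm[OF that]]
    by (rule pd_cong[OF V(1,2) that])
      (use near that V(3) chart_inv_in[OF d(1)] chart_chart_inv[OF d(1)] in auto)
  have "laplacian M g f p = (\<Sum>i<n. pd i (D.grd (loc d f) i) (snd d p)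
       + (\<Sum>j<n. D.Chr i i j (snd d p) * D.grd (loc d f) j (snd d p)))"
    unfolding laplacian_def divergence_def Let_def d_def[symmetric]
    by (intro sum.cong refl arg_cong2[of _ _ _ _ "(+)"])
      (auto simp: cv christoffel_eq[OF d(1)] near[OF d(2) V(2)])
  also have "\<dots> = D.lap (loc d f) (snd d p)" by (simp add: D.dvg_def)
  also have "\<dots> = lapc c (loc c f) (snd c p)"
    using nabla2_trace[OF d d f] nabla2_trace[OF c d f] by simp
  finally show ?thesis .
qed

lemma g_nonneg: "v \<in> tangent_space M p \<Longrightarrow> p \<in> mcarrier M \<Longrightarrow> g p v v \<ge> 0"
  using g_pos[of v p] g_zero[of v p] by (cases "v = (\<lambda>f. 0)") auto

lemma g_cauchy_schwarz:
  assumes u: "u \<in> tangent_space M p" and v: "v \<in> tangent_space M p" and p: "p \<in> mcarrier M"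
  shows "\<bar>g p u v\<bar> \<le> sqrt (g p u u) * sqrt (g p v v)"
proof (cases "v = (\<lambda>f. 0)")
  case True
  then show ?thesis using g_zero[OF u p] g_zero[OF v p] g_sym[OF u v p] by simp
next
  case False
  then have a: "g p v v > 0" using g_pos[OF v p] by blast
  \<comment> \<open>The coefficient for which \<open>?w\<close> is orthogonal to
    \<open>v\<close>.\<close>
  define r where "r = - (g p u v / g p v v)"
  let ?w = "\<lambda>f. 1 * u f + r * v f"
  have w: "?w \<in> tangent_space M p" by (rule tangent_comb[OF u v])
  have wu: "g p ?w u = g p u u + r * g p u v"
    using g_lin[OF u v u p, of 1 r] g_sym[OF u v p] by simp
  have wv: "g p ?w v = g p u v + r * g p v v"
    using g_lin[OF u v v p, of 1 r] by simp
  have "0 \<le> g p ?w ?w" by (rule g_nonneg[OF w p])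
  also have "g p ?w ?w = g p u ?w + r * g p v ?w"
    using g_lin[OF u v w p, of 1 r] by simp
  also have "\<dots> = g p u u + r * g p u v + r * (g p u v + r * g p v v)"
    unfolding g_sym[OF u w p] g_sym[OF v w p] wu wv ..
  also have "\<dots> = g p u u - (g p u v)\<^sup>2 / g p v v"
    using a by (simp add: r_def field_simps power2_eq_square)
  finally have "(g p u v)\<^sup>2 \<le> g p u u * g p v v" using a by (simp add: field_simps)
  then have "sqrt ((g p u v)\<^sup>2) \<le> sqrt (g p u u * g p v v)" by (rule real_sqrt_le_mono)
  then show ?thesis by (simp add: real_sqrt_mult)
qed

subsection \<open>Curves\<close>

definition speed :: "(real \<Rightarrow> 'a) \<Rightarrow> real \<Rightarrow> real" where
  "speed \<gamma> t = sqrt (g (\<gamma> t) (velocity M \<gamma> t) (velocity M \<gamma> t))"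

lemma velocity_cong:
  assumes "\<forall>\<^sub>F s in nhds t. \<gamma> s = \<gamma>' s"
  shows "velocity M \<gamma> t = velocity M \<gamma>' t"
proof -
  have "\<gamma> t = \<gamma>' t" using assms by (rule eventually_nhds_x_imp_x)
  moreover have "deriv (\<lambda>s. f (\<gamma> s)) t = deriv (\<lambda>s. f (\<gamma>' s)) t" for f :: "'a \<Rightarrow> real"
    by (rule deriv_cong_ev) (use assms in \<open>auto elim: eventually_mono\<close>)
  ultimately have "velocity M \<gamma> t f = velocity M \<gamma>' t f" for f
    unfolding velocity_def by (simp only:)
  then show ?thesis by blast
qed

context
  fixes J :: "real set" and \<gamma> :: "real \<Rightarrow> 'a"
  assumes J: "open J" and \<gamma>: "smooth_curve M J \<gamma>"
begin

lemma curve_continuous: "continuous_map (top_of_set J) (mtop M) \<gamma>"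
  using \<gamma> unfolding smooth_curve_def by blast

lemma curve_in_carrier: "t \<in> J \<Longrightarrow> \<gamma> t \<in> mcarrier M"
  using curve_continuous unfolding continuous_map_def by auto

lemma curve_near:
  assumes "openin (mtop M) S" "t \<in> J" "\<gamma> t \<in> S"
  shows "\<forall>\<^sub>F s in nhds t. s \<in> J \<and> \<gamma> s \<in> S"
proof -
  have "openin (top_of_set J) {s \<in> topspace (top_of_set J). \<gamma> s \<in> S}"
    by (rule openin_continuous_map_preimage[OF curve_continuous assms(1)])
  then have "open {s \<in> J. \<gamma> s \<in> S}" using J by (simp add: openin_open_eq)
  then show ?thesis using eventually_nhds_in_open[of "{s \<in> J. \<gamma> s \<in> S}" t] assms by simp
qed

definition coord_velocity :: "'a chart \<Rightarrow> nat \<Rightarrow> real \<Rightarrow> real" where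
  "coord_velocity c i t = deriv (\<lambda>s. snd c (\<gamma> s) i) t"

context
  fixes c t assumes c: "c \<in> matlas M" and t: "t \<in> J" "\<gamma> t \<in> fst c"
begin

lemma curve_smooth_real: "i < n \<Longrightarrow> smooth_real {t \<in> J. \<gamma> t \<in> fst c} (\<lambda>t. snd c (\<gamma> t) i)"
proof -
  assume i: "i < n"
  have "\<forall>(U, \<phi>)\<in>matlas M. \<forall>i<n. smooth_real {t \<in> J. \<gamma> t \<in> U} (\<lambda>t. \<phi> (\<gamma> t) i)"
    using \<gamma> unfolding smooth_curve_def by blast
  from bspec[OF this c] show ?thesis using i by (simp add: case_prod_beta)
qed

lemma DERIV_curve: "i < n \<Longrightarrow> ((\<lambda>s. snd c (\<gamma> s) i) has_real_derivative coord_velocity c i t) (at t)"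
proof -
  assume i: "i < n"
  have "((deriv ^^ 0) (\<lambda>s. snd c (\<gamma> s) i)) differentiable at t"
    using curve_smooth_real[OF i] t unfolding smooth_real_def by blast
  then show ?thesis by (simp add: coord_velocity_def DERIV_deriv_iff_real_differentiable)
qed

lemma isCont_coord_velocity: "i < n \<Longrightarrow> isCont (coord_velocity c i) t"
proof -
  assume i: "i < n"
  have "((deriv ^^ 1) (\<lambda>s. snd c (\<gamma> s) i)) differentiable at t"
    using curve_smooth_real[OF i] t unfolding smooth_real_def by blast
  then show ?thesis using differentiable_imp_continuous_within by (simp add: coord_velocity_def[abs_def])
qed

lemma DERIV_coord_function:
  assumes V: "openin (Euclidean_space n) V" "snd c (\<gamma> t) \<in> V" "smooth_coord n V h"
  shows "((\<lambda>s. h (snd c (\<gamma> s))) has_real_derivative (\<Sum>i<n. pd i h (snd c (\<gamma> t)) * coord_velocity c i t)) (at t)"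
proof (rule smooth_chain_rule[where \<gamma> = "\<lambda>s. snd c (\<gamma> s)", OF V(1,3,2)])
  have "\<forall>\<^sub>F s in nhds t. s \<in> J \<and> \<gamma> s \<in> fst c" by (rule curve_near[OF chart_props(1)[OF c] t])
  then have "\<forall>\<^sub>F s in nhds t. snd c (\<gamma> s) \<in> coord_space n"
    by (rule eventually_mono) (use img_subset[OF c] in blast)
  then show "\<forall>\<^sub>F s in at t. snd c (\<gamma> s) \<in> coord_space n"
    by (simp add: eventually_at_filter eventually_mono)
qed (rule DERIV_curve)

lemma DERIV_function_curve:
  assumes f: "smooth_near M (\<gamma> t) f"
  shows "((\<lambda>s. f (\<gamma> s)) has_real_derivative (\<Sum>i<n. pd i (loc c f) (snd c (\<gamma> t)) * coord_velocity c i t)) (at t)"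
proof -
  obtain V where V: "openin (Euclidean_space n) V" "snd c (\<gamma> t) \<in> V" "V \<subseteq> img c" "smooth_coord n V (loc c f)"
    using smooth_nearD[OF f c t(2)] .
  have ev: "\<forall>\<^sub>F s in nhds t. f (\<gamma> s) = loc c f (snd c (\<gamma> s))"
    using curve_near[OF chart_props(1)[OF c] t]
    by (rule eventually_mono) (simp add: chart_inv_chart[OF c])
  show ?thesis
    using DERIV_coord_function[OF V(1,2,4)] by (subst DERIV_cong_ev[OF refl ev refl])
qed

lemma velocity_chart: "velocity M \<gamma> t = lincomb n (\<lambda>i. coord_velocity c i t) (\<lambda>i. coord_vec M c i (\<gamma> t))"
proof
  fix f
  show "velocity M \<gamma> t f = lincomb n (\<lambda>i. coord_velocity c i t) (\<lambda>i. coord_vec M c i (\<gamma> t)) f"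
  proof (cases "smooth_near M (\<gamma> t) f")
    case True
    then show ?thesis
      using DERIV_imp_deriv[OF DERIV_function_curve[OF True]]
      by (simp add: velocity_def lincomb_def coord_vec_eq mult.commute)
  qed (simp add: velocity_def lincomb_def coord_vec_def)
qed

lemma speed_chart:
  "speed \<gamma> t = sqrt (\<Sum>i<n. \<Sum>j<n. metric_coeff M g c i j (snd c (\<gamma> t)) * coord_velocity c i t * coord_velocity c j t)"
proof -
  have v: "velocity M \<gamma> t \<in> tangent_space M (\<gamma> t)"
    unfolding velocity_chart by (rule lincomb_tangent[OF coord_vec_tangent[OF c t(2)]])
  have "vcomp c i (velocity M \<gamma> t) = coord_velocity c i t" if "i < n" for i
    unfolding velocity_chart by (rule vcomp_lincomb[OF c t(2) that])
  then show ?thesis unfolding speed_def g_coords[OF c t(2) v v] by simp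
qed

end

lemma velocity_tangent:
  assumes "t \<in> J"
  shows "velocity M \<gamma> t \<in> tangent_space M (\<gamma> t)"
proof -
  obtain c where c: "c \<in> matlas M" "\<gamma> t \<in> fst c" using chart_exists[OF curve_in_carrier[OF assms]] by blast
  show ?thesis unfolding velocity_chart[OF c(1) assms c(2)]
    by (rule lincomb_tangent[OF coord_vec_tangent[OF c]])
qed

lemma DERIV_velocity:
  assumes "t \<in> J" and f: "smooth_near M (\<gamma> t) f"
  shows "((\<lambda>s. f (\<gamma> s)) has_real_derivative velocity M \<gamma> t f) (at t)"
proof -
  obtain c where c: "c \<in> matlas M" "\<gamma> t \<in> fst c" using chart_exists[OF curve_in_carrier[OF assms(1)]] by blast
  have D: "((\<lambda>s. f (\<gamma> s)) has_real_derivative (\<Sum>i<n. pd i (loc c f) (snd c (\<gamma> t)) * coord_velocity c i t)) (at t)"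
    by (rule DERIV_function_curve[OF c(1) assms(1) c(2) f])
  then have "velocity M \<gamma> t f = (\<Sum>i<n. pd i (loc c f) (snd c (\<gamma> t)) * coord_velocity c i t)"
    using f by (simp add: velocity_def DERIV_imp_deriv)
  then show ?thesis using D by simp
qed

lemma continuous_on_speed: "continuous_on J (speed \<gamma>)"
proof (rule continuous_at_imp_continuous_on, rule ballI)
  fix t assume t: "t \<in> J"
  obtain c where c: "c \<in> matlas M" "\<gamma> t \<in> fst c" using chart_exists[OF curve_in_carrier[OF t]] by blast
  have ev: "\<forall>\<^sub>F s in nhds t. speed \<gamma> s =
      sqrt (\<Sum>i<n. \<Sum>j<n. metric_coeff M g c i j (snd c (\<gamma> s)) * coord_velocity c i s * coord_velocity c j s)"
    using curve_near[OF chart_props(1)[OF c(1)] t c(2)]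
    by (rule eventually_mono) (use speed_chart[OF c(1)] in blast)
  have mc: "isCont (\<lambda>s. metric_coeff M g c i j (snd c (\<gamma> s))) t" if "i < n" "j < n" for i j
    using DERIV_coord_function[OF c(1) t c(2) chart_props(2)[OF c(1)] _ smooth_metric_coeff[OF c(1) that]] c(2)
    by (intro DERIV_isCont) blast
  have "isCont (\<lambda>s. sqrt (\<Sum>i<n. \<Sum>j<n. metric_coeff M g c i j (snd c (\<gamma> s)) * coord_velocity c i s * coord_velocity c j s)) t"
    by (intro continuous_intros mc isCont_coord_velocity[OF c(1) t c(2)]) auto
  then show "isCont (speed \<gamma>) t" using isCont_cong[OF ev] by simp
qed

lemma DERIV_le_speed:
  assumes t: "t \<in> J" and f: "smooth_near M (\<gamma> t) f" and \<mu>: "\<mu> \<ge> 0" "ginn f f (\<gamma> t) \<le> \<mu>\<^sup>2"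
  shows "\<bar>velocity M \<gamma> t f\<bar> \<le> \<mu> * speed \<gamma> t"
proof -
  have p: "\<gamma> t \<in> mcarrier M" by (rule curve_in_carrier[OF t])
  have "\<bar>velocity M \<gamma> t f\<bar> = \<bar>g (\<gamma> t) (gradient M g f (\<gamma> t)) (velocity M \<gamma> t)\<bar>"
    by (simp add: g_gradient[OF f velocity_tangent[OF t]])
  also have "\<dots> \<le> sqrt (ginn f f (\<gamma> t)) * speed \<gamma> t"
    unfolding ginn_def speed_def by (rule g_cauchy_schwarz[OF gradient_tangent[OF f] velocity_tangent[OF t] p])
  also have "\<dots> \<le> \<mu> * speed \<gamma> t"
  proof (rule mult_right_mono)
    show "sqrt (ginn f f (\<gamma> t)) \<le> \<mu>" using \<mu> by (intro real_le_lsqrt) auto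
    show "0 \<le> speed \<gamma> t" unfolding speed_def using g_nonneg[OF velocity_tangent[OF t] p] by simp
  qed
  finally show ?thesis .
qed

end

text \<open>The derivative of \<open>f\<close> along the curve is the inner product of gradient and
  velocity, so Cauchy-Schwarz bounds it by \<open>\<mu>\<close> times the speed. The margin
  \<open>e\<close> makes the derivatives at the end points two-sided.\<close>

lemma curve_length_bound:
  assumes c: "smooth_curve M {a - e<..<b + e} c" and ab: "a \<le> b" "e > 0"
    and f: "smooth_function M f" and \<mu>: "\<mu> \<ge> 0" "\<And>p. p \<in> mcarrier M \<Longrightarrow> ginn f f p \<le> \<mu>\<^sup>2"
  shows "speed c integrable_on {a..b}" "\<bar>f (c b) - f (c a)\<bar> \<le> \<mu> * integral {a..b} (speed c)"
proof -
  let ?J = "{a - e<..<b + e}"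
  have o: "open ?J" by simp
  have sub: "{a..b} \<subseteq> ?J" using ab by auto
  have fn: "smooth_near M (c t) f" if "t \<in> ?J" for t
    by (rule smooth_function_near[OF f curve_in_carrier[OF o c that]])
  show int: "speed c integrable_on {a..b}"
    by (rule integrable_continuous_interval[OF continuous_on_subset[OF continuous_on_speed[OF o c] sub]])
  have I: "((\<lambda>t. velocity M c t f) has_integral (f (c b) - f (c a))) {a..b}"
  proof (rule fundamental_theorem_of_calculus[OF ab(1)])
    fix t assume "t \<in> {a..b}"
    then have t: "t \<in> ?J" using sub by blast
    show "((\<lambda>t. f (c t)) has_vector_derivative velocity M c t f) (at t within {a..b})"
      using DERIV_velocity[OF o c t fn[OF t]]
      by (simp add: has_real_derivative_iff_has_vector_derivative has_vector_derivative_at_within)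
  qed
  have "norm (integral {a..b} (\<lambda>t. velocity M c t f)) \<le> integral {a..b} (\<lambda>t. \<mu> * speed c t)"
  proof (rule integral_norm_bound_integral)
    show "(\<lambda>t. velocity M c t f) integrable_on {a..b}" using I by blast
    show "(\<lambda>t. \<mu> * speed c t) integrable_on {a..b}" using integrable_cmul[OF int, of \<mu>] by simp
    fix t assume "t \<in> {a..b}"
    then have t: "t \<in> ?J" using sub by blast
    show "norm (velocity M c t f) \<le> \<mu> * speed c t"
      using DERIV_le_speed[OF o c t fn[OF t] \<mu>(1)] \<mu>(2) curve_in_carrier[OF o c t] by simp
  qed
  then show "\<bar>f (c b) - f (c a)\<bar> \<le> \<mu> * integral {a..b} (speed c)"
    using integral_unique[OF I] by simp
qed

text \<open>The path may fail to be differentiable at the break points, so on each piece its speed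
  is replaced by that of the smooth extension, which differs at most at the two end points.
  Integrability of the speed is carried along in the induction over the pieces.\<close>

lemma path_length_bound:
  assumes \<gamma>: "piecewise_smooth_path M \<gamma>"
    and f: "smooth_function M f" and \<mu>: "\<mu> \<ge> 0" "\<And>p. p \<in> mcarrier M \<Longrightarrow> ginn f f p \<le> \<mu>\<^sup>2"
  shows "\<bar>f (\<gamma> 1) - f (\<gamma> 0)\<bar> \<le> \<mu> * path_length M g \<gamma>"
proof -
  obtain m s where s: "s 0 = (0::real)" "s m = (1::real)"
    and pieces: "\<And>i. i < m \<Longrightarrow> s i < s (Suc i) \<and>
           (\<exists>e>0. \<exists>c. smooth_curve M {s i - e<..<s (Suc i) + e} c \<and> (\<forall>t\<in>{s i..s (Suc i)}. \<gamma> t = c t))"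
    using \<gamma> unfolding piecewise_smooth_path_def by blast
  have "k \<le> m \<Longrightarrow> 0 \<le> s k \<and> speed \<gamma> integrable_on {0..s k} \<and>
      \<bar>f (\<gamma> (s k)) - f (\<gamma> 0)\<bar> \<le> \<mu> * integral {0..s k} (speed \<gamma>)" for k
  proof (induction k)
    case 0
    have "speed \<gamma> integrable_on {0..0}" using integrable_on_refl[of "speed \<gamma>" 0] by simp
    then show ?case by (simp add: s)
  next
    case (Suc k)
    let ?I = "{s k..s (Suc k)}"
    obtain e c where e: "e > 0" and lt: "s k < s (Suc k)"
      and c: "smooth_curve M {s k - e<..<s (Suc k) + e} c" and eq: "\<And>t. t \<in> ?I \<Longrightarrow> \<gamma> t = c t"
      using pieces[of k] Suc.prems by auto
    have cb: "speed c integrable_on ?I" "\<bar>f (c (s (Suc k))) - f (c (s k))\<bar> \<le> \<mu> * integral ?I (speed c)"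
      using curve_length_bound[OF c less_imp_le[OF lt] e f \<mu>(1)] \<mu>(2) by blast+
    have spike: "speed \<gamma> t = speed c t" if "t \<in> ?I - {s k, s (Suc k)}" for t
    proof -
      have t: "t \<in> {s k<..<s (Suc k)}" using that by auto
      have "\<forall>\<^sub>F r in nhds t. r \<in> {s k<..<s (Suc k)}"
        by (rule eventually_nhds_in_open) (use t in auto)
      then have "\<forall>\<^sub>F r in nhds t. \<gamma> r = c r" by (rule eventually_mono) (use eq in auto)
      then have "velocity M \<gamma> t = velocity M c t" by (rule velocity_cong)
      moreover have "\<gamma> t = c t" using eq t by auto
      ultimately show ?thesis by (simp add: speed_def)
    qed
    have neg: "negligible {s k, s (Suc k)}" by (rule negligible_finite) simp
    have int: "speed \<gamma> integrable_on ?I"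
      by (rule integrable_spike[OF cb(1) neg spike])
    have inteq: "integral ?I (speed \<gamma>) = integral ?I (speed c)"
      by (rule integral_spike[OF neg]) (use spike in auto)
    have IH: "0 \<le> s k" "speed \<gamma> integrable_on {0..s k}"
        "\<bar>f (\<gamma> (s k)) - f (\<gamma> 0)\<bar> \<le> \<mu> * integral {0..s k} (speed \<gamma>)"
      using Suc by auto
    have tot: "speed \<gamma> integrable_on {0..s (Suc k)}"
      by (rule Henstock_Kurzweil_Integration.integrable_combine[OF IH(1) less_imp_le[OF lt] IH(2) int])
    have "integral {0..s k} (speed \<gamma>) + integral ?I (speed \<gamma>) = integral {0..s (Suc k)} (speed \<gamma>)"
      by (rule Henstock_Kurzweil_Integration.integral_combine[OF IH(1) less_imp_le[OF lt] tot])
    moreover have "\<gamma> (s k) = c (s k)" "\<gamma> (s (Suc k)) = c (s (Suc k))" using eq lt by auto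
    moreover have "\<mu> * (integral {0..s k} (speed \<gamma>) + integral ?I (speed \<gamma>)) =
        \<mu> * integral {0..s k} (speed \<gamma>) + \<mu> * integral ?I (speed \<gamma>)" by (rule distrib_left)
    ultimately have "\<bar>f (\<gamma> (s (Suc k))) - f (\<gamma> 0)\<bar> \<le> \<mu> * integral {0..s (Suc k)} (speed \<gamma>)"
      using cb(2) IH(3) unfolding inteq[symmetric] by simp
    then show ?case using IH(1) lt tot by simp
  qed
  from this[of m] show ?thesis
    unfolding s path_length_def speed_def[abs_def, symmetric] by (simp add: speed_def[abs_def])
qed

end

section \<open>Boundedness of the distance\<close>

context riemannian
begin

text \<open>Any two points of such a ball are joined by a coordinate segment of length at most 1, since
  the entries of their difference are at most \<open>2 * e\<close>.\<close>

definition unit_ball :: "'a chart \<Rightarrow> (nat \<Rightarrow> real) \<Rightarrow> real \<Rightarrow> bool" where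
  "unit_ball c x e \<longleftrightarrow> c \<in> matlas M \<and> e > 0 \<and> coord_ball n x e \<subseteq> img c \<and>
     (\<forall>y\<in>coord_ball n x e. \<forall>v. (\<forall>j<n. \<bar>v j\<bar> \<le> 2 * e) \<longrightarrow>
        (\<Sum>i<n. \<Sum>j<n. metric_coeff M g c i j y * v i * v j) \<le> 1)"

lemma unit_ball_exists:
  assumes p: "p \<in> mcarrier M"
  obtains c e where "p \<in> fst c" "unit_ball c (snd c p) e"
proof -
  obtain c where c: "c \<in> matlas M" "p \<in> fst c" using chart_exists[OF p] by blast
  note I = chart_props(2)[OF c(1)]
  have x: "snd c p \<in> img c" using c by blast
  define S where "S y = (\<Sum>i<n. \<Sum>j<n. \<bar>metric_coeff M g c i j y\<bar>)" for y
  have "continuous_on (img c) S"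
    unfolding S_def
    by (intro continuous_intros smooth_coord_continuous[OF I smooth_metric_coeff[OF c(1)]]) auto
  then obtain d where d: "d > 0" "coord_ball n (snd c p) d \<subseteq> img c"
    "\<And>y. y \<in> coord_ball n (snd c p) d \<Longrightarrow> \<bar>S y - S (snd c p)\<bar> < 1"
    by (rule continuous_on_coordE[OF I _ x zero_less_one]) blast
  define B where "B = S (snd c p) + 1"
  have B: "B \<ge> 1" by (simp add: B_def S_def sum_nonneg)
  \<comment> \<open>Entries of size at most \<open>2 * e\<close> are at most \<open>1 / B\<close>,
    so the quadratic form is at most \<open>B * (1 / B) * (1 / B)\<close>, and this is at most 1
    because \<open>B \<ge> 1\<close>.\<close>
  define e where "e = min d (1 / (2 * B))"
  have e: "e > 0" "e \<le> d" "e \<le> 1 / (2 * B)" using d(1) B by (auto simp: e_def)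
  have sub: "coord_ball n (snd c p) e \<subseteq> coord_ball n (snd c p) d"
    using e(2) by (force simp: coord_ball_def)
  have "unit_ball c (snd c p) e"
    unfolding unit_ball_def
  proof (intro conjI ballI allI impI c(1) e(1))
    show "coord_ball n (snd c p) e \<subseteq> img c" using sub d(2) by blast
    fix y v assume y: "y \<in> coord_ball n (snd c p) e" and v: "\<forall>j<n. \<bar>v j\<bar> \<le> 2 * e"
    have "(\<Sum>i<n. \<Sum>j<n. metric_coeff M g c i j y * v i * v j) \<le>
        (\<Sum>i<n. \<Sum>j<n. \<bar>metric_coeff M g c i j y\<bar> * (2 * e) * (2 * e))"
    proof (intro sum_mono)
      fix i j assume "i \<in> {..<n}" "j \<in> {..<n}"
      then have "\<bar>v i\<bar> \<le> 2 * e" "\<bar>v j\<bar> \<le> 2 * e" using v by auto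
      then have "\<bar>metric_coeff M g c i j y\<bar> * \<bar>v i\<bar> * \<bar>v j\<bar> \<le> \<bar>metric_coeff M g c i j y\<bar> * (2 * e) * (2 * e)"
        using e(1) by (intro mult_mono) auto
      then show "metric_coeff M g c i j y * v i * v j \<le> \<bar>metric_coeff M g c i j y\<bar> * (2 * e) * (2 * e)"
        using abs_ge_self[of "metric_coeff M g c i j y * v i * v j"] by (simp add: abs_mult)
    qed
    also have "\<dots> = S y * (2 * e) * (2 * e)" by (simp add: S_def sum_distrib_right)
    also have "\<dots> \<le> B * (1 / B) * (1 / B)"
    proof (intro mult_mono)
      have "y \<in> coord_ball n (snd c p) d" using y sub by blast
      then show "S y \<le> B" using d(3)[of y] by (simp add: B_def abs_less_iff)
      show "2 * e \<le> 1 / B" "2 * e \<le> 1 / B" using e(3) B by (simp_all add: field_simps)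
    qed (use B e in \<open>auto simp: S_def intro: sum_nonneg\<close>)
    also have "\<dots> \<le> 1" using B by simp
    finally show "(\<Sum>i<n. \<Sum>j<n. metric_coeff M g c i j y * v i * v j) \<le> 1" .
  qed
  then show thesis using that c by blast
qed

text \<open>A relation that is symmetric, open and reflexive on the manifold; the number of steps
  serves as a coarse distance, since a step costs a path of length at most 1.\<close>

definition near_step :: "('a \<times> 'a) set" where
  "near_step = {(p, q). \<exists>c x e. unit_ball c x e \<and> p \<in> fst c \<and> q \<in> fst c \<and>
      snd c p \<in> coord_ball n x e \<and> snd c q \<in> coord_ball n x e}"

text \<open>The velocity has the constant coordinates \<open>(b j - a j) / (s - r)\<close>, with
  numerators of size at most \<open>2 * e\<close>, to which the bound in \<open>unit_ball\<close>
  applies.\<close>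

lemma segment_curve:
  assumes gd: "unit_ball c x e" and ab: "a \<in> coord_ball n x e" "b \<in> coord_ball n x e"
    and rs: "r < s" and lin: "\<And>t. lin t = (\<lambda>j. if j < n then a j + (t - r) / (s - r) * (b j - a j) else 0)"
  obtains \<eta> where "\<eta> > 0" "smooth_curve M {r - \<eta><..<s + \<eta>} (\<lambda>t. chart_inv c (lin t))"
    "\<And>t. t \<in> {r<..<s} \<Longrightarrow> speed (\<lambda>t. chart_inv c (lin t)) t \<le> 1 / (s - r)"
proof -
  let ?\<gamma> = "\<lambda>t. chart_inv c (lin t)"
  have c: "c \<in> matlas M" and e: "e > 0" and sub: "coord_ball n x e \<subseteq> img c" using gd by (auto simp: unit_ball_def)
  have linc: "lin t \<in> coord_space n" for t by (simp add: lin topspace_Euclidean_space)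
  \<comment> \<open>This set is open and, by convexity of the cube, contains the closed interval;
    that yields the margin \<open>\<eta>\<close> on both sides.\<close>
  define J where "J = {t. lin t \<in> coord_ball n x e}"
  have J_eq: "J = (\<Inter>j\<in>{..<n}. {t. \<bar>a j + (t - r) / (s - r) * (b j - a j) - x j\<bar> < e})"
    using linc by (auto simp: J_def coord_ball_def lin)
  have oJ: "open J" unfolding J_eq
    by (intro open_INT finite_lessThan ballI open_Collect_less continuous_intros) (use rs in auto)
  have conv: "t \<in> J" if "t \<in> {r..s}" for t
    unfolding J_eq
  proof (intro INT_I CollectI)
    fix j assume "j \<in> {..<n}"
    then have j: "\<bar>a j - x j\<bar> < e" "\<bar>b j - x j\<bar> < e" using ab by (auto simp: coord_ball_def)
    define u where "u = (t - r) / (s - r)"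
    have u: "0 \<le> u" "u \<le> 1" using that rs by (auto simp: u_def)
    have "a j + u * (b j - a j) - x j = (1 - u) * (a j - x j) + u * (b j - x j)" by (simp add: algebra_simps)
    also have "\<bar>\<dots>\<bar> \<le> (1 - u) * \<bar>a j - x j\<bar> + u * \<bar>b j - x j\<bar>"
      using u abs_triangle_ineq[of "(1 - u) * (a j - x j)" "u * (b j - x j)"] by (simp add: abs_mult)
    also have "\<dots> < e" by (rule convex_bound_lt) (use j u in auto)
    finally show "\<bar>a j + (t - r) / (s - r) * (b j - a j) - x j\<bar> < e" by (simp add: u_def)
  qed
  obtain \<eta>1 where \<eta>1: "\<eta>1 > 0" "\<And>t. dist t r < \<eta>1 \<Longrightarrow> t \<in> J"
    using oJ conv[of r] rs unfolding open_dist by force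
  obtain \<eta>2 where \<eta>2: "\<eta>2 > 0" "\<And>t. dist t s < \<eta>2 \<Longrightarrow> t \<in> J"
    using oJ conv[of s] rs unfolding open_dist by force
  define \<eta> where "\<eta> = min \<eta>1 \<eta>2"
  have \<eta>: "\<eta> > 0" using \<eta>1 \<eta>2 by (simp add: \<eta>_def)
  let ?K = "{r - \<eta><..<s + \<eta>}"
  have KJ: "t \<in> J" if "t \<in> ?K" for t
  proof -
    consider "t < r" | "t \<in> {r..s}" | "t > s" by fastforce
    then show ?thesis
      by cases (use that \<eta>1(2)[of t] \<eta>2(2)[of t] conv in \<open>auto simp: dist_real_def \<eta>_def\<close>)
  qed
  have linI: "lin t \<in> img c" if "t \<in> ?K" for t using KJ[OF that] sub by (auto simp: J_def)
  have oK: "open ?K" by simp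
  have cl: "continuous_on ?K lin"
  proof (rule continuous_on_coordinatewise_then_product)
    fix j show "continuous_on ?K (\<lambda>t. lin t j)"
      by (cases "j < n") (use rs in \<open>auto simp: lin intro!: continuous_intros\<close>)
  qed
  have topI: "subtopology (Euclidean_space n) (img c) = top_of_set (img c)"
    unfolding Euclidean_space_eq_top_of_set subtopology_subtopology
    using img_subset[OF c] by (simp add: topspace_Euclidean_space Int_absorb1)
  have ct: "continuous_map (top_of_set ?K) (mtop M) ?\<gamma>"
  proof -
    have 1: "continuous_map (top_of_set ?K) (subtopology (Euclidean_space n) (img c)) lin"
      unfolding topI using cl linI by auto
    have 2: "continuous_map (subtopology (Euclidean_space n) (img c)) (mtop M) (chart_inv c)"
      using chart_inv_continuous[OF c] continuous_map_into_fulltopology by blast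
    from continuous_map_compose[OF 1 2] show ?thesis by (simp add: o_def)
  qed
  have lin_aff: "lin t i = (a i - r / (s - r) * (b i - a i)) + t * ((b i - a i) / (s - r))" if "i < n" for i t
    using that by (simp add: lin divide_inverse algebra_simps)
  have sm: "smooth_curve M ?K ?\<gamma>"
    unfolding smooth_curve_def
  proof (intro conjI ct ballI allI impI)
    fix d assume d: "d \<in> matlas M"
    show "case d of (U, \<phi>) \<Rightarrow> \<forall>i<n. smooth_real {t \<in> ?K. ?\<gamma> t \<in> U} (\<lambda>t. \<phi> (?\<gamma> t) i)"
    proof (clarsimp simp del: greaterThanLessThan_iff)
      fix U \<phi> i assume Ud: "d = (U, \<phi>)" and i: "i < n"
      let ?W = "snd c ` (fst c \<inter> U)"
      have oW: "openin (Euclidean_space n) ?W"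
        using open_chart_image[OF c chart_props(1)[OF d]] by (simp add: Ud)
      have oJ': "open {t \<in> ?K. ?\<gamma> t \<in> U}"
      proof -
        have "openin (top_of_set ?K) {t \<in> topspace (top_of_set ?K). ?\<gamma> t \<in> U}"
          by (rule openin_continuous_map_preimage[OF ct]) (use chart_props(1)[OF d] Ud in simp)
        then show ?thesis using oK by (simp add: openin_open_eq del: greaterThanLessThan_iff)
      qed
      show "smooth_real {t \<in> ?K. ?\<gamma> t \<in> U} (\<lambda>t. \<phi> (?\<gamma> t) i)"
      proof (rule smooth_real_line[where f = "\<lambda>y. \<phi> (chart_inv c y) i" and \<gamma> = lin, OF oW _ oJ' _ linc lin_aff])
        show "smooth_coord n ?W (\<lambda>y. \<phi> (chart_inv c y) i)"
          using transition_smooth[OF c d i] by (simp add: Ud)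
        fix t assume t: "t \<in> {t \<in> ?K. ?\<gamma> t \<in> U}"
        then have "lin t \<in> img c" using linI by blast
        then have "lin t = snd c (?\<gamma> t)" "?\<gamma> t \<in> fst c \<inter> U"
          using t chart_chart_inv[OF c] chart_inv_in[OF c] by auto
        then show "lin t \<in> ?W" by (metis imageI)
      qed
    qed
  qed
  have "speed ?\<gamma> t \<le> 1 / (s - r)" if "t \<in> {r<..<s}" for t
  proof -
    have t: "t \<in> ?K" using that \<eta> by auto
    have gc: "?\<gamma> t \<in> fst c" by (rule chart_inv_in[OF c linI[OF t]])
    have v: "coord_velocity ?\<gamma> c i t = (b i - a i) / (s - r)" if i: "i < n" for i
    proof -
      have "\<forall>\<^sub>F u in nhds t. u \<in> ?K" by (rule eventually_nhds_in_open[OF oK t])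
      then have "\<forall>\<^sub>F u in nhds t. snd c (?\<gamma> u) i = (a i - r / (s - r) * (b i - a i)) + u * ((b i - a i) / (s - r))"
        by (rule eventually_mono) (use chart_chart_inv[OF c linI] lin_aff[OF i] in simp)
      then have "coord_velocity ?\<gamma> c i t = deriv (\<lambda>u. (a i - r / (s - r) * (b i - a i)) + u * ((b i - a i) / (s - r))) t"
        unfolding coord_velocity_def[OF oK sm] by (rule deriv_cong_ev) simp
      also have "\<dots> = (b i - a i) / (s - r)"
      proof (rule DERIV_imp_deriv)
        have "((\<lambda>u. A + u * B) has_real_derivative B) (at t)" for A B :: real
          by (auto intro!: derivative_eq_intros)
        then show "((\<lambda>u. (a i - r / (s - r) * (b i - a i)) + u * ((b i - a i) / (s - r))) has_real_derivative
            (b i - a i) / (s - r)) (at t)" .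
      qed
      finally show ?thesis .
    qed
    have y: "snd c (?\<gamma> t) \<in> coord_ball n x e"
      using chart_chart_inv[OF c linI[OF t]] KJ[OF t] by (simp add: J_def)
    have ba: "\<bar>b j - a j\<bar> \<le> 2 * e" if "j < n" for j
    proof -
      have "\<bar>a j - x j\<bar> < e" "\<bar>b j - x j\<bar> < e" using ab that by (auto simp: coord_ball_def)
      then show ?thesis by linarith
    qed
    have "\<forall>v. (\<forall>j<n. \<bar>v j\<bar> \<le> 2 * e) \<longrightarrow>
        (\<Sum>i<n. \<Sum>j<n. metric_coeff M g c i j (snd c (?\<gamma> t)) * v i * v j) \<le> 1"
      using gd y unfolding unit_ball_def by blast
    from this[rule_format, of "\<lambda>j. b j - a j"]
    have le: "(\<Sum>i<n. \<Sum>j<n. metric_coeff M g c i j (snd c (?\<gamma> t)) * (b i - a i) * (b j - a j)) \<le> 1"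
      using ba by simp
    have "speed ?\<gamma> t = sqrt (\<Sum>i<n. \<Sum>j<n. metric_coeff M g c i j (snd c (?\<gamma> t)) * ((b i - a i) / (s - r)) * ((b j - a j) / (s - r)))"
      unfolding speed_chart[OF oK sm c t gc]
      by (intro arg_cong[of _ _ sqrt] sum.cong refl) (simp add: v)
    also have "\<dots> = sqrt ((\<Sum>i<n. \<Sum>j<n. metric_coeff M g c i j (snd c (?\<gamma> t)) * (b i - a i) * (b j - a j)) / (s - r)\<^sup>2)"
      by (simp add: sum_divide_distrib power2_eq_square mult_ac)
    also have "\<dots> \<le> sqrt (1 / (s - r)\<^sup>2)"
      by (intro real_sqrt_le_mono divide_right_mono le) simp
    also have "\<dots> = 1 / (s - r)" using rs by (simp add: real_sqrt_divide)
    finally show ?thesis .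
  qed
  then show thesis using that \<eta> sm by blast
qed

text \<open>Each step becomes a segment traversed in time \<open>1 / m\<close> with speed at most
  \<open>m\<close>, so the speed on the unit interval is at most \<open>m\<close> apart from the
  break points.\<close>

lemma chain_path:
  assumes m: "m > 0" and steps: "\<And>i. i < m \<Longrightarrow> (P i, P (Suc i)) \<in> near_step"
  shows "\<exists>\<gamma>. piecewise_smooth_path M \<gamma> \<and> \<gamma> 0 = P 0 \<and> \<gamma> 1 = P m \<and> path_length M g \<gamma> \<le> real m"
proof -
  define s where "s i = real i / real m" for i
  have s: "s i < s (Suc i)" "s (Suc i) - s i = 1 / real m" for i
    using m by (auto simp: s_def field_simps)
  have s_mono: "s i \<le> s j \<longleftrightarrow> i \<le> j" for i j using m by (simp add: s_def divide_le_cancel)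
  have s_inj: "s i = s j \<longleftrightarrow> i = j" for i j using m by (simp add: s_def)
  have s0: "s 0 = 0" and sm: "s m = 1" using m by (auto simp: s_def)
  have "\<exists>cc \<eta>. cc (s i) = P i \<and> cc (s (Suc i)) = P (Suc i) \<and> \<eta> > 0 \<and>
      smooth_curve M {s i - \<eta><..<s (Suc i) + \<eta>} cc \<and>
      (\<forall>t\<in>{s i<..<s (Suc i)}. speed cc t \<le> real m)" if i: "i < m" for i
  proof -
    obtain c x e where gd: "unit_ball c x e" and P: "P i \<in> fst c" "P (Suc i) \<in> fst c"
      "snd c (P i) \<in> coord_ball n x e" "snd c (P (Suc i)) \<in> coord_ball n x e"
      using steps[OF i] by (auto simp: near_step_def)
    have c: "c \<in> matlas M" using gd by (simp add: unit_ball_def)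
    define lin where "lin t = (\<lambda>j. if j < n then snd c (P i) j + (t - s i) / (s (Suc i) - s i) *
       (snd c (P (Suc i)) j - snd c (P i) j) else 0)" for t
    obtain \<eta> where \<eta>: "\<eta> > 0" "smooth_curve M {s i - \<eta><..<s (Suc i) + \<eta>} (\<lambda>t. chart_inv c (lin t))"
      "\<And>t. t \<in> {s i<..<s (Suc i)} \<Longrightarrow> speed (\<lambda>t. chart_inv c (lin t)) t \<le> 1 / (s (Suc i) - s i)"
      using segment_curve[OF gd P(3,4) s(1) lin_def] by blast
    have "lin (s i) = snd c (P i)" "lin (s (Suc i)) = snd c (P (Suc i))"
      using P(3,4) s(1)[of i] by (auto simp: lin_def coord_ball_def topspace_Euclidean_space)
    then have "chart_inv c (lin (s i)) = P i" "chart_inv c (lin (s (Suc i))) = P (Suc i)"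
      using chart_inv_chart[OF c] P by auto
    then show ?thesis using \<eta> m unfolding s(2) by (intro exI[of _ "\<lambda>t. chart_inv c (lin t)"] exI[of _ \<eta>]) auto
  qed
  then obtain cc \<eta> where cc: "\<And>i. i < m \<Longrightarrow> cc i (s i) = P i" "\<And>i. i < m \<Longrightarrow> cc i (s (Suc i)) = P (Suc i)"
      "\<And>i. i < m \<Longrightarrow> \<eta> i > (0::real)"
      "\<And>i. i < m \<Longrightarrow> smooth_curve M {s i - \<eta> i<..<s (Suc i) + \<eta> i} (cc i)"
      "\<And>i t. i < m \<Longrightarrow> t \<in> {s i<..<s (Suc i)} \<Longrightarrow> speed (cc i) t \<le> real m" by metis
  \<comment> \<open>At a common end point the earlier piece is taken; the later one has the same
    value there.\<close>
  define \<gamma> where "\<gamma> t = cc (LEAST i. t \<le> s (Suc i)) t" for t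
  have \<gamma>: "\<gamma> t = cc i t" if i: "i < m" and t: "t \<in> {s i..s (Suc i)}" for i t
  proof -
    define k where "k = (LEAST i. t \<le> s (Suc i))"
    have k: "t \<le> s (Suc k)" "k \<le> i" unfolding k_def using t by (auto intro: LeastI Least_le)
    show ?thesis
    proof (cases "k = i")
      case False
      then have "Suc k \<le> i" using k by simp
      then have "s (Suc k) \<le> s i" by (simp only: s_mono)
      then have "t = s i" "s (Suc k) = s i" using k t by auto
      then have ki: "Suc k = i" "t = s i" using s_inj by auto
      have "\<gamma> t = cc k t" by (simp only: \<gamma>_def k_def)
      also have "\<dots> = P i" using cc(2)[of k] ki i by auto
      finally show ?thesis using cc(1)[OF i] ki by simp
    qed (simp add: \<gamma>_def k_def)
  qed
  have cover: "\<exists>i<m. t \<in> {s i..s (Suc i)}" if t: "t \<in> {0..1}" for t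
  proof -
    define k where "k = (LEAST i. t \<le> s (Suc i))"
    have ex: "t \<le> s (Suc (m - 1))" using t m sm by simp
    have k: "t \<le> s (Suc k)" "k \<le> m - 1" unfolding k_def using ex by (auto intro: LeastI Least_le)
    have "s k \<le> t"
    proof (cases k)
      case 0 then show ?thesis using t s0 by simp
    next
      case (Suc l)
      then have "\<not> t \<le> s (Suc l)" unfolding k_def using not_less_Least[of l "\<lambda>i. t \<le> s (Suc i)"] by auto
      then show ?thesis using Suc by simp
    qed
    then show ?thesis using k m by (intro exI[of _ k]) auto
  qed
  have sub01: "{s i..s (Suc i)} \<subseteq> {0..1}" if "i < m" for i
    using s_mono[of 0 i] s_mono[of "Suc i" m] s0 sm that by auto
  have cont: "continuous_map (top_of_set {0..1}) (mtop M) \<gamma>"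
  proof (rule pasting_lemma_closed[where I = "{..<m}" and T = "\<lambda>i. {s i..s (Suc i)}" and f = cc])
    show "closedin (top_of_set {0..1}) {s i..s (Suc i)}" if "i \<in> {..<m}" for i
      using sub01 that by (intro closed_subset) auto
    show "continuous_map (subtopology (top_of_set {0..1}) {s i..s (Suc i)}) (mtop M) (cc i)"
      if "i \<in> {..<m}" for i
    proof -
      have "continuous_map (top_of_set {s i - \<eta> i<..<s (Suc i) + \<eta> i}) (mtop M) (cc i)"
        using cc(4)[of i] that unfolding smooth_curve_def by blast
      then have "continuous_map (top_of_set {s i..s (Suc i)}) (mtop M) (cc i)"
        by (rule continuous_map_from_subtopology_mono) (use cc(3)[of i] that in auto)
      moreover have "{0..1} \<inter> {s i..s (Suc i)} = {s i..s (Suc i)}" using sub01[of i] that by blast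
      ultimately show ?thesis unfolding subtopology_subtopology by (simp only:)
    qed
    show "cc i x = cc j x" if "i \<in> {..<m}" "j \<in> {..<m}"
      "x \<in> topspace (top_of_set {0..1}) \<inter> {s i..s (Suc i)} \<inter> {s j..s (Suc j)}" for i j x
      using \<gamma>[of i x] \<gamma>[of j x] that by simp
    show "\<exists>j. j \<in> {..<m} \<and> x \<in> {s j..s (Suc j)} \<and> \<gamma> x = cc j x" if "x \<in> topspace (top_of_set {0..1})" for x
      using cover[of x] \<gamma> that by auto
  qed simp
  have pw: "piecewise_smooth_path M \<gamma>"
    unfolding piecewise_smooth_path_def
  proof (intro conjI cont exI[of _ m] exI[of _ s] s0 sm allI impI)
    fix i assume i: "i < m"
    show "s i < s (Suc i)" by (rule s(1))
    show "\<exists>e>0. \<exists>c. smooth_curve M {s i - e<..<s (Suc i) + e} c \<and> (\<forall>t\<in>{s i..s (Suc i)}. \<gamma> t = c t)"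
      using cc(3,4)[OF i] \<gamma>[OF i] by blast
  qed
  have sp: "speed \<gamma> t \<le> real m" if t: "t \<in> {0..1} - s ` {..m}" for t
  proof -
    obtain i where i: "i < m" "t \<in> {s i..s (Suc i)}" using cover t by blast
    then have ti: "t \<in> {s i<..<s (Suc i)}" using t by (auto simp: less_le)
    have "\<forall>\<^sub>F u in nhds t. u \<in> {s i<..<s (Suc i)}" by (rule eventually_nhds_in_open) (use ti in auto)
    then have "\<forall>\<^sub>F u in nhds t. \<gamma> u = cc i u" by (rule eventually_mono) (use \<gamma>[OF i(1)] in auto)
    then have "velocity M \<gamma> t = velocity M (cc i) t" by (rule velocity_cong)
    then have "speed \<gamma> t = speed (cc i) t" using \<gamma>[OF i] by (simp add: speed_def)
    then show ?thesis using cc(5)[OF i(1) ti] by simp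
  qed
  have "path_length M g \<gamma> \<le> real m"
  proof (cases "speed \<gamma> integrable_on {0..1}")
    case True
    have neg: "negligible (s ` {..m})" by (intro negligible_finite) simp
    define h where "h t = (if t \<in> s ` {..m} then 0 else speed \<gamma> t)" for t
    have hi: "h integrable_on {0..1}"
      by (rule integrable_spike[OF True neg]) (simp add: h_def)
    have "integral {0..1} (speed \<gamma>) = integral {0..1} h"
      by (rule integral_spike[OF neg]) (simp add: h_def)
    also have "\<dots> \<le> integral {0..1} (\<lambda>t::real. real m)"
      by (rule integral_le[OF hi]) (use sp in \<open>auto simp: h_def\<close>)
    finally show ?thesis by (simp add: path_length_def speed_def[abs_def])
  next
    \<comment> \<open>A function that is not integrable has integral 0 by convention, so the bound
      holds in this case too.\<close>
    case False
    then have "integral {0..1} (speed \<gamma>) = 0" by (rule not_integrable_integral)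
    then show ?thesis by (simp add: path_length_def speed_def[abs_def])
  qed
  moreover have "\<gamma> 0 = P 0" using \<gamma>[of 0 0] cc(1)[of 0] m s0 s(1)[of 0] by auto
  moreover have "\<gamma> 1 = P m" using \<gamma>[of "m - 1" 1] cc(2)[of "m - 1"] m sm s(1)[of "m - 1"] by auto
  ultimately show ?thesis using pw by blast
qed

lemma near_step_open:
  assumes "p \<in> mcarrier M"
  obtains S where "openin (mtop M) S" "p \<in> S" "\<And>q r. q \<in> S \<Longrightarrow> r \<in> S \<Longrightarrow> (q, r) \<in> near_step"
proof -
  obtain c e where c: "p \<in> fst c" and gd: "unit_ball c (snd c p) e" using unit_ball_exists[OF assms] .
  have cM: "c \<in> matlas M" and e: "e > 0" using gd by (auto simp: unit_ball_def)
  let ?S = "{q \<in> fst c. snd c q \<in> coord_ball n (snd c p) e}"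
  have "snd c p \<in> coord_space n" using img_subset[OF cM] c by blast
  then have "p \<in> ?S" using c e centre_in_coord_ball by blast
  moreover have "openin (mtop M) ?S" by (rule open_chart_preimage[OF cM openin_coord_ball])
  moreover have "(q, r) \<in> near_step" if "q \<in> ?S" "r \<in> ?S" for q r
    using that gd unfolding near_step_def by blast
  ultimately show thesis using that by blast
qed

lemma near_step_carrier: "(p, q) \<in> near_step \<Longrightarrow> q \<in> mcarrier M"
  using chart_dom_subset by (fastforce simp: near_step_def unit_ball_def)

text \<open>The points reachable from \<open>p0\<close> form an open set with open complement, hence
  everything by connectedness. The reachable sets increase with the number of steps, so by
  compactness a fixed number suffices; going back to \<open>p0\<close> and on to the second point
  doubles it.\<close>

lemma uniform_chains:
  assumes comp: "compact_space (mtop M)" and conn: "connected_space (mtop M)"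
  obtains N where "N > 0" "\<And>p q. p \<in> mcarrier M \<Longrightarrow> q \<in> mcarrier M \<Longrightarrow> (p, q) \<in> near_step ^^ N"
proof (cases "mcarrier M = {}")
  case True
  then show thesis using that[of 1] by simp
next
  case False
  then obtain p0 where p0: "p0 \<in> mcarrier M" by blast
  \<comment> \<open>At least one step is made, since the set reached in 0 steps is the single point
    \<open>p0\<close>, which need not be open.\<close>
  define U where "U m = {q. (p0, q) \<in> near_step ^^ Suc m}" for m
  have Usub: "U m \<subseteq> mcarrier M" for m
    using near_step_carrier by (auto simp: U_def)
  have refl: "(q, q) \<in> near_step" if "q \<in> mcarrier M" for q
    using near_step_open[OF that] by metis
  have sym: "sym near_step" by (auto simp: sym_def near_step_def)
  have Uo: "openin (mtop M) (U m)" for m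
  proof (subst openin_subopen, intro ballI)
    fix q assume q: "q \<in> U m"
    then obtain z where z: "(p0, z) \<in> near_step ^^ m" "(z, q) \<in> near_step" by (auto simp: U_def)
    then obtain c x e where gd: "unit_ball c x e" "z \<in> fst c" "q \<in> fst c"
      "snd c z \<in> coord_ball n x e" "snd c q \<in> coord_ball n x e" by (auto simp: near_step_def)
    let ?S = "{r \<in> fst c. snd c r \<in> coord_ball n x e}"
    have "openin (mtop M) ?S" by (rule open_chart_preimage[OF _ openin_coord_ball]) (use gd in \<open>simp add: unit_ball_def\<close>)
    moreover have "?S \<subseteq> U m"
    proof
      fix r assume "r \<in> ?S"
      then have "(z, r) \<in> near_step" using gd unfolding near_step_def by blast
      with z(1) have "(p0, r) \<in> near_step ^^ Suc m" by (rule relpow_Suc_I)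
      then show "r \<in> U m" by (simp only: U_def mem_Collect_eq)
    qed
    ultimately show "\<exists>T. openin (mtop M) T \<and> q \<in> T \<and> T \<subseteq> U m" using gd by blast
  qed
  have Umono: "U m \<subseteq> U (Suc m)" for m
    using Usub refl by (fastforce simp: U_def)
  then have Umono': "U m \<subseteq> U k" if "m \<le> k" for m k
    using that by (rule lift_Suc_mono_le)
  let ?V = "\<Union>m. U m"
  have "openin (mtop M) ?V" using Uo by blast
  moreover have "closedin (mtop M) ?V"
    unfolding closedin_def
  proof (intro conjI)
    show "?V \<subseteq> mcarrier M" using Usub by blast
    show "openin (mtop M) (mcarrier M - ?V)"
    proof (subst openin_subopen, intro ballI)
      fix q assume q: "q \<in> mcarrier M - ?V"
      then obtain S where S: "openin (mtop M) S" "q \<in> S" "\<And>q r. q \<in> S \<Longrightarrow> r \<in> S \<Longrightarrow> (q, r) \<in> near_step"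
        using near_step_open[of q] by blast
      have "r \<notin> U m" if "r \<in> S" for r m
      proof
        assume "r \<in> U m"
        then have "(p0, r) \<in> near_step ^^ Suc m" by (simp only: U_def mem_Collect_eq)
        then have "(p0, q) \<in> near_step ^^ Suc (Suc m)"
          using S(3)[OF that S(2)] by (rule relpow_Suc_I)
        then have "q \<in> U (Suc m)" by (simp only: U_def mem_Collect_eq)
        then show False using q by blast
      qed
      then have "S \<subseteq> mcarrier M - ?V" using openin_subset[OF S(1)] by blast
      then show "\<exists>T. openin (mtop M) T \<and> q \<in> T \<and> T \<subseteq> mcarrier M - ?V" using S by blast
    qed
  qed
  moreover have "p0 \<in> ?V" using refl[OF p0] by (auto simp: U_def intro!: exI[of _ 0])
  ultimately have V: "?V = mcarrier M"
    using conn unfolding connected_space_clopen_in by blast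
  then obtain \<F> where F: "finite \<F>" "\<F> \<subseteq> range U" "mcarrier M \<subseteq> \<Union>\<F>"
    using comp Uo unfolding compact_space_alt by (metis (no_types, lifting) imageE order_refl)
  obtain I where I: "finite I" "\<F> = U ` I" using finite_subset_image[OF F(1,2)] by blast
  obtain k where k: "\<And>i. i \<in> I \<Longrightarrow> i \<le> k" using I(1) by (meson finite_nat_set_iff_bounded_le)
  have Uk: "(p0, q) \<in> near_step ^^ Suc k" if "q \<in> mcarrier M" for q
  proof -
    have "q \<in> U k" using that F(3) I(2) k Umono' by blast
    then show ?thesis by (simp only: U_def mem_Collect_eq)
  qed
  have symp: "(p, q) \<in> near_step ^^ l \<Longrightarrow> (q, p) \<in> near_step ^^ l" for p q l
  proof (induction l arbitrary: q)
    case (Suc l)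
    then obtain z where "(p, z) \<in> near_step ^^ l" "(z, q) \<in> near_step" by auto
    then have "(q, z) \<in> near_step" "(z, p) \<in> near_step ^^ l" using Suc.IH sym by (auto dest: symD)
    then show ?case by (rule relpow_Suc_I2)
  qed simp
  show thesis
  proof (rule that[of "Suc k + Suc k"])
    fix p q assume pq: "p \<in> mcarrier M" "q \<in> mcarrier M"
    show "(p, q) \<in> near_step ^^ (Suc k + Suc k)"
      unfolding relpow_add using symp[OF Uk[OF pq(1)]] Uk[OF pq(2)] by (rule relcompI)
  qed simp
qed

text \<open>The length bound for the constant function 0 with \<open>\<mu> = 1\<close>. A direct
  argument from the integrand would have to treat the break points, where the velocity may fail to
  be a tangent vector.\<close>

lemma path_length_nonneg:
  assumes "piecewise_smooth_path M \<gamma>"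
  shows "path_length M g \<gamma> \<ge> 0"
proof -
  have sm: "smooth_function M (\<lambda>q. 0)" by (intro smooth_functionI smooth_near_const)
  have "ginn (\<lambda>q. 0) (\<lambda>q. 0) p \<le> 1\<^sup>2" if p: "p \<in> mcarrier M" for p
  proof -
    have s: "smooth_near M p (\<lambda>q. 0)" by (rule smooth_near_const[OF p])
    show ?thesis unfolding ginn_apply[OF s s] using tv_const[OF gradient_tangent[OF s] p] by simp
  qed
  then show ?thesis using path_length_bound[OF assms sm, of 1] by simp
qed

text \<open>\<open>Inf\<close> and \<open>Sup\<close> are related to the elements of a set only if
  it is nonempty and bounded on the proper side. Non-negative lengths bound the infima from below;
  the uniform chains join all points by paths of length at most \<open>N\<close>, which bounds the
  leaf distances from above.\<close>

lemma leaf_space_diameter_ge: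
  assumes comp: "compact_space (mtop M)" and conn: "connected_space (mtop M)"
    and F: "\<And>L. L \<in> \<F> \<Longrightarrow> mcarrier L \<subseteq> mcarrier M \<and> mcarrier L \<noteq> {}"
    and L: "L \<in> \<F>" "L' \<in> \<F>"
    and len: "\<And>\<gamma>. piecewise_smooth_path M \<gamma> \<Longrightarrow> \<gamma> 0 \<in> mcarrier L \<Longrightarrow> \<gamma> 1 \<in> mcarrier L' \<Longrightarrow> r \<le> path_length M g \<gamma>"
  shows "r \<le> leaf_space_diameter M g \<F>"
proof -
  obtain N where N: "N > 0" "\<And>p q. p \<in> mcarrier M \<Longrightarrow> q \<in> mcarrier M \<Longrightarrow> (p, q) \<in> near_step ^^ N"
    using uniform_chains[OF comp conn] by blast
  let ?D = "\<lambda>p q. {path_length M g \<gamma> | \<gamma>. piecewise_smooth_path M \<gamma> \<and> \<gamma> 0 = p \<and> \<gamma> 1 = q}"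
  have path: "\<exists>l\<in>?D p q. l \<le> real N" if pq: "p \<in> mcarrier M" "q \<in> mcarrier M" for p q
  proof -
    obtain P where "P 0 = p" "P N = q" "\<forall>i<N. (P i, P (Suc i)) \<in> near_step"
      using N(2)[OF pq] unfolding relpow_fun_conv by blast
    then show ?thesis using chain_path[OF N(1), of P] by blast
  qed
  have bdd: "bdd_below (?D p q)" for p q
    using path_length_nonneg by (intro bdd_belowI[of _ 0]) auto
  have r0: "0 \<le> rdist M g p q" if "p \<in> mcarrier M" "q \<in> mcarrier M" for p q
    unfolding rdist_def by (rule cInf_greatest) (use path[OF that] path_length_nonneg in auto)
  have rN: "rdist M g p q \<le> real N" if pq: "p \<in> mcarrier M" "q \<in> mcarrier M" for p q
  proof -
    obtain l where "l \<in> ?D p q" "l \<le> real N" using path[OF pq] by blast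
    then show ?thesis unfolding rdist_def using cInf_lower[OF _ bdd[of p q]] by fastforce
  qed
  have dN: "leaf_dist M g K K' \<le> real N" if K: "K \<in> \<F>" "K' \<in> \<F>" for K K'
  proof -
    obtain p q where pq: "p \<in> mcarrier K" "q \<in> mcarrier K'" using F K by blast
    then have "rdist M g p q \<in> {rdist M g p q | p q. p \<in> mcarrier K \<and> q \<in> mcarrier K'}" by blast
    moreover have "bdd_below {rdist M g p q | p q. p \<in> mcarrier K \<and> q \<in> mcarrier K'}"
      by (intro bdd_belowI[of _ 0]) (use r0 F K in blast)
    ultimately have "leaf_dist M g K K' \<le> rdist M g p q" unfolding leaf_dist_def by (rule cInf_lower)
    also have "\<dots> \<le> real N" by (rule rN) (use pq F K in auto)
    finally show ?thesis .
  qed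
  have "r \<le> rdist M g p q" if pq: "p \<in> mcarrier L" "q \<in> mcarrier L'" for p q
    unfolding rdist_def
  proof (rule cInf_greatest)
    show "?D p q \<noteq> {}" using path[of p q] pq F L by blast
    show "\<And>x. x \<in> ?D p q \<Longrightarrow> r \<le> x" using len pq by auto
  qed
  then have "r \<le> leaf_dist M g L L'"
    unfolding leaf_dist_def by (intro cInf_greatest) (use F[OF L(1)] F[OF L(2)] in \<open>blast+\<close>)
  also have "\<dots> \<le> leaf_space_diameter M g \<F>"
    unfolding leaf_space_diameter_def
  proof (rule cSup_upper)
    show "bdd_above {leaf_dist M g L L' | L L'. L \<in> \<F> \<and> L' \<in> \<F>}"
      using dN by (intro bdd_aboveI[of _ "real N"]) auto
  qed (use L in blast)
  finally show ?thesis .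
qed

end

section \<open>The one-dimensional comparison function\<close>

text \<open>The function \<open>w(t) = profile \<beta> (\<mu> t)\<close> solves \<open>w'' - 2 \<beta> \<mu> w' + \<mu>\<^sup>2 (1 + \<beta>\<^sup>2) w = 0\<close> with Neumann
  boundary values; the drift parameter \<open>\<beta>\<close> adjusts the ratio of maximum and minimum.\<close>

definition profile :: "real \<Rightarrow> real \<Rightarrow> real" where
  "profile \<beta> s = exp (\<beta> * s) * (\<beta> * sin s - cos s)"

definition profile1 :: "real \<Rightarrow> real \<Rightarrow> real" where
  "profile1 \<beta> s = (1 + \<beta>\<^sup>2) * (exp (\<beta> * s) * sin s)"

definition profile2 :: "real \<Rightarrow> real \<Rightarrow> real" where
  "profile2 \<beta> s = (1 + \<beta>\<^sup>2) * (exp (\<beta> * s) * (\<beta> * sin s + cos s))"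

lemma DERIV_profile: "(profile \<beta> has_real_derivative profile1 \<beta> s) (at s)"
proof -
  have "(profile \<beta> has_real_derivative
      exp (\<beta> * s) * \<beta> * (\<beta> * sin s - cos s) + (\<beta> * cos s + sin s) * exp (\<beta> * s)) (at s)"
    unfolding profile_def[abs_def] by (auto intro!: derivative_eq_intros)
  moreover have "exp (\<beta> * s) * \<beta> * (\<beta> * sin s - cos s) + (\<beta> * cos s + sin s) * exp (\<beta> * s) = profile1 \<beta> s"
    by (simp add: profile1_def power2_eq_square algebra_simps)
  ultimately show ?thesis by (simp only:)
qed

lemma DERIV_profile1: "(profile1 \<beta> has_real_derivative profile2 \<beta> s) (at s)"
proof -
  have "(profile1 \<beta> has_real_derivative
      (1 + \<beta>\<^sup>2) * (exp (\<beta> * s) * \<beta> * sin s + cos s * exp (\<beta> * s))) (at s)"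
    unfolding profile1_def[abs_def] by (auto intro!: derivative_eq_intros)
  moreover have "(1 + \<beta>\<^sup>2) * (exp (\<beta> * s) * \<beta> * sin s + cos s * exp (\<beta> * s)) = profile2 \<beta> s"
    by (simp add: profile2_def algebra_simps)
  ultimately show ?thesis by (simp only:)
qed

lemma profile_0: "profile \<beta> 0 = -1" and profile_pi: "profile \<beta> pi = exp (\<beta> * pi)"
  by (simp_all add: profile_def)

lemma profile1_pos: "s \<in> {0<..<pi} \<Longrightarrow> profile1 \<beta> s > 0"
  unfolding profile1_def by (intro mult_pos_pos) (auto simp: sin_gt_zero add_pos_nonneg)

lemma isCont_profile: "isCont (profile \<beta>) s"
  by (rule DERIV_isCont[OF DERIV_profile])

lemma profile_strict_mono:
  assumes "0 \<le> s" "s < t" "t \<le> pi"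
  shows "profile \<beta> s < profile \<beta> t"
proof (rule DERIV_pos_imp_increasing_open[OF assms(2)])
  fix x assume "s < x" "x < t"
  then show "\<exists>y. (profile \<beta> has_real_derivative y) (at x) \<and> 0 < y"
    using DERIV_profile profile1_pos[of x \<beta>] assms by (intro exI[of _ "profile1 \<beta> x"]) auto
qed (auto intro: continuous_at_imp_continuous_on isCont_profile)

text \<open>The end points 0 and \<pi> are excluded because \<open>profile1\<close> vanishes there
  and the inverse has no derivative.\<close>

definition profile_inv :: "real \<Rightarrow> real \<Rightarrow> real" where
  "profile_inv \<beta> y = (THE s. s \<in> {0<..<pi} \<and> profile \<beta> s = y)"

lemma profile_inv_profile:
  assumes "s \<in> {0<..<pi}"
  shows "profile_inv \<beta> (profile \<beta> s) = s"
  unfolding profile_inv_def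
proof (rule the_equality)
  fix t assume t: "t \<in> {0<..<pi} \<and> profile \<beta> t = profile \<beta> s"
  then show "t = s"
    using profile_strict_mono[of s t \<beta>] profile_strict_mono[of t s \<beta>] assms
    by (cases "s < t"; cases "t < s") auto
qed (use assms in auto)

lemma profile_inv:
  assumes y: "y \<in> {-1<..<exp (\<beta> * pi)}"
  shows "profile_inv \<beta> y \<in> {0<..<pi}" "profile \<beta> (profile_inv \<beta> y) = y"
proof -
  obtain s where s: "0 \<le> s" "s \<le> pi" "profile \<beta> s = y"
    using IVT'[of "profile \<beta>" 0 y pi] y profile_0 profile_pi
    by (auto intro: continuous_at_imp_continuous_on isCont_profile)
  moreover have "s \<noteq> 0" "s \<noteq> pi" using s(3) y profile_0[of \<beta>] profile_pi[of \<beta>] by auto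
  ultimately have "s \<in> {0<..<pi}" by auto
  then have "profile_inv \<beta> y = s" using profile_inv_profile s(3) by blast
  then show "profile_inv \<beta> y \<in> {0<..<pi}" "profile \<beta> (profile_inv \<beta> y) = y"
    using s(3) \<open>s \<in> {0<..<pi}\<close> by auto
qed

lemma DERIV_profile_inv:
  assumes y: "y \<in> {-1<..<exp (\<beta> * pi)}"
  shows "(profile_inv \<beta> has_real_derivative inverse (profile1 \<beta> (profile_inv \<beta> y))) (at y)"
proof (rule DERIV_inverse_function[where f = "profile \<beta>" and a = "-1" and b = "exp (\<beta> * pi)"])
  let ?s = "profile_inv \<beta> y"
  have s: "?s \<in> {0<..<pi}" by (rule profile_inv(1)[OF y])
  show "(profile \<beta> has_real_derivative profile1 \<beta> ?s) (at ?s)" by (rule DERIV_profile)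
  show "profile1 \<beta> ?s \<noteq> 0" using profile1_pos[OF s, of \<beta>] by simp
  show "-1 < y" "y < exp (\<beta> * pi)" using y by auto
  show "profile \<beta> (profile_inv \<beta> z) = z" if "-1 < z" "z < exp (\<beta> * pi)" for z
    using profile_inv(2)[of z \<beta>] that by simp
  have "isCont (profile_inv \<beta>) (profile \<beta> ?s)"
  proof (rule isCont_inverse_function2[where f = "profile \<beta>" and a = "?s / 2" and b = "(?s + pi) / 2"])
    fix z assume z: "?s / 2 \<le> z" "z \<le> (?s + pi) / 2"
    have "0 < z" "z < pi" using z s by auto
    then show "profile_inv \<beta> (profile \<beta> z) = z" by (intro profile_inv_profile) simp
  qed (use s in \<open>auto simp: isCont_profile\<close>)
  then show "isCont (profile_inv \<beta>) y" using profile_inv(2)[OF y] by simp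
qed

text \<open>The derivative of the inverse is the reciprocal of \<open>profile1\<close> at the
  inverse itself. So if the composite is of class \<open>k\<close>, its partial derivatives are too,
  and it is of class \<open>Suc k\<close>.\<close>

lemma smooth_coord_profile_inv:
  assumes W: "openin (Euclidean_space n) W" and u: "smooth_coord n W u"
    and rng: "\<And>x. x \<in> W \<Longrightarrow> u x \<in> {-1<..<exp (\<beta> * pi)}"
  shows "smooth_coord n W (\<lambda>x. profile_inv \<beta> (u x))"
  unfolding smooth_coord_iff[OF W]
proof
  fix k
  have cont: "continuous_on W (\<lambda>x. profile_inv \<beta> (u x))"
  proof (rule continuous_on_compose2[of "{-1<..<exp (\<beta> * pi)}" "profile_inv \<beta>" W u])
    show "continuous_on {-1<..<exp (\<beta> * pi)} (profile_inv \<beta>)"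
      by (intro continuous_at_imp_continuous_on ballI DERIV_isCont[OF DERIV_profile_inv])
    show "continuous_on W u" by (rule smooth_coord_continuous[OF W u])
  qed (use rng in auto)
  show "Ck_coord n W k (\<lambda>x. profile_inv \<beta> (u x))"
  proof (induction k)
    case 0
    show ?case using cont by simp
  next
    case (Suc k)
    let ?\<theta> = "\<lambda>x. profile_inv \<beta> (u x)"
    have D: "((\<lambda>t. ?\<theta> (x(i := t))) has_real_derivative inverse (profile1 \<beta> (?\<theta> x)) * pd i u x) (at (x i))"
      if "i < n" "x \<in> W" for i x
    proof -
      have "(profile_inv \<beta> has_real_derivative inverse (profile1 \<beta> (?\<theta> x))) (at (u (x(i := x i))))"
        using DERIV_profile_inv[OF rng[OF that(2)]] by simp
      from DERIV_chain2[OF this smooth_coord_has_pd[OF W u that]] show ?thesis .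
    qed
    have E: "Ck_coord n W k (\<lambda>x. (\<lambda>m s. \<beta> ^ m * exp (\<beta> * s)) 0 (?\<theta> x))"
    proof (rule Ck_real_compose[OF W, where J = UNIV and S = "\<lambda>m s. \<beta> ^ m * exp (\<beta> * s)"])
      show "((\<lambda>s. \<beta> ^ m * exp (\<beta> * s)) has_real_derivative \<beta> ^ Suc m * exp (\<beta> * s)) (at s)" for m s
        by (auto intro!: derivative_eq_intros)
    qed (use Suc in auto)
    \<comment> \<open>Shifts by \<open>pi / 2\<close> list the successive derivatives of the
      sine.\<close>
    have S: "Ck_coord n W k (\<lambda>x. (\<lambda>m s. sin (s + real m * (pi / 2))) 0 (?\<theta> x))"
    proof (rule Ck_real_compose[OF W, where J = UNIV and S = "\<lambda>m s. sin (s + real m * (pi / 2))"])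
      fix m s
      have "((\<lambda>s. sin (s + real m * (pi / 2))) has_real_derivative cos (s + real m * (pi / 2))) (at s)"
        by (auto intro!: derivative_eq_intros)
      moreover have "s + real (Suc m) * (pi / 2) = (s + real m * (pi / 2)) + pi / 2"
        by (simp add: algebra_simps)
      then have "sin (s + real (Suc m) * (pi / 2)) = cos (s + real m * (pi / 2))"
        by (simp only: sin_add sin_pi_half cos_pi_half)
      ultimately show "((\<lambda>s. sin (s + real m * (pi / 2))) has_real_derivative
          sin (s + real (Suc m) * (pi / 2))) (at s)" by (simp only:)
    qed (use Suc in auto)
    have P: "Ck_coord n W k (\<lambda>x. profile1 \<beta> (?\<theta> x))"
      using Ck_mult[OF W Ck_const[OF W, of k "1 + \<beta>\<^sup>2"] Ck_mult[OF W E S]] by (simp add: profile1_def)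
    have nz: "profile1 \<beta> (?\<theta> x) \<noteq> 0" if "x \<in> W" for x
      using profile1_pos[OF profile_inv(1)[OF rng[OF that]], of \<beta>] by simp
    show ?case
    proof (rule Ck_SucI[OF W cont D])
      fix i assume i: "i < n"
      have "Ck_coord n W k (pd i u)" using smooth_coord_pd[OF u i] smooth_coord_iff[OF W] by blast
      then show "Ck_coord n W k (\<lambda>x. inverse (profile1 \<beta> (?\<theta> x)) * pd i u x)"
        by (intro Ck_mult[OF W] Ck_inverse[OF W nz P])
    qed
  qed
qed

section \<open>The gradient estimate\<close>

lemma (in manifold) smooth_function_continuous:
  assumes f: "smooth_function M f"
  shows "continuous_map (mtop M) euclideanreal f"
  unfolding continuous_map_def
proof (intro conjI allI impI)
  fix S assume "openin euclideanreal S"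
  then have S: "open S" by simp
  show "openin (mtop M) {x \<in> mcarrier M. f x \<in> S}"
  proof (subst openin_subopen, intro ballI)
    fix p assume p: "p \<in> {x \<in> mcarrier M. f x \<in> S}"
    then obtain c where c: "c \<in> matlas M" "p \<in> fst c" using chart_exists by blast
    let ?V = "{y \<in> img c. loc c f y \<in> S}"
    have "openin (Euclidean_space n) ?V"
      by (rule openin_preimage_coord[OF chart_props(2)[OF c(1)]
            smooth_coord_continuous[OF chart_props(2)[OF c(1)] smooth_function_loc[OF f c(1)]] S])
    then have "openin (mtop M) {q \<in> fst c. snd c q \<in> ?V}" by (rule open_chart_preimage[OF c(1)])
    moreover have "p \<in> {q \<in> fst c. snd c q \<in> ?V}" using c p chart_inv_chart[OF c] by auto
    moreover have "{q \<in> fst c. snd c q \<in> ?V} \<subseteq> {x \<in> mcarrier M. f x \<in> S}"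
    proof
      fix q assume "q \<in> {q \<in> fst c. snd c q \<in> ?V}"
      then show "q \<in> {x \<in> mcarrier M. f x \<in> S}"
        using chart_inv_chart[OF c(1), of q] chart_dom_subset[OF c(1)] by auto
    qed
    ultimately show "\<exists>T. openin (mtop M) T \<and> p \<in> T \<and> T \<subseteq> {x \<in> mcarrier M. f x \<in> S}" by blast
  qed
qed simp

lemma (in manifold) smooth_function_attains_max:
  assumes "compact_space (mtop M)" "mcarrier M \<noteq> {}" and f: "smooth_function M f"
  obtains p where "p \<in> mcarrier M" "\<And>q. q \<in> mcarrier M \<Longrightarrow> f q \<le> f p"
proof -
  have "compactin euclideanreal (f ` mcarrier M)"
    using image_compactin[OF _ smooth_function_continuous[OF f]] assms(1) unfolding compact_space_def by blast
  then have "compact (f ` mcarrier M)" by (simp add: compactin_euclidean_iff)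
  then obtain y where "y \<in> f ` mcarrier M" "\<forall>z\<in>f ` mcarrier M. z \<le> y"
    using compact_attains_sup[of "f ` mcarrier M"] assms(2) by blast
  then show thesis using that by auto
qed

context coord_metric
begin

lemma lap_cong:
  assumes "\<And>y. y \<in> W \<Longrightarrow> f y = h y" "x \<in> W"
  shows "lap f x = lap h x"
proof (rule dvg_cong[OF _ assms(2)])
  show "grd f k y = grd h k y" if "k < n" "y \<in> W" for k y
    unfolding grd_def by (intro sum.cong refl arg_cong2[of _ _ _ _ "(*)"] pd_cong[OF openW that(2)]) (use assms in auto)
qed

end

context riemannian
begin

lemma laplacian_at_max:
  assumes f: "smooth_function M f" and p: "p \<in> mcarrier M" and mx: "\<And>q. q \<in> mcarrier M \<Longrightarrow> f q \<le> f p"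
  shows "laplacian M g f p \<le> 0"
proof -
  obtain c where c: "c \<in> matlas M" "p \<in> fst c" using chart_exists[OF p] by blast
  interpret C: coord_metric n "img c" "metric_coeff M g c"
    by (rule coord_metric_chart[OF c(1) chart_props(2)[OF c(1)]]) simp
  have "C.lap (loc c f) (snd c p) \<le> 0"
  proof (rule C.lap_local_max(1)[OF smooth_function_loc[OF f c(1)]])
    show "loc c f y \<le> loc c f (snd c p)" if "y \<in> img c" for y
      using mx[of "chart_inv c y"] chart_inv_in[OF c(1) that] chart_dom_subset[OF c(1)] chart_inv_chart[OF c] by auto
  qed (use c in auto)
  then show ?thesis using laplacian_chart[OF smooth_function_near[OF f p] c] by simp
qed

lemma laplacian_at_min:
  assumes f: "smooth_function M f" and p: "p \<in> mcarrier M" and mn: "\<And>q. q \<in> mcarrier M \<Longrightarrow> f p \<le> f q"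
  shows "laplacian M g f p \<ge> 0"
proof -
  obtain c where c: "c \<in> matlas M" "p \<in> fst c" using chart_exists[OF p] by blast
  interpret C: coord_metric n "img c" "metric_coeff M g c"
    by (rule coord_metric_chart[OF c(1) chart_props(2)[OF c(1)]]) simp
  note sf = smooth_function_loc[OF f c(1)]
  have x: "snd c p \<in> img c" using c by blast
  have "C.lap (\<lambda>y. - loc c f y) (snd c p) \<le> 0"
  proof (rule C.lap_local_max(1)[OF smooth_coord_uminus[OF chart_props(2)[OF c(1)] sf] x])
    show "- loc c f y \<le> - loc c f (snd c p)" if "y \<in> img c" for y
      using mn[of "chart_inv c y"] chart_inv_in[OF c(1) that] chart_dom_subset[OF c(1)] chart_inv_chart[OF c] by auto
  qed
  moreover have "C.lap (\<lambda>y. - loc c f y) (snd c p) = (-1) * C.lap (loc c f) (snd c p) + 0 * C.inn (loc c f) (loc c f) (snd c p)"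
    by (rule C.lap_compose[where S = "\<lambda>s. - s" and S' = "\<lambda>s. -1" and S'' = "\<lambda>s. 0" and J = UNIV, OF _ _ _ sf x])
      (auto intro!: derivative_eq_intros)
  ultimately show ?thesis using laplacian_chart[OF smooth_function_near[OF f p] c] by simp
qed

text \<open>A change of sign of \<open>u\<close> is absorbed in \<open>A\<close>, which may be
  negative.\<close>

lemma angle_gradient_estimate:
  assumes comp: "compact_space (mtop M)" and ric: "nonneg_ricci M g"
    and u: "smooth_function M u"
    and eig: "\<And>p. p \<in> mcarrier M \<Longrightarrow> laplacian M g u p = - (\<mu>\<^sup>2 * (1 + \<beta>\<^sup>2)) * u p"
    and A: "A \<noteq> 0" and rng: "\<And>p. p \<in> mcarrier M \<Longrightarrow> u p / A \<in> {-1<..<exp (\<beta> * pi)}"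
    and \<theta>_def: "\<theta> = (\<lambda>p. profile_inv \<beta> (u p / A))"
  shows "smooth_function M \<theta>" "\<And>p. p \<in> mcarrier M \<Longrightarrow> ginn \<theta> \<theta> p \<le> \<mu>\<^sup>2"
proof -
  have loc\<theta>: "smooth_coord n (img c) (loc c \<theta>)" if c: "c \<in> matlas M" for c
  proof -
    note I = chart_props(2)[OF c]
    have "smooth_coord n (img c) (\<lambda>y. loc c u y * (1 / A))"
      by (intro smooth_coord_mult[OF I] smooth_coord_const[OF I] smooth_function_loc[OF u c])
    then have "smooth_coord n (img c) (\<lambda>y. loc c u y / A)" by simp
    then show ?thesis
      unfolding \<theta>_def
      by (rule smooth_coord_profile_inv[OF I]) (use rng chart_inv_in[OF c] chart_dom_subset[OF c] in blast)
  qed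
  show sm\<theta>: "smooth_function M \<theta>"
  proof (rule smooth_functionI)
    fix p assume "p \<in> mcarrier M"
    then obtain c where c: "c \<in> matlas M" "p \<in> fst c" using chart_exists by blast
    show "smooth_near M p \<theta>"
      by (rule smooth_nearI[OF c chart_props(2)[OF c(1)] _ _ loc\<theta>[OF c(1)]]) (use c in auto)
  qed
  note near\<theta> = smooth_function_near[OF sm\<theta>]
  fix p0 assume p0: "p0 \<in> mcarrier M"
  have smP: "smooth_function M (ginn \<theta> \<theta>)"
    by (intro smooth_functionI smooth_near_ginn near\<theta>)
  obtain p where p: "p \<in> mcarrier M" "\<And>q. q \<in> mcarrier M \<Longrightarrow> ginn \<theta> \<theta> q \<le> ginn \<theta> \<theta> p"
    using smooth_function_attains_max[OF comp _ smP] p0 by blast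
  \<comment> \<open>\<open>ricci\<close> is evaluated in the chart selected at the point, so the
    maximum is studied in that very chart.\<close>
  define c where "c = chart_at M p"
  have c: "c \<in> matlas M" "p \<in> fst c" using chart_at[OF p(1)] by (auto simp: c_def)
  note I = chart_props(2)[OF c(1)]
  interpret C: coord_metric n "img c" "metric_coeff M g c"
    by (rule coord_metric_chart[OF c(1) I]) simp
  let ?x = "snd c p" and ?h = "loc c \<theta>"
  have x: "?x \<in> img c" using c by blast
  have h: "smooth_coord n (img c) ?h" by (rule loc\<theta>[OF c(1)])
  have inM: "chart_inv c y \<in> fst c" "chart_inv c y \<in> mcarrier M" "snd c (chart_inv c y) = y" if "y \<in> img c" for y
    using chart_inv_in[OF c(1) that] chart_dom_subset[OF c(1)] chart_chart_inv[OF c(1) that] by auto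
  have P: "C.inn ?h ?h y = ginn \<theta> \<theta> (chart_inv c y)" if y: "y \<in> img c" for y
    using ginn_chart[OF c(1) inM(1)[OF y] near\<theta>[OF inM(2)[OF y]] near\<theta>[OF inM(2)[OF y]]] inM(3)[OF y] by simp
  have Pmax: "C.inn ?h ?h y \<le> C.inn ?h ?h ?x" if y: "y \<in> img c" for y
    using p(2)[OF inM(2)[OF y]] P[OF y] P[OF x] chart_inv_chart[OF c] by simp
  have hJ: "?h y \<in> {0<..<pi}" "loc c u y = A * profile \<beta> (?h y)" if y: "y \<in> img c" for y
    using profile_inv[OF rng[OF inM(2)[OF y]]] A by (auto simp: \<theta>_def)
  \<comment> \<open>Insert u = A w(\<theta>) into the eigenvalue equation. The composition rule
    gives w'(\<theta>) times the Laplacian of \<theta> plus w''(\<theta>) times P, and the common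
    factor \<open>A * (1 + \<beta>\<^sup>2) * exp (\<beta> * ?s)\<close> cancels, leaving a linear
    equation for the Laplacian of \<theta>.\<close>
  have lap: "C.lap ?h y = - (\<beta> + cot (?h y)) * C.inn ?h ?h y - \<mu>\<^sup>2 * (\<beta> - cot (?h y))" if y: "y \<in> img c" for y
  proof -
    let ?s = "?h y"
    have sin: "sin ?s > 0" using hJ(1)[OF y] by (simp add: sin_gt_zero)
    have "C.lap (loc c u) y = C.lap (\<lambda>y. A * profile \<beta> (?h y)) y"
      by (rule C.lap_cong[OF hJ(2) y])
    also have "\<dots> = A * profile1 \<beta> ?s * C.lap ?h y + A * profile2 \<beta> ?s * C.inn ?h ?h y"
      by (rule C.lap_compose[where S = "\<lambda>s. A * profile \<beta> s" and S' = "\<lambda>s. A * profile1 \<beta> s"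
            and S'' = "\<lambda>s. A * profile2 \<beta> s" and J = "{0<..<pi}", OF _ _ hJ(1) h y])
        (auto intro!: DERIV_cmult DERIV_profile DERIV_profile1)
    finally have "A * profile1 \<beta> ?s * C.lap ?h y + A * profile2 \<beta> ?s * C.inn ?h ?h y =
        - (\<mu>\<^sup>2 * (1 + \<beta>\<^sup>2)) * (A * profile \<beta> ?s)"
      using eig[OF inM(2)[OF y]] laplacian_chart[OF smooth_function_near[OF u inM(2)[OF y]] c(1) inM(1)[OF y]]
        inM(3)[OF y] hJ(2)[OF y] by simp
    then have "(A * (1 + \<beta>\<^sup>2) * exp (\<beta> * ?s)) * (sin ?s * C.lap ?h y) =
       (A * (1 + \<beta>\<^sup>2) * exp (\<beta> * ?s)) * (- (\<beta> * sin ?s + cos ?s) * C.inn ?h ?h y - \<mu>\<^sup>2 * (\<beta> * sin ?s - cos ?s))"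
      by (simp add: profile_def profile1_def profile2_def algebra_simps)
    moreover have "A * (1 + \<beta>\<^sup>2) * exp (\<beta> * ?s) \<noteq> 0"
      using A by (simp add: add_nonneg_eq_0_iff)
    ultimately have "sin ?s * C.lap ?h y =
        - (\<beta> * sin ?s + cos ?s) * C.inn ?h ?h y - \<mu>\<^sup>2 * (\<beta> * sin ?s - cos ?s)"
      by (simp only: mult_cancel_left simp_thms)
    then have "C.lap ?h y = (- (\<beta> * sin ?s + cos ?s) * C.inn ?h ?h y - \<mu>\<^sup>2 * (\<beta> * sin ?s - cos ?s)) / sin ?s"
      using sin by (simp add: field_simps)
    also have "\<dots> = - (\<beta> + cot ?s) * C.inn ?h ?h y - \<mu>\<^sup>2 * (\<beta> - cot ?s)"
      using sin by (simp add: cot_def field_simps)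
    finally show ?thesis .
  qed
  have smI: "smooth_coord n (img c) (C.inn ?h ?h)" by (rule C.smooth_inn[OF h h])
  define P0 where "P0 = C.inn ?h ?h ?x"
  have sinx: "sin (?h ?x) > 0" using hJ(1)[OF x] by (simp add: sin_gt_zero)
  \<comment> \<open>The derivative of P vanishes at its maximum, so only the two occurrences of the
    cotangent contribute, with the coefficients \<open>- P0\<close> and
    \<open>\<mu>\<^sup>2\<close>.\<close>
  have pdlap: "pd j (C.lap ?h) ?x = (P0 - \<mu>\<^sup>2) * inverse ((sin (?h ?x))\<^sup>2) * pd j ?h ?x" if j: "j < n" for j
  proof -
    have "pd j (C.lap ?h) ?x = pd j (\<lambda>y. - (\<beta> + cot (?h y)) * C.inn ?h ?h y - \<mu>\<^sup>2 * (\<beta> - cot (?h y))) ?x"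
      by (rule pd_cong[OF I x j lap])
    also have "\<dots> = (P0 - \<mu>\<^sup>2) * inverse ((sin (?h ?x))\<^sup>2) * pd j ?h ?x"
    proof (rule pd_eqI)
      let ?l = "\<lambda>t. ?x(j := t)"
      have "pd j (C.inn ?h ?h) ?x = 0" by (rule C.lap_local_max(2)[OF smI x Pmax j])
      then have d1: "((\<lambda>t. C.inn ?h ?h (?l t)) has_real_derivative 0) (at (?x j))"
        using smooth_coord_has_pd[OF I smI j x] by (simp only:)
      have "(cot has_real_derivative - inverse ((sin (?h ?x))\<^sup>2)) (at (?h (?l (?x j))))"
        using sinx DERIV_cot[of "?h ?x"] by simp
      from DERIV_chain2[OF this smooth_coord_has_pd[OF I h j x]]
      have d2: "((\<lambda>t. cot (?h (?l t))) has_real_derivative - inverse ((sin (?h ?x))\<^sup>2) * pd j ?h ?x) (at (?x j))" .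
      let ?d = "inverse ((sin (?h ?x))\<^sup>2) * pd j ?h ?x"
      have x0: "?l (?x j) = ?x" by simp
      have "((\<lambda>t. - (\<beta> + cot (?h (?l t))) * C.inn ?h ?h (?l t) - \<mu>\<^sup>2 * (\<beta> - cot (?h (?l t))))
          has_real_derivative (- (0 + - inverse ((sin (?h ?x))\<^sup>2) * pd j ?h ?x) * C.inn ?h ?h (?l (?x j)) + 0 * - (\<beta> + cot (?h (?l (?x j)))))
            - \<mu>\<^sup>2 * (0 - - inverse ((sin (?h ?x))\<^sup>2) * pd j ?h ?x)) (at (?x j))"
        by (intro DERIV_diff DERIV_cmult DERIV_mult DERIV_minus DERIV_add DERIV_const d1 d2)
      moreover have "(- (0 + - inverse ((sin (?h ?x))\<^sup>2) * pd j ?h ?x) * C.inn ?h ?h (?l (?x j)) + 0 * - (\<beta> + cot (?h (?l (?x j)))))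
            - \<mu>\<^sup>2 * (0 - - inverse ((sin (?h ?x))\<^sup>2) * pd j ?h ?x) = (P0 - \<mu>\<^sup>2) * inverse ((sin (?h ?x))\<^sup>2) * pd j ?h ?x"
        unfolding x0 P0_def by (simp add: algebra_simps)
      ultimately show "((\<lambda>t. - (\<beta> + cot (?h (?l t))) * C.inn ?h ?h (?l t) - \<mu>\<^sup>2 * (\<beta> - cot (?h (?l t))))
          has_real_derivative (P0 - \<mu>\<^sup>2) * inverse ((sin (?h ?x))\<^sup>2) * pd j ?h ?x) (at (?x j))"
        by (simp only:)
    qed
    finally show ?thesis .
  qed
  have "(\<Sum>j<n. C.grd ?h j ?x * pd j (C.lap ?h) ?x) = (P0 - \<mu>\<^sup>2) * inverse ((sin (?h ?x))\<^sup>2) * P0"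
    unfolding P0_def C.inn_def sum_distrib_left
    by (intro sum.cong refl) (simp add: pdlap[unfolded P0_def C.inn_def] mult_ac)
  moreover have "(\<Sum>j<n. \<Sum>k<n. C.Ric j k ?x * C.grd ?h j ?x * C.grd ?h k ?x) \<ge> 0"
  proof -
    have v: "gradient M g \<theta> p \<in> tangent_space M p" by (rule gradient_tangent[OF near\<theta>[OF p(1)]])
    have "0 \<le> ricci M g p (gradient M g \<theta> p) (gradient M g \<theta> p)"
      using ric p(1) v unfolding nonneg_ricci_def by blast
    also have "\<dots> = (\<Sum>j<n. \<Sum>k<n. C.Ric j k ?x * C.grd ?h j ?x * C.grd ?h k ?x)"
      unfolding ricci_def Let_def c_def[symmetric] ricci_coeff_eq[OF c(1)]
      by (intro sum.cong refl) (simp add: vcomp_gradient[OF c near\<theta>[OF p(1)]])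
    finally show ?thesis .
  qed
  ultimately have "(P0 - \<mu>\<^sup>2) * inverse ((sin (?h ?x))\<^sup>2) * P0 \<le> 0"
    using C.bochner_max[OF h x Pmax] by simp
  \<comment> \<open>If \<open>P0\<close> exceeded \<open>\<mu>\<^sup>2\<close>, it would be
    positive, and so would the whole product.\<close>
  moreover have "P0 \<le> \<mu>\<^sup>2" if "\<not> (P0 - \<mu>\<^sup>2) * inverse ((sin (?h ?x))\<^sup>2) * P0 > 0"
  proof (rule ccontr)
    assume "\<not> P0 \<le> \<mu>\<^sup>2"
    then have "P0 - \<mu>\<^sup>2 > 0" "P0 > 0" using zero_le_power2[of \<mu>] by linarith+
    then show False using that sinx by (simp add: zero_less_mult_iff)
  qed
  ultimately have "P0 \<le> \<mu>\<^sup>2" by linarith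
  then show "ginn \<theta> \<theta> p0 \<le> \<mu>\<^sup>2"
    using p(2)[OF p0] P[OF x] chart_inv_chart[OF c] by (simp add: P0_def)
qed

text \<open>The sign \<open>\<sigma>\<close> is chosen such that the maximum \<open>K\<close> of \<open>\<sigma> u\<close> is at least minus its minimum
  \<open>k\<close>, and \<open>\<beta>\<close> such that the comparison function has the range \<open>[- k, K]\<close> of \<open>\<sigma> u\<close> up to a
  factor. The case \<open>k = 0\<close> does not occur, but rather than excluding it by the strong maximum
  principle, we use the range \<open>[- k0, K]\<close> for \<open>\<beta> = sqrt 3\<close>: then \<open>\<mu> = sqrt lam / 2\<close>, and the part
  of the path from \<open>\<pi> / 2\<close> to \<open>\<pi>\<close> suffices.\<close>

lemma nodal_path_length:
  assumes comp: "compact_space (mtop M)" and ric: "nonneg_ricci M g"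
    and u: "smooth_function M u"
    and eig: "\<And>p. p \<in> mcarrier M \<Longrightarrow> laplacian M g u p = - lam * u p" and lam: "lam > 0"
    and \<sigma>: "\<sigma> * \<sigma> = 1" and kK: "0 \<le> k" "k \<le> K" "K > 0"
    and rng: "\<And>p. p \<in> mcarrier M \<Longrightarrow> - k \<le> \<sigma> * u p \<and> \<sigma> * u p \<le> K"
    and \<gamma>: "piecewise_smooth_path M \<gamma>"
    and PQ: "P \<in> mcarrier M" "Q \<in> mcarrier M" "\<sigma> * u P = K" "\<sigma> * u Q = - k"
      "{\<gamma> 0, \<gamma> 1} = {P, Q}"
    and nonneg: "path_length M g \<gamma> \<ge> 0"
  shows "pi \<le> sqrt lam * path_length M g \<gamma>"
proof -
  \<comment> \<open>For \<open>k > 0\<close> this gives \<open>exp (\<beta> * pi) = K / k\<close>,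
    hence \<open>k0 = k\<close>; it is nonnegative because \<open>k \<le> K\<close>.\<close>
  define \<beta> where "\<beta> = (if k > 0 then ln (K / k) / pi else sqrt 3)"
  define k0 where "k0 = K / exp (\<beta> * pi)"
  define \<mu> where "\<mu> = sqrt (lam / (1 + \<beta>\<^sup>2))"
  have b1: "1 + \<beta>\<^sup>2 > 0" by (simp add: add_pos_nonneg)
  have \<mu>: "\<mu> \<ge> 0" "\<mu>\<^sup>2 * (1 + \<beta>\<^sup>2) = lam" using lam b1 by (auto simp: \<mu>_def)
  have \<beta>: "\<beta> \<ge> 0" using kK by (auto simp: \<beta>_def)
  have k0: "k0 > 0" "K / k0 = exp (\<beta> * pi)" using kK by (auto simp: k0_def)
  have kk0: "k \<le> k0" "k > 0 \<Longrightarrow> k = k0" using kK k0(1) by (auto simp: k0_def \<beta>_def)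
  \<comment> \<open>The factor \<open>c > 1\<close> in \<open>A\<close> keeps the angle inside the
    open interval, at the cost of at most \<open>\<delta>\<close> at either end;
    \<open>\<delta>\<close> is arbitrary.\<close>
  have main: "pi - 2 * \<delta> \<le> sqrt lam * path_length M g \<gamma>" if \<delta>: "0 < \<delta>" "\<delta> < pi / 2" for \<delta>
  proof -
    have "profile \<beta> (pi - \<delta>) < exp (\<beta> * pi)"
      using profile_strict_mono[of "pi - \<delta>" pi \<beta>] \<delta> profile_pi by simp
    \<comment> \<open>For \<open>c\<close> close to 1, the value
      \<open>exp (\<beta> * pi) / c\<close> of the profile at \<open>\<theta> P\<close> exceeds its
      value at \<open>pi - \<delta>\<close>; by \<open>e2\<close>, the value \<open>- 1 / c\<close>,
      taken at \<open>\<theta> Q\<close> if \<open>k > 0\<close>, is below its value at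
      \<open>\<delta>\<close>.\<close>
    then have e1: "\<forall>\<^sub>F c in at_right 1. c * profile \<beta> (pi - \<delta>) < exp (\<beta> * pi)"
      by (intro order_tendstoD(2)[where y = "1 * profile \<beta> (pi - \<delta>)"] tendsto_intros) auto
    have "-1 < profile \<beta> \<delta>"
      using profile_strict_mono[of 0 \<delta> \<beta>] \<delta> profile_0 by simp
    then have e2: "\<forall>\<^sub>F c in at_right 1. -1 < c * profile \<beta> \<delta>"
      by (intro order_tendstoD(1)[where y = "1 * profile \<beta> \<delta>"] tendsto_intros) auto
    have e3: "\<forall>\<^sub>F c in at_right (1::real). 1 < c" by (simp add: eventually_at_filter)
    obtain c where c: "c * profile \<beta> (pi - \<delta>) < exp (\<beta> * pi)" "-1 < c * profile \<beta> \<delta>" "1 < c"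
      using eventually_happens[OF eventually_conj[OF e1 eventually_conj[OF e2 e3]]] by auto
    define A where "A = \<sigma> * c * k0"
    have s0: "\<sigma> \<noteq> 0" using \<sigma> by auto
    have A: "A \<noteq> 0" using s0 c k0 by (simp add: A_def)
    have uA: "u p / A = (\<sigma> * u p) / (c * k0)" for p
    proof -
      have "(\<sigma> * u p) / (c * k0) = (\<sigma> * (\<sigma> * u p)) / (\<sigma> * (c * k0))" using s0 by simp
      also have "\<sigma> * (\<sigma> * u p) = u p" using \<sigma> by (simp add: mult.assoc[symmetric])
      finally show ?thesis by (simp add: A_def mult.assoc)
    qed
    have ck: "c * k0 > 0" "k0 < c * k0" using c k0 by auto
    have rngA: "u p / A \<in> {-1<..<exp (\<beta> * pi)}" if "p \<in> mcarrier M" for p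
    proof -
      have "- (c * k0) < \<sigma> * u p" using rng[OF that] kk0 ck by linarith
      moreover have "\<sigma> * u p < (c * k0) * exp (\<beta> * pi)"
      proof -
        have "K = k0 * exp (\<beta> * pi)" using k0 by (simp add: field_simps)
        then have "K < (c * k0) * exp (\<beta> * pi)"
          using mult_strict_right_mono[OF ck(2), of "exp (\<beta> * pi)"] by simp
        then show ?thesis using rng[OF that] by linarith
      qed
      ultimately show ?thesis unfolding uA using ck by (simp add: field_simps)
    qed
    define \<theta> where "\<theta> = (\<lambda>p. profile_inv \<beta> (u p / A))"
    have eig': "laplacian M g u p = - (\<mu>\<^sup>2 * (1 + \<beta>\<^sup>2)) * u p" if "p \<in> mcarrier M" for p
      using eig[OF that] \<mu> by simp
    note est = angle_gradient_estimate[OF comp ric u eig' A rngA \<theta>_def]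
    have "\<bar>\<theta> (\<gamma> 1) - \<theta> (\<gamma> 0)\<bar> \<le> \<mu> * path_length M g \<gamma>"
      by (rule path_length_bound[OF \<gamma> est(1) \<mu>(1) est(2)])
    moreover have "\<bar>\<theta> (\<gamma> 1) - \<theta> (\<gamma> 0)\<bar> = \<bar>\<theta> P - \<theta> Q\<bar>"
      using PQ(5) by (auto simp: doubleton_eq_iff)
    ultimately have len: "\<theta> P - \<theta> Q \<le> \<mu> * path_length M g \<gamma>" by simp
    have \<theta>: "\<theta> p \<in> {0<..<pi}" "profile \<beta> (\<theta> p) = (\<sigma> * u p) / (c * k0)" if "p \<in> mcarrier M" for p
      using profile_inv[OF rngA[OF that]] uA by (auto simp: \<theta>_def)
    have less: "s < t" if "profile \<beta> s < profile \<beta> t" "s \<in> {0..pi}" "t \<in> {0..pi}" for s t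
    proof (rule ccontr)
      assume "\<not> s < t"
      then have "t = s \<or> t < s" by auto
      then show False using profile_strict_mono[of t s \<beta>] that by auto
    qed
    have \<theta>P: "pi - \<delta> < \<theta> P"
    proof (rule less)
      have "profile \<beta> (\<theta> P) = exp (\<beta> * pi) / c"
        unfolding \<theta>(2)[OF PQ(1)] PQ(3) k0(2)[symmetric] by simp
      then show "profile \<beta> (pi - \<delta>) < profile \<beta> (\<theta> P)"
        using c by (simp add: pos_less_divide_eq mult.commute)
    qed (use \<delta> \<theta>(1)[OF PQ(1)] in auto)
    show ?thesis
    proof (cases "k > 0")
      case True
      have "\<theta> Q < \<delta>"
      proof (rule less)
        have "profile \<beta> (\<theta> Q) = - 1 / c"
          unfolding \<theta>(2)[OF PQ(2)] PQ(4) using kk0(2)[OF True] k0(1) by simp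
        then show "profile \<beta> (\<theta> Q) < profile \<beta> \<delta>"
          using c pos_divide_less_eq[of c "- 1" "profile \<beta> \<delta>"] by (simp add: mult.commute)
      qed (use \<delta> \<theta>(1)[OF PQ(2)] in auto)
      then have "pi - 2 * \<delta> \<le> \<mu> * path_length M g \<gamma>" using \<theta>P len by linarith
      also have "\<mu> \<le> sqrt lam"
        unfolding \<mu>_def using lam b1 by (intro real_sqrt_le_mono) (simp add: field_simps)
      then have "\<mu> * path_length M g \<gamma> \<le> sqrt lam * path_length M g \<gamma>"
        by (rule mult_right_mono[OF _ nonneg])
      finally show ?thesis .
    next
      case False
      then have k: "k = 0" "\<beta> = sqrt 3" using kK by (auto simp: \<beta>_def)
      \<comment> \<open>At \<open>\<theta> Q\<close> the profile vanishes, while at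
        \<open>pi / 2\<close> the cosine term is absent and the profile is positive.\<close>
      have "\<theta> Q < pi / 2"
      proof (rule less)
        have "profile \<beta> (\<theta> Q) = 0" using \<theta>(2)[OF PQ(2)] PQ(4) k(1) by simp
        moreover have "profile \<beta> (pi / 2) > 0" by (simp add: profile_def k(2))
        ultimately show "profile \<beta> (\<theta> Q) < profile \<beta> (pi / 2)" by simp
      qed (use \<theta>(1)[OF PQ(2)] in auto)
      then have "pi / 2 - \<delta> \<le> \<mu> * path_length M g \<gamma>" using \<theta>P len by linarith
      moreover have "\<mu> = sqrt lam / 2"
        by (simp add: \<mu>_def k real_sqrt_divide)
      ultimately show ?thesis by simp
    qed
  qed
  show ?thesis
  proof (rule ccontr)
    assume neg: "\<not> pi \<le> sqrt lam * path_length M g \<gamma>"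
    \<comment> \<open>The supposed deficit. With \<open>\<delta> = x / 4\<close> the bound would
      read \<open>pi - x / 2 \<le> pi - x\<close>.\<close>
    define x where "x = pi - sqrt lam * path_length M g \<gamma>"
    have "x > 0" using neg by (simp add: x_def)
    moreover have "x \<le> pi" using nonneg lam by (simp add: x_def)
    moreover have "pi - 2 * (x / 4) \<le> sqrt lam * path_length M g \<gamma>"
      by (rule main) (use calculation pi_gt_zero in linarith)+
    moreover have "sqrt lam * path_length M g \<gamma> = pi - x" by (simp add: x_def)
    ultimately show False by linarith
  qed
qed

end

theorem theorem1p1:
  fixes M :: "'a mfd" and g :: "'a rmetric" and \<F> :: "'a mfd set" and lam :: real
  assumes "riemannian_manifold M g"
    and "compact_space (mtop M)" and "connected_space (mtop M)"
    and "nonneg_ricci M g"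
    and "singular_riemannian_foliation M g \<F>"
    and "closed_leaves M \<F>"
    and "basic_mean_curvature M g \<F>"
    and "first_nonzero_basic_eigenvalue M g \<F> lam"
  shows "lam \<ge> pi\<^sup>2 / (leaf_space_diameter M g \<F>)\<^sup>2"
proof -
  interpret riemannian M g
    using assms(1) by unfold_locales (auto simp: riemannian_manifold_def)
  note foliation = assms(5)[unfolded singular_riemannian_foliation_def]
  have leaves: "mcarrier L \<subseteq> mcarrier M \<and> mcarrier L \<noteq> {}" if "L \<in> \<F>" for L
    using conjunct1[OF foliation] that unfolding immersed_submanifold_def by blast
  have cover: "\<exists>L\<in>\<F>. p \<in> mcarrier L" if "p \<in> mcarrier M" for p
    using conjunct1[OF conjunct2[OF foliation]] that by blast
  obtain u p0 where u: "smooth_function M u" and basic: "basic_function \<F> u"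
    and p0: "p0 \<in> mcarrier M" "u p0 \<noteq> 0"
    and eig: "\<And>p. p \<in> mcarrier M \<Longrightarrow> laplacian M g u p = - lam * u p"
    using assms(8) unfolding first_nonzero_basic_eigenvalue_def basic_eigenvalue_def by blast
  have lam0: "lam \<noteq> 0" using assms(8) unfolding first_nonzero_basic_eigenvalue_def by blast
  have ne: "mcarrier M \<noteq> {}" using p0 by blast
  obtain P where P: "P \<in> mcarrier M" "\<And>q. q \<in> mcarrier M \<Longrightarrow> u q \<le> u P"
    using smooth_function_attains_max[OF assms(2) ne u] by blast
  have um: "smooth_function M (\<lambda>q. (-1) * u q)"
    by (intro smooth_functionI smooth_near_cmult smooth_function_near[OF u])
  obtain Q where Q: "Q \<in> mcarrier M" "\<And>q. q \<in> mcarrier M \<Longrightarrow> u Q \<le> u q"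
    using smooth_function_attains_max[OF assms(2) ne um] by auto
  have max: "lam * u P \<ge> 0" using laplacian_at_max[OF u P] eig[OF P(1)] by simp
  have min: "lam * u Q \<le> 0" using laplacian_at_min[OF u Q] eig[OF Q(1)] by simp
  have QP: "u Q \<le> u p0" "u p0 \<le> u P" using P(2) Q(2) p0 by auto
  \<comment> \<open>For negative \<open>lam\<close> the signs of the Laplacian at the extrema would
    force the maximum to be at most 0 and the minimum at least 0, so \<open>u\<close> would vanish
    at \<open>p0\<close>.\<close>
  have lam: "lam > 0"
  proof (rule ccontr)
    assume "\<not> lam > 0"
    then have "lam < 0" using lam0 by simp
    then have "u P \<le> 0" "u Q \<ge> 0" using max min by (auto simp: zero_le_mult_iff mult_le_0_iff)
    then show False using QP p0(2) by linarith
  qed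
  have PQ: "u P \<ge> 0" "u Q \<le> 0" using max min lam by (auto simp: zero_le_mult_iff mult_le_0_iff)
  obtain L where L: "L \<in> \<F>" "Q \<in> mcarrier L" using cover[OF Q(1)] by blast
  obtain L' where L': "L' \<in> \<F>" "P \<in> mcarrier L'" using cover[OF P(1)] by blast
  have "pi / sqrt lam \<le> leaf_space_diameter M g \<F>"
  proof (rule leaf_space_diameter_ge[OF assms(2,3) leaves L(1) L'(1)])
    fix \<gamma> assume \<gamma>: "piecewise_smooth_path M \<gamma>" "\<gamma> 0 \<in> mcarrier L" "\<gamma> 1 \<in> mcarrier L'"
    \<comment> \<open>A path between the two leaves need not pass through \<open>P\<close> and
      \<open>Q\<close>, but \<open>u\<close> is basic and takes its extreme values on all of these
      leaves.\<close>
    have ends: "u (\<gamma> 0) = u Q" "u (\<gamma> 1) = u P"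
      using basic L L' \<gamma>(2,3) unfolding basic_function_def by blast+
    have inM: "\<gamma> 0 \<in> mcarrier M" "\<gamma> 1 \<in> mcarrier M" using \<gamma>(2,3) leaves L L' by blast+
    note nn = path_length_nonneg[OF \<gamma>(1)]
    have "pi \<le> sqrt lam * path_length M g \<gamma>"
    proof (cases "- u Q \<le> u P")
      case True
      \<comment> \<open>If the extreme value of larger modulus were 0, then \<open>u p0\<close>
        would be 0.\<close>
      have "0 < u P" using True QP p0(2) PQ by linarith
      then show ?thesis
        using nodal_path_length[OF assms(2,4) u eig lam, of 1 "- u Q" "u P" \<gamma> "\<gamma> 1" "\<gamma> 0"]
          True PQ P(2) Q(2) \<gamma>(1) inM ends nn by auto
    next
      case False
      then have "0 < - u Q" using PQ by linarith
      \<comment> \<open>For \<open>- u\<close> maximum and minimum are exchanged, and with them the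
        end points of the path.\<close>
      then show ?thesis
        using nodal_path_length[OF assms(2,4) u eig lam, of "-1" "u P" "- u Q" \<gamma> "\<gamma> 0" "\<gamma> 1"]
          False PQ P(2) Q(2) \<gamma>(1) inM ends nn by auto
    qed
    then show "pi / sqrt lam \<le> path_length M g \<gamma>"
      using lam by (simp add: pos_divide_le_eq mult.commute)
  qed
  moreover have "0 < pi / sqrt lam" using lam by simp
  ultimately have "(pi / sqrt lam)\<^sup>2 \<le> (leaf_space_diameter M g \<F>)\<^sup>2"
      and d: "leaf_space_diameter M g \<F> > 0"
    by (auto intro: power_mono)
  then have "pi\<^sup>2 / lam \<le> (leaf_space_diameter M g \<F>)\<^sup>2" using lam by (simp add: power_divide)
  then show ?thesis using lam d by (simp add: field_simps)
qed

end
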